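(* Let $m\ge 2$ and $n\ge 1$ be integers, let $A=(a_{i_1\cdots i_m})$ be an $n$-dimensional $m$th order complex hypermatrix, and let $a_0(m,n)$ be the constant term (the coefficient of $\lambda^0$) of its E-characteristic polynomial $\psi_A(\lambda)$. If $m$ is even, then $$a_0(m,n)=\mathrm{Res}_x(Ax^{m-1}).$$ If $m$ is odd, then $$a_0(m,n)=\big(\mathrm{Res}_x(Ax^{m-1})\big)^2.$$
   Context: For a hypermatrix $A$ and $x=(x_1,\dots,x_n)^T$, $Ax^{m-1}$ is the vector with components $(Ax^{m-1})_i=\sum_{i_2,\dots,i_m=1}^n a_{ii_2\cdots i_m}x_{i_2}\cdots x_{i_m}$. $\mathrm{Res}$ denotes the classical multipolynomial resultant of $N$ homogeneous polynomials (of prescribed degrees $d_1,\dots,d_N$) in $N$ variables, normalized by $\mathrm{Res}(x_1^{d_1},\dots,x_N^{d_N})=1$. $\mathrm{Res}_x(Ax^{m-1})$ is the resultant of the $n$ components of $Ax^{m-1}$ in $x_1,\dots,x_n$ (degrees $m-1$). The E-characteristic polynomial: for $m$ even, $\psi_A(\lambda)=\mathrm{Res}_x\big(Ax^{m-1}-\lambda(x^Tx)^{(m-2)/2}x\big)$ ($n$ forms of degree $m-1$ in $x_1,\dots,x_n$). For $m$ odd, $\psi_A(\lambda)$ is the resultant in the $n+1$ variables $(x_1,\dots,x_n,x_0)$ of the $n$ components of $Ax^{m-1}-\lambda x_0^{m-2}x$ (degree $m-1$) together with $x^Tx-x_0^2$ (degree $2$). Here $x^Tx=\sum_i x_i^2$.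 *)

theory Defs
  imports
    Complex_Main
    "HOL-Library.Poly_Mapping"
    "HOL-Computational_Algebra.Polynomial"
    "HOL-Computational_Algebra.Factorial_Ring"
begin

text \<open>
  A multivariate polynomial with variables in \<open>'v\<close> and coefficients in \<open>'a\<close> is an element of
  \<open>('v \<Rightarrow>\<^sub>0 nat) \<Rightarrow>\<^sub>0 'a\<close>, a finitely supported function from exponent vectors to coefficients, with
  the convolution product of \<^theory>\<open>HOL-Library.Poly_Mapping\<close>.
\<close>

type_synonym ('v, 'a) mpoly = "('v \<Rightarrow>\<^sub>0 nat) \<Rightarrow>\<^sub>0 'a"

definition mvar :: "'v \<Rightarrow> ('v, 'a::comm_ring_1) mpoly" where
  "mvar v = Poly_Mapping.single (Poly_Mapping.single v 1) 1"

definition mconst :: "'a \<Rightarrow> ('v, 'a::comm_ring_1) mpoly" where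
  "mconst c = Poly_Mapping.single 0 c"

definition meval :: "('b \<Rightarrow> 'a) \<Rightarrow> ('v \<Rightarrow> 'a) \<Rightarrow> ('v, 'b::zero) mpoly \<Rightarrow> 'a::comm_ring_1" where
  "meval \<phi> x p =
     (\<Sum>\<alpha>\<in>Poly_Mapping.keys p. \<phi> (Poly_Mapping.lookup p \<alpha>) *
        (\<Prod>v\<in>Poly_Mapping.keys \<alpha>. x v ^ Poly_Mapping.lookup \<alpha> v))"

text \<open>
  Forms of degree \<open>d\<close> in the \<open>N\<close> variables with indices \<open>0, \<dots>, N - 1\<close> (the zero polynomial is a
  form of every degree).
\<close>

definition exponents :: "nat \<Rightarrow> nat \<Rightarrow> (nat \<Rightarrow>\<^sub>0 nat) set" where
  "exponents N d =
     {\<alpha>. Poly_Mapping.keys \<alpha> \<subseteq> {..<N} \<and> (\<Sum>j<N. Poly_Mapping.lookup \<alpha> j) = d}"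

definition is_form :: "nat \<Rightarrow> nat \<Rightarrow> (nat, 'a::zero) mpoly \<Rightarrow> bool" where
  "is_form N d p \<longleftrightarrow> Poly_Mapping.keys p \<subseteq> exponents N d"

text \<open>
  The generic system of forms has one indeterminate \<open>(i, \<alpha>)\<close> for the coefficient of the monomial
  with exponent \<open>\<alpha>\<close> in the \<open>i\<close>-th form; \<open>res_eval R F\<close> substitutes for these the actual coefficients
  of the system \<open>F\<close>, in an arbitrary commutative ring.
\<close>

type_synonym cvar = "nat \<times> (nat \<Rightarrow>\<^sub>0 nat)"

definition res_eval :: "(cvar, int) mpoly \<Rightarrow> (nat \<Rightarrow> (nat, 'a::comm_ring_1) mpoly) \<Rightarrow> 'a" where
  "res_eval R F = meval of_int (\<lambda>(i, \<alpha>). Poly_Mapping.lookup (F i) \<alpha>) R"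

definition has_nontrivial_zero :: "nat \<Rightarrow> (nat \<Rightarrow> (nat, complex) mpoly) \<Rightarrow> bool" where
  "has_nontrivial_zero N F \<longleftrightarrow>
     (\<exists>x. (\<exists>j<N. x j \<noteq> 0) \<and> (\<forall>i<N. meval (\<lambda>c. c) x (F i) = 0))"

text \<open>
  The classical characterization of the multipolynomial resultant of \<open>N\<close> forms of positive degrees
  \<open>d 0, \<dots>, d (N - 1)\<close> in \<open>N\<close> variables (Cox, Little, O'Shea, Using Algebraic Geometry,
  Chapter 3, Theorem 2.3): it is the unique integer polynomial in the coefficients of the generic
  forms that vanishes precisely at the complex systems with a nontrivial common zero, has value 1
  at the pure powers, and is irreducible, even over the complex numbers.
\<close>

definition is_resultant :: "nat \<Rightarrow> (nat \<Rightarrow> nat) \<Rightarrow> (cvar, int) mpoly \<Rightarrow> bool" where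
  "is_resultant N d R \<longleftrightarrow>
     (\<forall>\<mu>\<in>Poly_Mapping.keys R. Poly_Mapping.keys \<mu> \<subseteq> (SIGMA i:{..<N}. exponents N (d i))) \<and>
     (\<forall>F :: nat \<Rightarrow> (nat, complex) mpoly. (\<forall>i<N. is_form N (d i) (F i)) \<longrightarrow>
        (res_eval R F = 0 \<longleftrightarrow> has_nontrivial_zero N F)) \<and>
     res_eval R (\<lambda>i. mvar i ^ d i :: (nat, int) mpoly) = 1 \<and>
     irreducible R \<and>
     irreducible (Poly_Mapping.map of_int R :: (cvar, complex) mpoly)"

definition generic_resultant :: "nat \<Rightarrow> (nat \<Rightarrow> nat) \<Rightarrow> (cvar, int) mpoly" where
  "generic_resultant N d = (THE R. is_resultant N d R)"

definition Res :: "nat \<Rightarrow> (nat \<Rightarrow> nat) \<Rightarrow> (nat \<Rightarrow> (nat, 'a::comm_ring_1) mpoly) \<Rightarrow> 'a" where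
  "Res N d F = res_eval (generic_resultant N d) F"

text \<open>
  An \<open>n\<close>-dimensional hypermatrix of order \<open>m\<close> is a function on index lists, of which only the lists
  of length \<open>m\<close> with entries in \<open>{..<n}\<close> matter; indices are shifted to start at 0.
  \<open>tensor_form n m A i\<close> is the \<open>i\<close>-th component of \<open>A x^(m-1)\<close>.
\<close>

definition tensor_form ::
    "nat \<Rightarrow> nat \<Rightarrow> (nat list \<Rightarrow> 'a::comm_ring_1) \<Rightarrow> nat \<Rightarrow> (nat, 'a) mpoly" where
  "tensor_form n m A i =
     (\<Sum>js\<in>{js. length js = m - 1 \<and> set js \<subseteq> {..<n}}. mconst (A (i # js)) * (\<Prod>j\<leftarrow>js. mvar j))"

definition square_sum :: "nat \<Rightarrow> (nat, 'a::comm_ring_1) mpoly" where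
  "square_sum n = (\<Sum>j<n. mvar j ^ 2)"

text \<open>
  The E-characteristic polynomial is a resultant over the ring of univariate polynomials in
  \<open>\<lambda> = [:0, 1:]\<close>. For odd \<open>m\<close> the additional variable \<open>x_0\<close> has index \<open>n\<close>, i.e. it is the last one.
\<close>

definition E_char_poly :: "nat \<Rightarrow> nat \<Rightarrow> (nat list \<Rightarrow> complex) \<Rightarrow> complex poly" where
  "E_char_poly n m A =
     (let A' = (\<lambda>is. [:A is:]); lam = mconst [:0, 1:] in
      if even m then
        Res n (\<lambda>_. m - 1)
          (\<lambda>i. tensor_form n m A' i - lam * square_sum n ^ ((m - 2) div 2) * mvar i)
      else
        Res (n + 1) (\<lambda>i. if i < n then m - 1 else 2)
          (\<lambda>i. if i < n then tensor_form n m A' i - lam * mvar n ^ (m - 2) * mvar i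
               else square_sum n - mvar n ^ 2))"

end

theory Submission
  imports
    Defs
    "HOL-Library.Product_Lexorder"
    "HOL-Analysis.Continuum_Not_Denumerable"
    "HOL-Computational_Algebra.Fundamental_Theorem_Algebra"
    "Jordan_Normal_Form.Determinant"
begin

text \<open>
  For even \<open>m\<close> it suffices to put \<open>\<lambda> = 0\<close> in the coefficients of the system. For odd \<open>m\<close> the constant
  term is the resultant of \<open>F = A x ^ (m - 1)\<close> together with \<open>x\<^sup>T x - x\<^sub>0\<^sup>2\<close>; as a polynomial in the
  coefficients of \<open>F\<close> it has the same zeros as the irreducible resultant of \<open>F\<close>, hence it is a constant
  multiple of a power of it, and comparing the degrees in the coefficients of \<open>F\<^sub>0\<close> gives the square.

  This needs the existence and the degrees of the resultant. The polynomials that vanish at all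
  systems with a zero \<open>(1, x\<^sub>1, \<dots>)\<close> form a prime ideal, the kernel of the substitution that solves for
  the coefficients of the powers of \<open>x\<^sub>0\<close>. It contains no nonzero polynomial independent of one of
  these coefficients, so that by Gauss's lemma it is generated by an irreducible \<open>R\<close>. By the
  Nullstellensatz each system without nontrivial zeros is avoided by some determinant in the ideal, hence
  by \<open>R\<close>. Macaulay's determinants, which are 1 at the pure powers, normalize \<open>R\<close> and bound its degrees.
\<close>

text \<open>\<open>Res\<close> is defined through \<open>THE\<close>, so nothing can be said about
  it before \<open>is_resultant\<close> is shown to have exactly one solution; most of the proof
  serves this purpose. The working description is \<open>resultant_poly\<close>, and
  \<open>is_resultant_iff\<close> identifies the two. Both coefficient domains are needed:
  factorization is done over the integers, where the generator lives, while zeros, limits and the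
  Nullstellensatz concern complex systems. To pass between them, the finitely many coefficients of a
  complex polynomial are expanded over the integers. That the generator stays irreducible over the
  complex numbers is due to the ideal being prime there as well. For odd \<open>m\<close>, equality
  of zero sets leaves an exponent and a constant undetermined. The exponent requires exact degrees
  in the coefficients of one form, e^(n-1) and 2 e^(n-1) with e = m - 1, so that upper bounds do not
  suffice. The constant is read off at one system, where the sign (-1)^(e^n) is 1 because e is even
  and n is positive.\<close>

abbreviation "keys \<equiv> Poly_Mapping.keys"
abbreviation "lookup \<equiv> Poly_Mapping.lookup"
abbreviation "single \<equiv> Poly_Mapping.single"

section \<open>Evaluation and substitution\<close>

lemma poly_mapping_additive_induct [case_names zero single add]:
  fixes p :: "'b \<Rightarrow>\<^sub>0 'c::comm_monoid_add"
  assumes "P 0" "\<And>k c. P (single k c)" "\<And>p q. P p \<Longrightarrow> P q \<Longrightarrow> P (p + q)"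
  shows "P p"
proof -
  have "P (\<Sum>k\<in>K. single k (lookup p k))" if "finite K" for K
    using that by (induction K) (auto intro: assms)
  moreover have "p = (\<Sum>k\<in>keys p. single k (lookup p k))"
    by (rule poly_mapping_eqI)
       (auto simp: lookup_sum lookup_single when_def sum.delta in_keys_iff)
  ultimately show ?thesis by (metis finite_keys)
qed

definition mon :: "('v \<Rightarrow> 'a::comm_ring_1) \<Rightarrow> ('v \<Rightarrow>\<^sub>0 nat) \<Rightarrow> 'a" where
  "mon x \<alpha> = (\<Prod>v\<in>keys \<alpha>. x v ^ lookup \<alpha> v)"

lemma mon_superset:
  assumes "finite S" "keys \<alpha> \<subseteq> S"
  shows "mon x \<alpha> = (\<Prod>v\<in>S. x v ^ lookup \<alpha> v)"
  unfolding mon_def by (rule prod.mono_neutral_left) (use assms in \<open>auto simp: in_keys_iff\<close>)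

lemma mon_0 [simp]: "mon x 0 = 1"
  by (simp add: mon_def)

lemma mon_add: "mon x (\<alpha> + \<beta>) = mon x \<alpha> * mon x \<beta>"
proof -
  let ?S = "keys \<alpha> \<union> keys \<beta>"
  have "mon x (\<alpha> + \<beta>) = (\<Prod>v\<in>?S. x v ^ lookup (\<alpha> + \<beta>) v)"
    by (rule mon_superset) (use keys_add[of \<alpha> \<beta>] in auto)
  also have "\<dots> = (\<Prod>v\<in>?S. x v ^ lookup \<alpha> v) * (\<Prod>v\<in>?S. x v ^ lookup \<beta> v)"
    by (simp add: lookup_add power_add prod.distrib)
  also have "\<dots> = mon x \<alpha> * mon x \<beta>"
    by (simp add: mon_superset[of ?S])
  finally show ?thesis .
qed

lemma mon_single [simp]: "mon x (single v k) = x v ^ k"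
  by (auto simp: mon_def)

lemma mon_cong: "(\<And>v. v \<in> keys \<alpha> \<Longrightarrow> x v = y v) \<Longrightarrow> mon x \<alpha> = mon y \<alpha>"
  by (auto simp: mon_def intro!: prod.cong)

lemma mon_mult: "mon (\<lambda>v. x v * y v) \<alpha> = mon x \<alpha> * mon y \<alpha>"
  by (simp add: mon_def power_mult_distrib prod.distrib)

lemma (in comm_ring_hom) hom_mon: "hom (mon x \<alpha>) = mon (\<lambda>v. hom (x v)) \<alpha>"
  by (simp add: mon_def hom_distribs)

lemma mon_mvar: "mon mvar \<alpha> = (single \<alpha> 1 :: ('v, 'a::comm_ring_1) mpoly)"
proof (induction \<alpha> rule: poly_mapping_additive_induct)
  case (single v k)
  have "(mvar v :: ('v, 'a) mpoly) ^ k = Poly_Mapping.single (Poly_Mapping.single v k) 1"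
    by (induction k) (auto simp: mvar_def mult_single single_add[symmetric])
  then show ?case by simp
qed (auto simp: mon_add mult_single)

abbreviation peval :: "('v \<Rightarrow> 'a) \<Rightarrow> ('v, 'a::comm_ring_1) mpoly \<Rightarrow> 'a" where
  "peval \<equiv> meval (\<lambda>c. c)"

lemma meval_superset:
  assumes "finite S" "keys p \<subseteq> S" "\<phi> 0 = 0"
  shows "meval \<phi> x p = (\<Sum>\<alpha>\<in>S. \<phi> (lookup p \<alpha>) * mon x \<alpha>)"
  unfolding meval_def mon_def[symmetric]
  by (rule sum.mono_neutral_left) (use assms in \<open>auto simp: in_keys_iff\<close>)

lemma meval_keys: "meval \<phi> x p = (\<Sum>\<alpha>\<in>keys p. \<phi> (lookup p \<alpha>) * mon x \<alpha>)"
  by (simp add: meval_def mon_def)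

lemma meval_zero [simp]: "meval \<phi> x 0 = 0"
  by (simp add: meval_def)

lemma meval_single: "\<phi> 0 = 0 \<Longrightarrow> meval \<phi> x (single \<alpha> c) = \<phi> c * mon x \<alpha>"
  by (simp add: meval_keys)

lemma meval_add:
  assumes "\<phi> 0 = 0" "\<And>a b. \<phi> (a + b) = \<phi> a + \<phi> b"
  shows "meval \<phi> x (p + q) = meval \<phi> x p + meval \<phi> x q"
proof -
  let ?S = "keys p \<union> keys q"
  have "keys (p + q) \<subseteq> ?S" by (rule keys_add)
  then show ?thesis
    using assms by (simp add: meval_superset[of ?S] lookup_add algebra_simps sum.distrib)
qed

lemma comm_ring_hom_meval:
  assumes "comm_ring_hom \<phi>"
  shows "comm_ring_hom (meval \<phi> x)"
proof -
  interpret comm_ring_hom \<phi> by fact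
  have add: "meval \<phi> x (p + q) = meval \<phi> x p + meval \<phi> x q" for p q
    by (rule meval_add) (auto simp: hom_distribs)
  show ?thesis
  proof
    show "meval \<phi> x (p * q) = meval \<phi> x p * meval \<phi> x q" for p q
    proof (induction p rule: poly_mapping_additive_induct)
      case (single \<alpha> a)
      show ?case
        by (induction q rule: poly_mapping_additive_induct)
           (auto simp: mult_single meval_single mon_add hom_distribs algebra_simps add)
    qed (auto simp: algebra_simps add)
    show "meval \<phi> x 1 = 1"
      by (simp add: meval_keys)
  qed (auto simp: add)
qed

lemma meval_mconst [simp]: "comm_ring_hom \<phi> \<Longrightarrow> meval \<phi> x (mconst c) = \<phi> c"
proof -
  assume "comm_ring_hom \<phi>"
  then interpret comm_ring_hom \<phi> .
  show ?thesis by (simp add: mconst_def meval_single)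
qed

lemma meval_mvar [simp]: "comm_ring_hom \<phi> \<Longrightarrow> meval \<phi> x (mvar v) = x v"
proof -
  assume "comm_ring_hom \<phi>"
  then interpret comm_ring_hom \<phi> .
  show ?thesis by (simp add: mvar_def meval_single)
qed

lemma single_eq: "single \<alpha> c = mconst c * mon mvar \<alpha>"
  by (simp add: mon_mvar mconst_def mult_single)

lemma mpoly_eq_sum: "p = (\<Sum>\<alpha>\<in>keys p. mconst (lookup p \<alpha>) * mon mvar \<alpha>)"
  unfolding single_eq[symmetric]
  by (rule poly_mapping_eqI)
     (auto simp: lookup_sum lookup_single when_def sum.delta in_keys_iff)

lemma comm_ring_hom_mconst: "comm_ring_hom mconst"
  by unfold_locales (auto simp: mconst_def single_add mult_single)

interpretation mconst: comm_ring_hom mconst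
  by (rule comm_ring_hom_mconst)

lemma comm_ring_hom_id: "comm_ring_hom (\<lambda>c. c)"
  by unfold_locales auto

lemma comm_ring_hom_of_int: "comm_ring_hom of_int"
  by unfold_locales auto

lemma comm_ring_hom_comp:
  assumes "comm_ring_hom f" "comm_ring_hom g" shows "comm_ring_hom (\<lambda>x. f (g x))"
proof -
  interpret f: comm_ring_hom f by fact
  interpret g: comm_ring_hom g by fact
  show ?thesis by unfold_locales (auto simp: hom_distribs)
qed

lemma comm_ring_hom_pconst: "comm_ring_hom (\<lambda>c::'a::comm_ring_1. [:c:])"
  by unfold_locales auto

lemma comm_ring_hom_poly: "comm_ring_hom (\<lambda>p::'a::comm_ring_1 poly. poly p c)"
  by unfold_locales auto

lemma (in comm_ring_hom) hom_meval:
  "hom (meval \<phi> x p) = meval (\<lambda>c. hom (\<phi> c)) (\<lambda>v. hom (x v)) p"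
  by (simp add: meval_keys hom_distribs hom_mon)

lemma meval_meval:
  assumes "comm_ring_hom \<phi>"
  shows "meval \<phi> x (meval mconst \<sigma> p) = meval \<phi> (\<lambda>v. meval \<phi> x (\<sigma> v)) p"
  using comm_ring_hom.hom_meval[OF comm_ring_hom_meval[OF assms], of x mconst \<sigma> p] assms
  by simp

lemma meval_mconst_mvar [simp]: "meval mconst mvar p = p"
  by (simp add: meval_keys mpoly_eq_sum[symmetric])

text \<open>Extension of scalars, written as a substitution so that the homomorphism property comes
  from \<open>comm_ring_hom_meval\<close>; \<open>map_int_eq\<close> links it to the
  \<open>Poly_Mapping.map\<close> in \<open>is_resultant\<close>.\<close>

definition map_int :: "('v, int) mpoly \<Rightarrow> ('v, 'a::comm_ring_1) mpoly" where
  "map_int p = meval (\<lambda>c. mconst (of_int c)) mvar p"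

lemma comm_ring_hom_map_int: "comm_ring_hom map_int"
  unfolding map_int_def
  by (intro comm_ring_hom_meval comm_ring_hom_comp[OF comm_ring_hom_mconst] comm_ring_hom_of_int)

interpretation map_int: comm_ring_hom map_int
  by (rule comm_ring_hom_map_int)

lemma lookup_map_int [simp]: "lookup (map_int p) \<alpha> = of_int (lookup p \<alpha>)"
  unfolding map_int_def meval_keys single_eq[symmetric]
  by (auto simp: lookup_sum lookup_single when_def sum.delta in_keys_iff)

lemma map_int_eq: "Poly_Mapping.map of_int p = map_int p"
  by (rule poly_mapping_eqI) (simp add: Poly_Mapping.map.rep_eq when_def)

lemma meval_map_int:
  "comm_ring_hom \<phi> \<Longrightarrow> meval \<phi> x (map_int p) = meval of_int x p"
proof -
  assume \<phi>: "comm_ring_hom \<phi>"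
  then interpret \<phi>: comm_ring_hom \<phi> .
  interpret comm_ring_hom "meval \<phi> x" by (rule comm_ring_hom_meval[OF \<phi>])
  show ?thesis
    unfolding map_int_def hom_meval using \<phi> by (simp add: hom_distribs)
qed

lemma map_int_mvar [simp]: "map_int (mvar v) = mvar v"
  and map_int_mconst [simp]: "map_int (mconst c) = mconst (of_int c)"
  unfolding map_int_def
  by (simp_all add: comm_ring_hom_comp[OF comm_ring_hom_mconst comm_ring_hom_of_int])

section \<open>Variables of a polynomial, and polynomial rings as subsets of one type\<close>

definition vars :: "('v, 'a::zero) mpoly \<Rightarrow> 'v set" where
  "vars p = (\<Union>\<alpha>\<in>keys p. keys \<alpha>)"

lemma finite_vars [simp]: "finite (vars p)"
  by (simp add: vars_def)

lemma meval_cong: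
  "(\<And>v. v \<in> vars p \<Longrightarrow> x v = y v) \<Longrightarrow> meval \<phi> x p = meval \<phi> y p"
  unfolding meval_keys by (intro sum.cong arg_cong2[of _ _ _ _ "(*)"] mon_cong refl) (auto simp: vars_def)

text \<open>Coefficient rings are handled as sets, not as types: inductions on the number of
  variables pass between polynomial rings that all live in the same type.\<close>

definition subring :: "'a::comm_ring_1 set \<Rightarrow> bool" where
  "subring S \<longleftrightarrow> 0 \<in> S \<and> 1 \<in> S \<and> (\<forall>a\<in>S. \<forall>b\<in>S. a + b \<in> S \<and> a - b \<in> S \<and> a * b \<in> S)"

lemma subringD:
  assumes "subring S"
  shows "0 \<in> S" "1 \<in> S" "a \<in> S \<Longrightarrow> b \<in> S \<Longrightarrow> a + b \<in> S" "a \<in> S \<Longrightarrow> b \<in> S \<Longrightarrow> a - b \<in> S"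
    "a \<in> S \<Longrightarrow> b \<in> S \<Longrightarrow> a * b \<in> S" "a \<in> S \<Longrightarrow> - a \<in> S" "a \<in> S \<Longrightarrow> a ^ n \<in> S"
    "(\<And>i. i \<in> I \<Longrightarrow> f i \<in> S) \<Longrightarrow> sum f I \<in> S" "(\<And>i. i \<in> I \<Longrightarrow> f i \<in> S) \<Longrightarrow> prod f I \<in> S"
proof -
  have *: "0 \<in> S" "1 \<in> S" "\<And>a b. a \<in> S \<Longrightarrow> b \<in> S \<Longrightarrow> a + b \<in> S"
    "\<And>a b. a \<in> S \<Longrightarrow> b \<in> S \<Longrightarrow> a - b \<in> S" "\<And>a b. a \<in> S \<Longrightarrow> b \<in> S \<Longrightarrow> a * b \<in> S"
    using assms by (auto simp: subring_def)
  show "0 \<in> S" "1 \<in> S" "a \<in> S \<Longrightarrow> b \<in> S \<Longrightarrow> a + b \<in> S" "a \<in> S \<Longrightarrow> b \<in> S \<Longrightarrow> a - b \<in> S"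
    "a \<in> S \<Longrightarrow> b \<in> S \<Longrightarrow> a * b \<in> S" by fact+
  show "a \<in> S \<Longrightarrow> - a \<in> S" using *(4)[of 0 a] *(1) by simp
  show "a \<in> S \<Longrightarrow> a ^ n \<in> S" by (induction n) (use * in auto)
  show "(\<And>i. i \<in> I \<Longrightarrow> f i \<in> S) \<Longrightarrow> sum f I \<in> S"
    by (induction I rule: infinite_finite_induct) (use * in auto)
  show "(\<And>i. i \<in> I \<Longrightarrow> f i \<in> S) \<Longrightarrow> prod f I \<in> S"
    by (induction I rule: infinite_finite_induct) (use * in auto)
qed

lemma meval_in_subring:
  assumes "subring S" "\<And>c. \<phi> c \<in> S" "\<And>v. v \<in> vars p \<Longrightarrow> x v \<in> S"
  shows "meval \<phi> x p \<in> S"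
  unfolding meval_keys mon_def using assms(2,3)
  by (auto intro!: subringD[OF assms(1)] simp: vars_def)

definition mpolys :: "'v set \<Rightarrow> ('v, 'a::comm_ring_1) mpoly set" where
  "mpolys V = {p. vars p \<subseteq> V}"

lemma mpolys_mono: "V \<subseteq> W \<Longrightarrow> mpolys V \<subseteq> mpolys W"
  by (auto simp: mpolys_def)

lemma subring_mpolys: "subring (mpolys V)"
  unfolding subring_def mpolys_def mem_Collect_eq
proof (intro conjI ballI)
  fix p q :: "('a, 'b) mpoly" assume pq: "p \<in> {p. vars p \<subseteq> V}" "q \<in> {p. vars p \<subseteq> V}"
  have "keys (p - q) \<subseteq> keys p \<union> keys q"
    by (auto simp: in_keys_iff lookup_minus)
  then have "vars (p - q) \<subseteq> vars p \<union> vars q" "vars (p + q) \<subseteq> vars p \<union> vars q"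
    using keys_add[of p q] unfolding vars_def by blast+
  then show "vars (p + q) \<subseteq> V" "vars (p - q) \<subseteq> V" using pq by auto
  show "vars (p * q) \<subseteq> V"
  proof
    fix v assume "v \<in> vars (p * q)"
    then obtain \<gamma> where "\<gamma> \<in> keys (p * q)" "v \<in> keys \<gamma>" by (auto simp: vars_def)
    then obtain \<alpha> \<beta> where "\<alpha> \<in> keys p" "\<beta> \<in> keys q" "v \<in> keys (\<alpha> + \<beta>)"
      using keys_mult[of p q] by blast
    then show "v \<in> V" using keys_add[of \<alpha> \<beta>] pq unfolding vars_def by blast
  qed
qed (auto simp: vars_def)

lemma mvar_in_mpolys: "v \<in> V \<Longrightarrow> mvar v \<in> mpolys V"
  by (auto simp: mpolys_def vars_def mvar_def split: if_splits)

lemma mconst_in_mpolys [simp]: "mconst c \<in> mpolys V"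
  by (auto simp: mpolys_def vars_def mconst_def split: if_splits)

lemma meval_mconst_in_mpolys:
  "(\<And>v. v \<in> vars p \<Longrightarrow> \<sigma> v \<in> mpolys V) \<Longrightarrow> meval mconst \<sigma> p \<in> mpolys V"
  by (rule meval_in_subring[OF subring_mpolys]) auto

lemma mpolys_empty: "p \<in> mpolys {} \<Longrightarrow> \<exists>c. p = mconst c"
proof -
  assume "p \<in> mpolys {}"
  then have "keys p \<subseteq> {0}" by (auto simp: mpolys_def vars_def)
  then have "p = mconst (lookup p 0)"
    by (intro poly_mapping_eqI) (auto simp: mconst_def lookup_single when_def in_keys_iff)
  then show ?thesis ..
qed

lemma vars_map_int: "vars (map_int p :: ('v, 'a::{comm_ring_1,ring_char_0}) mpoly) = vars p"
  by (auto simp: vars_def in_keys_iff)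

section \<open>A multivariate polynomial as a univariate one\<close>

text \<open>The coefficients keep the type of the polynomial although they no longer involve
  \<open>v\<close> (\<open>as_poly_in_polys_over\<close>); evaluation at \<open>mvar v\<close> is
  the inverse operation.\<close>

definition as_poly :: "'v \<Rightarrow> ('v, 'a::comm_ring_1) mpoly \<Rightarrow> ('v, 'a) mpoly poly" where
  "as_poly v = meval (\<lambda>c. [:mconst c:]) (\<lambda>w. if w = v then [:0, 1:] else [:mvar w:])"

lemma comm_ring_hom_pconst_mconst: "comm_ring_hom (\<lambda>c. [:mconst c:])"
  by (rule comm_ring_hom_comp[OF comm_ring_hom_pconst comm_ring_hom_mconst])

lemma comm_ring_hom_as_poly: "comm_ring_hom (as_poly v)"
  unfolding as_poly_def by (rule comm_ring_hom_meval[OF comm_ring_hom_pconst_mconst])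

interpretation as_poly: comm_ring_hom "as_poly v" for v
  by (rule comm_ring_hom_as_poly)

lemma poly_as_poly [simp]: "poly (as_poly v p) (mvar v) = p"
proof -
  interpret comm_ring_hom "\<lambda>q. poly q (mvar v)" by (rule comm_ring_hom_poly)
  have "(\<lambda>w. poly (if w = v then [:0, 1:] else [:mvar w:]) (mvar v)) = (mvar :: _ \<Rightarrow> ('a,'b) mpoly)"
    by auto
  then show ?thesis unfolding as_poly_def hom_meval by simp
qed

lemma as_poly_inject: "as_poly v p = as_poly v q \<longleftrightarrow> p = q"
  by (metis poly_as_poly)

lemma as_poly_eq_0_iff [simp]: "as_poly v p = 0 \<longleftrightarrow> p = 0"
  using as_poly_inject[of v p 0] by simp

definition polys_over :: "'a::comm_ring_1 set \<Rightarrow> 'a poly set" where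
  "polys_over S = {p. \<forall>i. coeff p i \<in> S}"

lemma subring_polys_over:
  assumes "subring S" shows "subring (polys_over S)"
  unfolding subring_def polys_over_def
  by (auto simp: coeff_mult coeff_1 intro!: subringD[OF assms])

lemma pconst_in_polys_over: "subring S \<Longrightarrow> c \<in> S \<Longrightarrow> [:c:] \<in> polys_over S"
  by (auto simp: polys_over_def coeff_pCons subringD split: nat.splits)

lemma var_in_polys_over: "subring S \<Longrightarrow> [:0, 1:] \<in> polys_over S"
  by (auto simp: polys_over_def coeff_pCons subringD split: nat.splits)

lemma as_poly_in_polys_over:
  assumes "p \<in> mpolys V" shows "as_poly v p \<in> polys_over (mpolys (V - {v}))"
  unfolding as_poly_def
proof (rule meval_in_subring)
  fix w assume "w \<in> vars p"
  then show "(if w = v then [:0, 1:] else [:mvar w:]) \<in> polys_over (mpolys (V - {v}))"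
    using assms subsetD[of "vars p" V w]
    by (auto intro!: var_in_polys_over pconst_in_polys_over mvar_in_mpolys subring_mpolys
        simp: mpolys_def[of V])
qed (auto intro!: subring_polys_over pconst_in_polys_over subring_mpolys)

lemma poly_in_mpolys:
  assumes "q \<in> polys_over (mpolys V)" "V \<subseteq> W" "v \<in> W"
  shows "poly q (mvar v) \<in> mpolys W"
  unfolding poly_altdef using assms mpolys_mono[OF assms(2)]
  by (auto simp: polys_over_def intro!: subringD[OF subring_mpolys] mvar_in_mpolys)

lemma as_poly_const:
  assumes "v \<notin> vars p" shows "as_poly v p = [:p:]"
proof -
  interpret comm_ring_hom "\<lambda>c. [:c:] :: ('a, 'b) mpoly poly" by (rule comm_ring_hom_pconst)
  have "[:p:] = [:meval mconst mvar p:]" by simp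
  also have "\<dots> = as_poly v p"
    unfolding hom_meval as_poly_def by (rule meval_cong) (use assms in auto)
  finally show ?thesis ..
qed

lemma degree_as_poly_0_iff: "Polynomial.degree (as_poly v p) = 0 \<longleftrightarrow> v \<notin> vars p"
proof
  assume "Polynomial.degree (as_poly v p) = 0"
  then have c: "as_poly v p = [:coeff (as_poly v p) 0:]" by (simp add: degree_0_id)
  have "p = poly (as_poly v p) (mvar v)" by simp
  also have "\<dots> = coeff (as_poly v p) 0" by (subst c) simp
  finally have "p = coeff (as_poly v p) 0" .
  moreover have "coeff (as_poly v p) 0 \<in> mpolys (UNIV - {v})"
    using as_poly_in_polys_over[of p UNIV v] by (auto simp: polys_over_def mpolys_def)
  ultimately show "v \<notin> vars p" by (auto simp: mpolys_def)
qed (auto simp: as_poly_const)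

text \<open>Degrees in \<open>v\<close> add up in a product over an integral domain. The order on
  the variables induces the order on monomials that makes the polynomials an integral
  domain.\<close>

lemma vars_dvd:
  fixes a p :: "('v::linorder, 'a::idom) mpoly"
  assumes "a dvd p" "p \<noteq> 0" shows "vars a \<subseteq> vars p"
proof
  fix v assume v: "v \<in> vars a"
  obtain b where p: "p = a * b" using assms by auto
  have "as_poly v p = as_poly v a * as_poly v b" by (simp add: p as_poly.hom_mult)
  then have "Polynomial.degree (as_poly v p) =
      Polynomial.degree (as_poly v a) + Polynomial.degree (as_poly v b)"
    using assms p by (simp add: degree_mult_eq)
  then show "v \<in> vars p" using v degree_as_poly_0_iff[of v a] degree_as_poly_0_iff[of v p] by auto
qed

lemma vars_1 [simp]: "vars 1 = {}"
  by (simp add: vars_def)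

lemma mconst_eq_iff [simp]: "mconst a = mconst b \<longleftrightarrow> a = b"
  by (metis lookup_single_eq mconst_def)

lemma mconst_eq_0_iff [simp]: "mconst a = 0 \<longleftrightarrow> a = 0"
  using mconst_eq_iff[of a 0] by (simp del: mconst_eq_iff)

lemma unit_mpoly:
  fixes a :: "('v::linorder, 'a::idom) mpoly"
  assumes "a dvd 1" shows "\<exists>c. a = mconst c \<and> c dvd 1"
proof -
  obtain b where b: "1 = a * b" using assms by auto
  have "vars a \<subseteq> {}" "vars b \<subseteq> {}"
    using vars_dvd[OF assms] vars_dvd[of b 1] dvd_triv_right[of b a] unfolding b[symmetric] by simp_all
  then obtain c d where cd: "a = mconst c" "b = mconst d"
    using mpolys_empty unfolding mpolys_def by blast
  have "mconst (c * d) = (mconst 1 :: ('v, 'a) mpoly)"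
    using b unfolding mconst.hom_mult mconst.hom_one cd by simp
  then have "c * d = 1" by (simp only: mconst_eq_iff)
  then show ?thesis using cd by (metis dvd_triv_left)
qed

lemma mconst_dvd_1: "c dvd 1 \<Longrightarrow> mconst c dvd (1 :: ('v, 'a::comm_ring_1) mpoly)"
  by (metis mconst.hom_dvd_1)

section \<open>Unique factorization over the integers\<close>

text \<open>Each reduction step multiplies \<open>f\<close> by the leading coefficient of
  \<open>w\<close> instead of dividing by it, whence the power \<open>k\<close>; quotient and
  remainder therefore stay over \<open>S\<close>.\<close>

lemma pseudo_division:
  fixes f w :: "'a::idom poly"
  assumes S: "subring S" and w: "w \<in> polys_over S" "w \<noteq> 0" and f: "f \<in> polys_over S"
  shows "\<exists>q r k. q \<in> polys_over S \<and> r \<in> polys_over S \<and>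
    Polynomial.smult (lead_coeff w ^ k) f = q * w + r \<and> (r = 0 \<or> degree r < degree w)"
proof -
  note P = subring_polys_over[OF S]
  have lc: "lead_coeff p \<in> S" if "p \<in> polys_over S" for p
    using that by (auto simp: polys_over_def)
  have "\<exists>q r k. q \<in> polys_over S \<and> r \<in> polys_over S \<and>
      Polynomial.smult (lead_coeff w ^ k) f = q * w + r \<and> (r = 0 \<or> degree r < degree w)"
    if "f = 0 \<or> degree f < n" "f \<in> polys_over S" for n f
    using that
  proof (induction n arbitrary: f)
    case 0
    then show ?case using subringD(1)[OF P] by (intro exI[of _ 0]) auto
  next
    case (Suc n)
    show ?case
    proof (cases "f = 0 \<or> degree f < degree w")
      case True
      then show ?thesis using Suc.prems subringD(1)[OF P]
        by (intro exI[of _ 0] exI[of _ f]) auto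
    next
      case False
      define m where "m = Polynomial.monom (lead_coeff f) (degree f - degree w)"
      define f' where "f' = Polynomial.smult (lead_coeff w) f - m * w"
      have m: "m \<in> polys_over S"
        using lc[OF Suc.prems(2)] subringD(1)[OF S] by (auto simp: m_def polys_over_def)
      have "Polynomial.smult (lead_coeff w) f \<in> polys_over S"
        using lc[OF w(1)] Suc.prems(2) by (auto simp: polys_over_def intro: subringD(5)[OF S])
      then have f': "f' \<in> polys_over S"
        unfolding f'_def by (intro subringD(4,5)[OF P] m w)
      have "degree (m * w) \<le> degree f"
        using False by (auto simp: m_def degree_mult_eq degree_monom_eq w)
      then have "degree f' \<le> degree f"
        unfolding f'_def by (intro degree_diff_le) auto
      moreover have "coeff f' (degree f) = 0"
        using False coeff_monom_mult[of "lead_coeff f" "degree f - degree w" w "degree f"]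
        by (simp add: f'_def m_def)
      ultimately have "f' = 0 \<or> degree f' < degree f"
        by (metis le_neq_implies_less leading_coeff_0_iff)
      then have "f' = 0 \<or> degree f' < n" using Suc.prems(1) by auto
      from Suc.IH[OF this f'] obtain q r k where q: "q \<in> polys_over S" "r \<in> polys_over S"
        "Polynomial.smult (lead_coeff w ^ k) f' = q * w + r" "r = 0 \<or> degree r < degree w" by auto
      have "Polynomial.smult (lead_coeff w ^ Suc k) f = Polynomial.smult (lead_coeff w ^ k) (f' + m * w)"
        by (simp add: f'_def mult.commute)
      also have "\<dots> = (q + Polynomial.smult (lead_coeff w ^ k) m) * w + r"
        by (simp add: smult_add_right q algebra_simps)
      finally have "Polynomial.smult (lead_coeff w ^ Suc k) f = (q + Polynomial.smult (lead_coeff w ^ k) m) * w + r" .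
      moreover have "q + Polynomial.smult (lead_coeff w ^ k) m \<in> polys_over S"
        using q(1) m subringD(7)[OF S lc[OF w(1)]]
        by (auto simp: polys_over_def intro!: subringD(3,5)[OF S])
      ultimately show ?thesis using q(2,4) by blast
    qed
  qed
  from this[of f "Suc (degree f)"] show ?thesis using f by auto
qed

text \<open>Substitute for principal ideals over the field of fractions: the remainder of
  pseudo-division lies in \<open>I\<close> and has smaller degree than \<open>w\<close>, hence
  vanishes.\<close>

lemma pseudo_generator:
  fixes w :: "'a::idom poly"
  assumes S: "subring S" and I: "I \<subseteq> polys_over S" "\<And>f g. f \<in> I \<Longrightarrow> g \<in> I \<Longrightarrow> f - g \<in> I"
    "\<And>f q. f \<in> I \<Longrightarrow> q \<in> polys_over S \<Longrightarrow> q * f \<in> I"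
    and w: "w \<in> I" "w \<noteq> 0" "\<And>f. f \<in> I \<Longrightarrow> f \<noteq> 0 \<Longrightarrow> degree w \<le> degree f" and f: "f \<in> I"
  shows "\<exists>q k. q \<in> polys_over S \<and> Polynomial.smult (lead_coeff w ^ k) f = q * w"
proof -
  obtain q r k where q: "q \<in> polys_over S" "Polynomial.smult (lead_coeff w ^ k) f = q * w + r"
    "r = 0 \<or> degree r < degree w"
    using pseudo_division[OF S _ w(2), of f] w(1) f I(1) by blast
  have lc: "lead_coeff w \<in> S" using w(1) I(1) by (auto simp: polys_over_def)
  have "r = [:lead_coeff w ^ k:] * f - q * w" using q(2) by simp
  also have "\<dots> \<in> I"
    by (intro I w f q pconst_in_polys_over S subringD(7)[OF S] lc)
  finally have "r \<in> I" .
  then have "r = 0" using w(3)[of r] q(3) by linarith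
  then show ?thesis using q by auto
qed

lemma ex_min_degree:
  fixes f :: "'a::zero poly"
  assumes "f \<in> I" "f \<noteq> 0"
  obtains w where "w \<in> I" "w \<noteq> 0" "\<And>g. g \<in> I \<Longrightarrow> g \<noteq> 0 \<Longrightarrow> degree w \<le> degree g"
  using ex_has_least_nat[of "\<lambda>w. w \<in> I \<and> w \<noteq> 0" f degree] assms by auto

text \<open>Gauss's argument: take the first coefficients of \<open>p\<close> and of
  \<open>q\<close> not divisible by \<open>f\<close>. The coefficient of \<open>p * q\<close> at the
  sum of their indices is their product plus multiples of \<open>f\<close>.\<close>

lemma const_dvd_mult_polys_over:
  fixes p q :: "'a::idom poly"
  assumes S: "subring S" and pq: "p \<in> polys_over S" "q \<in> polys_over S"
    and prime: "\<And>a b. a \<in> S \<Longrightarrow> b \<in> S \<Longrightarrow> f dvd a * b \<Longrightarrow> f dvd a \<or> f dvd b"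
    and dvd: "[:f:] dvd p * q"
  shows "[:f:] dvd p \<or> [:f:] dvd q"
proof (rule ccontr)
  assume "\<not> ([:f:] dvd p \<or> [:f:] dvd q)"
  then have ex: "\<exists>i. \<not> f dvd coeff p i" "\<exists>i. \<not> f dvd coeff q i"
    using const_poly_dvd_iff[of f p] const_poly_dvd_iff[of f q] by blast+
  define m where "m = (LEAST i. \<not> f dvd coeff p i)"
  define n where "n = (LEAST i. \<not> f dvd coeff q i)"
  have m: "\<not> f dvd coeff p m" and n: "\<not> f dvd coeff q n"
    using LeastI_ex[OF ex(1)] LeastI_ex[OF ex(2)] by (auto simp: m_def n_def)
  have mn: "f dvd coeff p i * coeff q (m + n - i)" if "i \<in> {..m + n} - {m}" for i
  proof (cases "i < m")
    case True
    then have "f dvd coeff p i" using not_less_Least unfolding m_def by blast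
    then show ?thesis by simp
  next
    case False
    then have "m + n - i < n" using that by auto
    then have "f dvd coeff q (m + n - i)" using not_less_Least unfolding n_def by blast
    then show ?thesis by simp
  qed
  have "f dvd coeff (p * q) (m + n)" using dvd by (simp add: const_poly_dvd_iff)
  also have "coeff (p * q) (m + n) = coeff p m * coeff q n +
      (\<Sum>i\<in>{..m + n} - {m}. coeff p i * coeff q (m + n - i))"
    unfolding coeff_mult by (subst sum.remove[of _ m]) auto
  finally have "f dvd coeff p m * coeff q n"
    using dvd_sum[of "{..m + n} - {m}" f "\<lambda>i. coeff p i * coeff q (m + n - i)"] mn dvd_add_left_iff
    by metis
  then show False using prime m n pq by (auto simp: polys_over_def)
qed

section \<open>Gradings, and induction along proper divisors over the integers\<close>

text \<open>An auxiliary variable scales the variables in \<open>W\<close>; the coefficient of its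
  k-th power is the component of degree k in these variables. For \<open>W = UNIV\<close> the degree
  is the total degree.\<close>

definition graded :: "'v set \<Rightarrow> ('v, 'a::comm_ring_1) mpoly \<Rightarrow> ('v, 'a) mpoly poly" where
  "graded W = meval (\<lambda>c. [:mconst c:]) (\<lambda>w. if w \<in> W then [:0, mvar w:] else [:mvar w:])"

lemma comm_ring_hom_graded: "comm_ring_hom (graded W)"
  unfolding graded_def by (rule comm_ring_hom_meval[OF comm_ring_hom_pconst_mconst])

interpretation graded: comm_ring_hom "graded W" for W
  by (rule comm_ring_hom_graded)

lemma poly_graded: "poly (graded W p) c = meval mconst (\<lambda>w. if w \<in> W then c * mvar w else mvar w) p"
proof -
  interpret comm_ring_hom "\<lambda>q. poly q c" by (rule comm_ring_hom_poly)
  have "(\<lambda>w. poly (if w \<in> W then [:0, mvar w:] else [:mvar w:]) c) =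
      (\<lambda>w. if w \<in> W then c * mvar w else (mvar w :: ('a, 'b) mpoly))" by auto
  then show ?thesis unfolding graded_def hom_meval by simp
qed

lemma poly_graded_1 [simp]: "poly (graded W p) 1 = p"
  by (simp add: poly_graded cong: if_cong)

lemma graded_eq_0_iff [simp]: "graded W p = 0 \<longleftrightarrow> p = 0"
  using poly_graded_1[of W p] by (metis graded.hom_zero poly_0)

lemma graded_in_polys_over: "p \<in> mpolys V \<Longrightarrow> graded W p \<in> polys_over (mpolys V)"
  unfolding graded_def
proof (rule meval_in_subring)
  fix w assume "p \<in> mpolys V" "w \<in> vars p"
  then have "w \<in> V" by (auto simp: mpolys_def)
  then show "(if w \<in> W then [:0, mvar w:] else [:mvar w:]) \<in> polys_over (mpolys V)"
    using subringD(1)[OF subring_mpolys]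
    by (auto simp: polys_over_def coeff_pCons mvar_in_mpolys split: nat.splits)
qed (auto intro!: subring_polys_over pconst_in_polys_over subring_mpolys)

lemma degree_graded_mult:
  fixes p q :: "('v::linorder, 'a::idom) mpoly"
  assumes "p \<noteq> 0" "q \<noteq> 0"
  shows "degree (graded W (p * q)) = degree (graded W p) + degree (graded W q)"
  using assms by (simp add: graded.hom_mult degree_mult_eq)

lemma degree_graded_UNIV_0: "degree (graded UNIV p) = 0 \<Longrightarrow> \<exists>c. p = mconst c"
proof -
  assume *: "degree (graded UNIV p) = 0"
  have "p = poly (graded UNIV p) 1" by simp
  also have "\<dots> = poly (graded UNIV p) 0" using degree_0_id[OF *] by (metis poly_pCons poly_0 mult_zero_right add_0_right)
  also have "\<dots> \<in> mpolys {}"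
    unfolding poly_graded by (rule meval_mconst_in_mpolys) (auto intro: subringD[OF subring_mpolys])
  finally show ?thesis by (rule mpolys_empty)
qed

text \<open>Splitting off a nonconstant factor lowers the total degree; splitting off an integer
  other than 1 and -1 lowers the sum of the absolute values of the coefficients.\<close>

definition int_size :: "('v, int) mpoly \<Rightarrow> nat \<times> nat" where
  "int_size p = (degree (graded UNIV p), \<Sum>\<alpha>\<in>keys p. nat \<bar>lookup p \<alpha>\<bar>)"

definition size_less :: "(('v, int) mpoly \<times> ('v, int) mpoly) set" where
  "size_less = inv_image (less_than <*lex*> less_than) int_size"

lemma wf_size_less: "wf size_less"
  by (auto simp: size_less_def)

lemma lookup_mult_mconst: "lookup (p * mconst c) \<alpha> = lookup p \<alpha> * c"
proof (induction p rule: poly_mapping_additive_induct)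
  case (single k a)
  then show ?case by (auto simp: mconst_def mult_single lookup_single when_def)
qed (auto simp: algebra_simps lookup_add)

lemma proper_divisor_size_less:
  fixes a b :: "('v::linorder, int) mpoly"
  assumes "a * b \<noteq> 0" "\<not> b dvd 1"
  shows "(a, a * b) \<in> size_less"
proof (cases "degree (graded UNIV b) = 0")
  case True
  then obtain c where c: "b = mconst c" using degree_graded_UNIV_0 by blast
  have "c \<noteq> 0" "\<not> c dvd 1" using assms c mconst_dvd_1[of c] by auto
  then have c2: "\<bar>c\<bar> \<ge> 2" by auto
  then have k: "keys (a * b) = keys a" by (auto simp: c in_keys_iff lookup_mult_mconst)
  have "a \<noteq> 0" using assms by auto
  then have "keys a \<noteq> {}" by (auto simp: poly_mapping_eq_iff fun_eq_iff in_keys_iff)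
  then have "(\<Sum>\<alpha>\<in>keys a. nat \<bar>lookup a \<alpha>\<bar>) < (\<Sum>\<alpha>\<in>keys a. nat \<bar>lookup a \<alpha> * c\<bar>)"
  proof (intro sum_strict_mono)
    fix \<alpha> assume "\<alpha> \<in> keys a"
    then have "\<bar>lookup a \<alpha>\<bar> > 0" by (auto simp: in_keys_iff)
    then have "\<bar>lookup a \<alpha>\<bar> * 1 < \<bar>lookup a \<alpha>\<bar> * \<bar>c\<bar>"
      using c2 by (intro mult_strict_left_mono) auto
    then show "nat \<bar>lookup a \<alpha>\<bar> < nat \<bar>lookup a \<alpha> * c\<bar>"
      unfolding abs_mult by simp
  qed auto
  moreover have "degree (graded UNIV (a * b)) = degree (graded UNIV a)"
    using assms True by (subst degree_graded_mult) auto
  ultimately show ?thesis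
    by (simp add: size_less_def int_size_def k) (simp add: c lookup_mult_mconst)
next
  case False
  then show ?thesis using assms by (auto simp: size_less_def int_size_def degree_graded_mult)
qed

lemma ex_irreducible_factor:
  fixes p :: "('v::linorder, int) mpoly"
  assumes "p \<noteq> 0" "\<not> p dvd 1"
  shows "\<exists>q. irreducible q \<and> q dvd p"
  using assms
proof (induction p rule: wf_induct_rule[OF wf_size_less])
  case (1 p)
  show ?case
  proof (cases "irreducible p")
    case False
    then obtain a b where ab: "p = a * b" "\<not> a dvd 1" "\<not> b dvd 1"
      using 1 by (auto simp: irreducible_def)
    then have "\<exists>q. irreducible q \<and> q dvd a"
      using 1 proper_divisor_size_less[of a b] by (intro 1) auto
    then show ?thesis using ab by auto
  qed auto
qed

lemma irreducible_dvd_imp_dvd: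
  assumes "irreducible f" "\<pi> dvd f" "\<not> \<pi> dvd 1" shows "f dvd \<pi>"
proof -
  obtain u where u: "f = \<pi> * u" using assms by auto
  then have "u dvd 1" using irreducibleD[OF assms(1) u] assms(3) by blast
  then obtain u' where "1 = u * u'" by (rule dvdE)
  then have "f * u' = \<pi>" by (simp add: u mult.assoc[symmetric]) (metis mult.assoc mult.right_neutral)
  then show ?thesis by auto
qed

lemma irreducible_mconst_prime:
  fixes c :: int
  assumes "irreducible (mconst c :: ('v::linorder, int) mpoly)"
  shows "prime_elem c"
proof (rule irreducible_imp_prime_elem, rule irreducibleI)
  show "c \<noteq> 0" using assms by auto
  show "\<not> c dvd 1" using assms mconst_dvd_1[of c] by (auto simp: irreducible_def)
  fix a b assume "c = a * b"
  then have "(mconst c :: ('v, int) mpoly) = mconst a * mconst b" by (simp add: mconst.hom_mult)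
  then have "(mconst a :: ('v, int) mpoly) dvd 1 \<or> (mconst b :: ('v, int) mpoly) dvd 1"
    using irreducibleD[OF assms] by simp
  then show "a dvd 1 \<or> b dvd 1" by (auto dest!: unit_mpoly)
qed

lemma as_poly_dvd_iff: "as_poly v f dvd as_poly v g \<longleftrightarrow> f dvd g"
proof
  assume "as_poly v f dvd as_poly v g"
  then have "poly (as_poly v f) (mvar v) dvd poly (as_poly v g) (mvar v)"
    by (metis dvd_def poly_mult)
  then show "f dvd g" by simp
qed auto

text \<open>Induction on the variables. With \<open>S\<close> the polynomials over \<open>V\<close>,
  the ideal of \<open>f\<close> and \<open>g\<close> in \<open>S[v]\<close> has a nonzero element
  \<open>w\<close> of minimal degree, and up to constants from \<open>S\<close> both
  \<open>f\<close> and \<open>g\<close> are multiples of it. As \<open>f\<close> is irreducible,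
  \<open>w\<close> or its cofactor in \<open>f\<close> lies in \<open>S\<close>; then
  \<open>f\<close> divides a constant multiple of \<open>h\<close> or of \<open>g\<close>, and the
  constant is removed prime by prime.\<close>

lemma irreducible_dvd_mult_mpolys:
  fixes f g h :: "('v::linorder, int) mpoly"
  assumes "finite V" "irreducible f" "f \<in> mpolys V" "g \<in> mpolys V" "h \<in> mpolys V" "f dvd g * h"
  shows "f dvd g \<or> f dvd h"
  using assms
proof (induction V arbitrary: f g h rule: finite_induct)
  case empty
  obtain a b c where abc: "f = mconst a" "g = mconst b" "h = mconst c"
    using empty mpolys_empty by blast
  obtain q where q: "g * h = f * q" using empty by auto
  have "lookup (q * mconst a) 0 = lookup (mconst b * mconst c :: ('v, int) mpoly) 0"
    using q abc by (simp add: mult.commute)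
  then have "lookup q 0 * a = b * c" by (simp only: lookup_mult_mconst) (simp add: mconst_def)
  then have "a dvd b * c" by (metis dvd_triv_right)
  then have "a dvd b \<or> a dvd c"
    using irreducible_mconst_prime empty abc by (metis prime_elem_dvd_mult_iff)
  then show ?case unfolding abc using mconst.hom_dvd by blast
next
  case (insert v V)
  let ?S = "mpolys V :: ('v, int) mpoly set" and ?W = "mpolys (insert v V) :: ('v, int) mpoly set"
  note S = subring_mpolys[of V, where 'b = int]
  note W = subring_mpolys[of "insert v V", where 'b = int]
  have SW: "?S \<subseteq> ?W" by (rule mpolys_mono) auto
  have ap: "as_poly v p \<in> polys_over ?S" if "p \<in> ?W" for p
    using as_poly_in_polys_over[OF that, of v] insert.hyps by simp
  have dvdS: "p \<in> mpolys U" if "p dvd q" "q \<noteq> 0" "q \<in> mpolys U" for p q :: "('v, int) mpoly" and U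
    using vars_dvd[OF that(1,2)] that(3) by (auto simp: mpolys_def)
  \<comment> \<open>An irreducible that is free of \<open>v\<close> is prime in \<open>S\<close> by
    the induction hypothesis; Gauss's lemma extends this to polynomials in \<open>v\<close>.\<close>
  have const_prime: "\<pi> dvd a \<or> \<pi> dvd b"
    if "irreducible \<pi>" "\<pi> \<in> ?S" "a \<in> ?W" "b \<in> ?W" "\<pi> dvd a * b" for \<pi> a b
  proof -
    have "v \<notin> vars \<pi>" using that(2) insert.hyps by (auto simp: mpolys_def)
    then have \<pi>: "as_poly v \<pi> = [:\<pi>:]" by (rule as_poly_const)
    have "[:\<pi>:] dvd as_poly v a * as_poly v b"
      using that(5) unfolding \<pi>[symmetric] as_poly.hom_mult[symmetric] by (simp add: as_poly_dvd_iff)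
    then have "[:\<pi>:] dvd as_poly v a \<or> [:\<pi>:] dvd as_poly v b"
      using insert.IH[OF that(1,2)] by (intro const_dvd_mult_polys_over[OF S ap[OF that(3)] ap[OF that(4)]])
    then show ?thesis by (simp add: \<pi>[symmetric] as_poly_dvd_iff)
  qed
  show ?case
  proof (cases "f \<in> ?S")
    case True
    then show ?thesis using const_prime insert.prems by blast
  next
    case fS: False
    have f0: "f \<noteq> 0" using insert.prems by auto
    have no_const: "\<pi> dvd 1" if "\<pi> \<in> ?S" "\<pi> \<noteq> 0" "\<pi> dvd f" for \<pi>
      using irreducible_dvd_imp_dvd[OF insert.prems(1) that(3)] dvdS[OF _ that(2,1)] fS by blast
    \<comment> \<open>An irreducible factor of \<open>l\<close> divides \<open>f * t\<close> but not
      \<open>f\<close>, so it divides \<open>t\<close> and cancels.\<close>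
    have cancel: "f dvd s" if "l \<in> ?S" "l \<noteq> 0" "s \<in> ?W" "f dvd l * s" for l s
      using that
    proof (induction l rule: wf_induct_rule[OF wf_size_less])
      case (1 l)
      show ?case
      proof (cases "l dvd 1 \<or> s = 0")
        case True
        then show ?thesis using 1(5) by (auto dest: unit_imp_dvd simp: dvd_mult_unit_iff')
      next
        case False
        then obtain \<pi> l' where \<pi>: "irreducible \<pi>" "l = l' * \<pi>"
          using ex_irreducible_factor[OF 1(3)] by (auto simp: dvd_def mult.commute)
        have S': "\<pi> \<in> ?S" "l' \<in> ?S" using dvdS[OF _ 1(3,2)] \<pi>(2) by auto
        obtain t where t: "l * s = f * t" using 1(5) by auto
        have "f * t \<noteq> 0" using t 1(3) False by auto
        moreover have "f * t \<in> ?W"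
          unfolding t[symmetric] using 1(2,4) SW by (intro subringD(5)[OF W]) auto
        ultimately have tW: "t \<in> ?W" by (rule dvdS[OF dvd_triv_right])
        have "\<pi> dvd f * t" unfolding t[symmetric] \<pi>(2) by simp
        then have "\<pi> dvd f \<or> \<pi> dvd t" using const_prime[OF \<pi>(1) S'(1) _ tW] insert.prems by blast
        moreover have "\<not> \<pi> dvd f" using no_const[OF S'(1)] \<pi>(1) by (auto simp: irreducible_def)
        ultimately obtain t' where "t = \<pi> * t'" by auto
        then have "\<pi> * (l' * s) = \<pi> * (f * t')" using t \<pi>(2) by (simp add: ac_simps)
        then have "f dvd l' * s" using \<pi>(1) by auto
        moreover have "(l', l) \<in> size_less"
          using proper_divisor_size_less[of l' \<pi>] \<pi> 1(3) by (auto simp: irreducible_def)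
        moreover have "l' \<noteq> 0" using 1(3) \<pi>(2) by auto
        ultimately show ?thesis using 1(1) S'(2) 1(4) by blast
      qed
    qed
    \<comment> \<open>Gauss's lemma for a factorization up to constants: each irreducible factor of
      \<open>l\<close> is cancelled against \<open>q\<close> or \<open>w\<close>, until a genuine
      factorization of \<open>f\<close> remains.\<close>
    have split: "q \<in> ?S \<or> w \<in> ?S" if "l \<in> ?S" "l \<noteq> 0" "q \<in> ?W" "w \<in> ?W" "l * f = q * w" for l q w
      using that
    proof (induction l arbitrary: q w rule: wf_induct_rule[OF wf_size_less])
      case (1 l)
      show ?case
      proof (cases "l dvd 1")
        case True
        then obtain l' where l': "1 = l * l'" by auto
        then have "f = (l' * q) * w" using 1(6) by (metis mult.assoc mult.commute mult_1)
        then have "l' * q dvd 1 \<or> w dvd 1" by (rule irreducibleD[OF insert.prems(1)])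
        then have "q dvd 1 \<or> w dvd 1" using dvd_mult_right by blast
        then show ?thesis using dvdS[of _ 1 V] subringD(2)[OF S] by auto
      next
        case False
        then obtain \<pi> l' where \<pi>: "irreducible \<pi>" "l = l' * \<pi>"
          using ex_irreducible_factor[OF 1(3)] by (auto simp: dvd_def mult.commute)
        have \<pi>0: "\<pi> \<noteq> 0" using \<pi>(1) by auto
        have S': "\<pi> \<in> ?S" "l' \<in> ?S" using dvdS[OF _ 1(3,2)] \<pi>(2) by auto
        have qw0: "q \<noteq> 0" "w \<noteq> 0" using 1(3,6) f0 by auto
        have less: "(l', l) \<in> size_less"
          using proper_divisor_size_less[of l' \<pi>] \<pi> 1(3) by (auto simp: irreducible_def)
        have "\<pi> dvd q * w" unfolding 1(6)[symmetric] \<pi>(2) by simp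
        then consider q' where "q = \<pi> * q'" | w' where "w = \<pi> * w'"
          using const_prime[OF \<pi>(1) S'(1) 1(4,5)] by (auto elim!: dvdE)
        then show ?thesis
        proof cases
          case 1
          have "\<pi> * (l' * f) = \<pi> * (q' * w)" using 1 \<open>l * f = q * w\<close> \<pi>(2) by (simp add: ac_simps)
          then have "l' * f = q' * w" using \<pi>0 by simp
          moreover have "q' \<in> ?W" using dvdS[of q' q] 1 qw0 \<open>q \<in> ?W\<close> by auto
          ultimately have "q' \<in> ?S \<or> w \<in> ?S"
            using "1.IH"[OF less S'(2)] \<pi>(2) \<open>l \<noteq> 0\<close> \<open>w \<in> ?W\<close> by auto
          then show ?thesis using 1 subringD(5)[OF S S'(1)] by auto
        next
          case 2
          have "\<pi> * (l' * f) = \<pi> * (q * w')" using 2 \<open>l * f = q * w\<close> \<pi>(2) by (simp add: ac_simps)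
          then have "l' * f = q * w'" using \<pi>0 by simp
          moreover have "w' \<in> ?W" using dvdS[of w' w] 2 qw0 \<open>w \<in> ?W\<close> by auto
          ultimately have "q \<in> ?S \<or> w' \<in> ?S"
            using "1.IH"[OF less S'(2)] \<pi>(2) \<open>l \<noteq> 0\<close> \<open>q \<in> ?W\<close> by auto
          then show ?thesis using 2 subringD(5)[OF S S'(1)] by auto
        qed
      qed
    qed
    define I where "I = {a * as_poly v f + b * as_poly v g | a b. a \<in> polys_over ?S \<and> b \<in> polys_over ?S}"
    note P = subring_polys_over[OF S]
    note apf = ap[OF insert.prems(2)] and apg = ap[OF insert.prems(3)]
    have II: "1 * as_poly v f + 0 * as_poly v g \<in> I" "0 * as_poly v f + 1 * as_poly v g \<in> I"
      using subringD(1,2)[OF P] unfolding I_def by blast+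
    then have fI: "as_poly v f \<in> I" and gI: "as_poly v g \<in> I" by simp_all
    have I: "I \<subseteq> polys_over ?S"
      unfolding I_def using apf apg by (auto intro!: subringD(3,5)[OF P])
    have I': "x - y \<in> I" if "x \<in> I" "y \<in> I" for x y
    proof -
      obtain a b c d where *: "x = a * as_poly v f + b * as_poly v g" "y = c * as_poly v f + d * as_poly v g"
        "a \<in> polys_over ?S" "b \<in> polys_over ?S" "c \<in> polys_over ?S" "d \<in> polys_over ?S"
        using \<open>x \<in> I\<close> \<open>y \<in> I\<close> unfolding I_def by auto
      have "x - y = (a - c) * as_poly v f + (b - d) * as_poly v g" by (simp add: * algebra_simps)
      then show ?thesis unfolding I_def using *(3-) subringD(4)[OF P] by blast
    qed
    have I'': "q * x \<in> I" if "x \<in> I" "q \<in> polys_over ?S" for x q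
    proof -
      obtain a b where *: "x = a * as_poly v f + b * as_poly v g"
        "a \<in> polys_over ?S" "b \<in> polys_over ?S"
        using \<open>x \<in> I\<close> unfolding I_def by auto
      have "q * x = (q * a) * as_poly v f + (q * b) * as_poly v g" by (simp add: * algebra_simps)
      then show ?thesis unfolding I_def using *(2-) that(2) subringD(5)[OF P] by blast
    qed
    obtain w where w: "w \<in> I" "w \<noteq> 0" "\<And>f. f \<in> I \<Longrightarrow> f \<noteq> 0 \<Longrightarrow> degree w \<le> degree f"
      using ex_min_degree[OF fI] f0 by auto
    define l where "l = lead_coeff w"
    have l: "l \<in> ?S" "l \<noteq> 0" using w I by (auto simp: l_def polys_over_def)
    obtain qf kf where qf: "qf \<in> polys_over ?S" "Polynomial.smult (l ^ kf) (as_poly v f) = qf * w"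
      using pseudo_generator[OF S I I' I'' w fI] unfolding l_def by blast
    obtain qg kg where qg: "qg \<in> polys_over ?S" "Polynomial.smult (l ^ kg) (as_poly v g) = qg * w"
      using pseudo_generator[OF S I I' I'' w gI] unfolding l_def by blast
    have lk: "l ^ k \<in> ?S" "l ^ k \<noteq> 0" for k using l subringD(7)[OF S] by auto
    have toW: "poly q (mvar v) \<in> ?W" if "q \<in> polys_over ?S" for q
      by (rule poly_in_mpolys[OF that]) auto
    let ?w = "poly w (mvar v)" and ?qf = "poly qf (mvar v)" and ?qg = "poly qg (mvar v)"
    have ef: "l ^ kf * f = ?qf * ?w" using arg_cong[OF qf(2), of "\<lambda>p. poly p (mvar v)"] by simp
    have eg: "l ^ kg * g = ?qg * ?w" using arg_cong[OF qg(2), of "\<lambda>p. poly p (mvar v)"] by simp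
    have ne: "?qf \<noteq> 0" "?w \<noteq> 0" using ef lk(2)[of kf] f0 by auto
    from split[OF lk toW[OF qf(1)] toW ef] w(1) I consider "?qf \<in> ?S" | "?w \<in> ?S" by blast
    then show ?thesis
    proof cases
      case 1
      have "(?qf * l ^ kg) * g = ?qg * (?qf * ?w)" using eg by (simp add: ac_simps)
      also have "\<dots> = f * (?qg * l ^ kf)" unfolding ef[symmetric] by (simp add: ac_simps)
      finally have "f dvd (?qf * l ^ kg) * g" by simp
      then have "f dvd g"
        using cancel[OF subringD(5)[OF S 1 lk(1)[of kg]] _ insert.prems(3)] ne(1) lk(2)[of kg] by simp
      then show ?thesis ..
    next
      case 2
      obtain a b where "w = a * as_poly v f + b * as_poly v g" using w(1) unfolding I_def by auto
      then have "?w = poly a (mvar v) * f + poly b (mvar v) * g" by simp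
      then have "?w * h = f * (poly a (mvar v) * h) + poly b (mvar v) * (g * h)"
        by (simp add: algebra_simps)
      then have "f dvd ?w * h" using insert.prems(5) by (metis dvd_add dvd_mult dvd_triv_left)
      then have "f dvd h" by (rule cancel[OF 2 ne(2) insert.prems(4)])
      then show ?thesis ..
    qed
  qed
qed

theorem irreducible_imp_prime_elem_mpoly:
  fixes f :: "('v::linorder, int) mpoly"
  assumes "irreducible f" shows "prime_elem f"
proof (rule prime_elemI)
  fix g h assume *: "f dvd g * h"
  let ?V = "vars f \<union> vars g \<union> vars h"
  show "f dvd g \<or> f dvd h"
    by (rule irreducible_dvd_mult_mpolys[of ?V]) (use assms * in \<open>auto simp: mpolys_def\<close>)
qed (use assms in \<open>auto simp: irreducible_def\<close>)

section \<open>Polynomials as functions, and the Nullstellensatz\<close>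

lemma (in comm_ring_hom) hom_poly: "hom (poly p x) = (\<Sum>i\<le>degree p. hom (coeff p i) * hom x ^ i)"
  by (simp add: poly_altdef hom_distribs)

lemma coeffs_eq_0_if_vanishing:
  fixes a :: "nat \<Rightarrow> 'a::{idom,ring_char_0}"
  assumes "\<And>c. (\<Sum>i\<le>d. a i * c ^ i) = 0" "i \<le> d"
  shows "a i = 0"
proof -
  let ?q = "\<Sum>i\<le>d. Polynomial.monom (a i) i"
  have "\<forall>c. poly ?q c = 0" using assms(1) by (simp add: poly_sum poly_monom)
  then have "?q = 0" by (simp only: poly_all_0_iff_0)
  then have "coeff ?q i = 0" by simp
  then show ?thesis using assms(2) by (simp add: coeff_sum)
qed

text \<open>For fixed values of the other variables the polynomial vanishes at every value of
  \<open>v\<close>, of which there are infinitely many in characteristic 0. So its coefficients with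
  respect to \<open>v\<close> vanish everywhere, and they involve fewer variables.\<close>

lemma mpoly_eq_0_if_vanishing:
  fixes p :: "('v, 'a::{idom,ring_char_0}) mpoly"
  assumes "\<And>x. peval x p = 0"
  shows "p = 0"
proof -
  have "p = 0" if "finite V" "p \<in> mpolys V" "\<forall>x. peval x p = 0"
    for V and p :: "('v, 'a) mpoly"
    using that
  proof (induction V arbitrary: p rule: finite_induct)
    case empty
    then obtain c where c: "p = mconst c" using mpolys_empty by blast
    have "peval (\<lambda>_. 0) p = 0" using empty by blast
    then show ?case by (simp add: c comm_ring_hom_id)
  next
    case (insert v V)
    let ?P = "as_poly v p"
    have c: "coeff ?P i \<in> mpolys V" for i
      using as_poly_in_polys_over[OF insert.prems(1), of v] insert.hyps by (simp add: polys_over_def)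
    have "coeff ?P i = 0" if i: "i \<le> degree ?P" for i
    proof (rule insert.IH[OF c], rule allI)
      fix x :: "'v \<Rightarrow> 'a"
      show "peval x (coeff ?P i) = 0"
      proof (rule coeffs_eq_0_if_vanishing[OF _ i])
        fix t
        interpret comm_ring_hom "peval (x(v := t))"
          by (intro comm_ring_hom_meval comm_ring_hom_id)
        have "peval (x(v := t)) (coeff ?P j) = peval x (coeff ?P j)" for j
          using c[of j] insert.hyps by (intro meval_cong) (auto simp: mpolys_def)
        then have "(\<Sum>i\<le>degree ?P. peval x (coeff ?P i) * t ^ i) =
            peval (x(v := t)) (poly ?P (mvar v))"
          unfolding hom_poly by (simp add: comm_ring_hom_id)
        also have "\<dots> = 0" using insert.prems(2) by simp
        finally show "(\<Sum>i\<le>degree ?P. peval x (coeff ?P i) * t ^ i) = 0" .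
      qed
    qed
    then have "lead_coeff ?P = 0" by blast
    then show ?case by simp
  qed
  from this[of "vars p" p] assms show ?thesis by (auto simp: mpolys_def)
qed

lemma map_int_eq_0_iff [simp]:
  "(map_int p :: ('v, 'a::{comm_ring_1,ring_char_0}) mpoly) = 0 \<longleftrightarrow> p = 0"
  by (auto simp: poly_mapping_eq_iff fun_eq_iff)

section \<open>The Nullstellensatz over the complex numbers\<close>

lemma nontrivial_linear_relation:
  fixes f :: "'b \<Rightarrow> nat \<Rightarrow> 'a::field"
  assumes "finite C" "card C > D"
  shows "\<exists>a. (\<exists>c\<in>C. a c \<noteq> 0) \<and> (\<forall>k<D. (\<Sum>c\<in>C. a c * f c k) = 0)"
  using assms
proof (induction D arbitrary: C f)
  case 0
  then have "C \<noteq> {}" by auto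
  then show ?case by (intro exI[of _ "\<lambda>_. 1"]) auto
next
  case (Suc D)
  show ?case
  proof (cases "\<forall>c\<in>C. f c D = 0")
    case True
    obtain a where "\<exists>c\<in>C. a c \<noteq> 0" "\<forall>k<D. (\<Sum>c\<in>C. a c * f c k) = 0"
      using Suc.IH[of C f] Suc.prems by auto
    then show ?thesis using True by (intro exI[of _ a]) (auto simp: less_Suc_eq)
  next
    case False
    then obtain c0 where c0: "c0 \<in> C" "f c0 D \<noteq> 0" by auto
    let ?C = "C - {c0}"
    \<comment> \<open>Subtracting a multiple of the vector at \<open>c0\<close> clears coordinate
      \<open>D\<close> in the other vectors.\<close>
    define g where "g = (\<lambda>c k. f c k - f c D / f c0 D * f c0 k)"
    have "card ?C > D" using Suc.prems c0 by simp
    then obtain a where a: "\<exists>c\<in>?C. a c \<noteq> 0" "\<forall>k<D. (\<Sum>c\<in>?C. a c * g c k) = 0"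
      using Suc.IH[of ?C g] Suc.prems by auto
    define a' where "a' = a(c0 := - (\<Sum>c\<in>?C. a c * (f c D / f c0 D)))"
    have "(\<Sum>c\<in>C. a' c * f c k) = (\<Sum>c\<in>?C. a c * g c k)" for k
    proof -
      have "(\<Sum>c\<in>C. a' c * f c k) = a' c0 * f c0 k + (\<Sum>c\<in>?C. a' c * f c k)"
        using Suc.prems c0 by (intro sum.remove) auto
      also have "(\<Sum>c\<in>?C. a' c * f c k) = (\<Sum>c\<in>?C. a c * f c k)"
        by (intro sum.cong) (auto simp: a'_def)
      finally show ?thesis
        by (simp add: a'_def g_def algebra_simps sum_subtractf sum_distrib_left)
    qed
    moreover have "(\<Sum>c\<in>?C. a c * g c D) = 0" using c0 by (simp add: g_def)
    moreover have "\<exists>c\<in>C. a' c \<noteq> 0" using a by (auto simp: a'_def)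
    ultimately show ?thesis using a by (intro exI[of _ a']) (auto simp: less_Suc_eq)
  qed
qed

definition mideal :: "('v, 'a::comm_ring_1) mpoly set \<Rightarrow> bool" where
  "mideal J \<longleftrightarrow> 0 \<in> J \<and> (\<forall>p\<in>J. \<forall>q\<in>J. p + q \<in> J) \<and> (\<forall>a. \<forall>p\<in>J. a * p \<in> J)"

lemma midealD:
  assumes "mideal J"
  shows "0 \<in> J" "p \<in> J \<Longrightarrow> q \<in> J \<Longrightarrow> p + q \<in> J" "p \<in> J \<Longrightarrow> a * p \<in> J" "p \<in> J \<Longrightarrow> p * a \<in> J"
    "p \<in> J \<Longrightarrow> q \<in> J \<Longrightarrow> p - q \<in> J" "(\<And>i. i \<in> I \<Longrightarrow> f i \<in> J) \<Longrightarrow> sum f I \<in> J"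
proof -
  have *: "0 \<in> J" "\<And>p q. p \<in> J \<Longrightarrow> q \<in> J \<Longrightarrow> p + q \<in> J" "\<And>a p. p \<in> J \<Longrightarrow> a * p \<in> J"
    using assms by (auto simp: mideal_def)
  show "0 \<in> J" "p \<in> J \<Longrightarrow> q \<in> J \<Longrightarrow> p + q \<in> J" "p \<in> J \<Longrightarrow> a * p \<in> J" by fact+
  show "p \<in> J \<Longrightarrow> p * a \<in> J" using *(3)[of p a] by (simp add: mult.commute)
  show "p \<in> J \<Longrightarrow> q \<in> J \<Longrightarrow> p - q \<in> J" using *(2)[of p "- q"] *(3)[of q "-1"] by simp
  show "(\<And>i. i \<in> I \<Longrightarrow> f i \<in> J) \<Longrightarrow> sum f I \<in> J"
    by (induction I rule: infinite_finite_induct) (use * in auto)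
qed

definition adjoin :: "('v, 'a::comm_ring_1) mpoly set \<Rightarrow> ('v, 'a) mpoly \<Rightarrow> ('v, 'a) mpoly set" where
  "adjoin J q = {j + a * q | j a. j \<in> J}"

lemma mideal_adjoin: assumes "mideal J" shows "mideal (adjoin J q)"
  unfolding mideal_def
proof (intro conjI ballI allI)
  show "0 \<in> adjoin J q" unfolding adjoin_def using midealD(1)[OF assms]
    by (auto intro!: exI[of _ 0])
  fix x y a assume x: "x \<in> adjoin J q"
  then obtain j b where j: "x = j + b * q" "j \<in> J" by (auto simp: adjoin_def)
  have "a * x = a * j + (a * b) * q" by (simp add: j algebra_simps)
  then show "a * x \<in> adjoin J q" unfolding adjoin_def using midealD(3)[OF assms j(2)] by blast
  assume "y \<in> adjoin J q"
  then obtain j' b' where j': "y = j' + b' * q" "j' \<in> J" by (auto simp: adjoin_def)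
  have "x + y = (j + j') + (b + b') * q" by (simp add: j j' algebra_simps)
  then show "x + y \<in> adjoin J q"
    unfolding adjoin_def using midealD(2)[OF assms j(2) j'(2)] by blast
qed

lemma adjoin_superset: "J \<subseteq> adjoin J q"
  by (force simp: adjoin_def intro: exI[of _ 0])

lemma in_adjoin: "mideal J \<Longrightarrow> q \<in> adjoin J q"
  unfolding adjoin_def using midealD(1)[of J]
  by (intro CollectI exI[of _ 0] exI[of _ 1] conjI) auto

text \<open>The graph of an exponent vector over its support determines it and is a finite subset of
  a countable set.\<close>

lemma countable_monomials:
  assumes "countable (UNIV :: 'v set)" shows "countable (UNIV :: ('v \<Rightarrow>\<^sub>0 nat) set)"
proof -
  have "countable (UNIV :: ('v \<times> nat) set)"
    unfolding UNIV_Times_UNIV[symmetric] by (intro countable_SIGMA assms) auto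
  then have "countable {A :: ('v \<times> nat) set. finite A}"
    using countable_Collect_finite_subset[of "UNIV :: ('v \<times> nat) set"] by simp
  moreover have "(\<lambda>\<alpha> :: 'v \<Rightarrow>\<^sub>0 nat. (\<lambda>v. (v, lookup \<alpha> v)) ` keys \<alpha>) ` UNIV \<subseteq> {A. finite A}" by auto
  ultimately have "countable ((\<lambda>\<alpha> :: 'v \<Rightarrow>\<^sub>0 nat. (\<lambda>v. (v, lookup \<alpha> v)) ` keys \<alpha>) ` UNIV)"
    by (rule countable_subset[rotated])
  moreover have "inj (\<lambda>\<alpha> :: 'v \<Rightarrow>\<^sub>0 nat. (\<lambda>v. (v, lookup \<alpha> v)) ` keys \<alpha>)"
  proof (rule injI, rule poly_mapping_eqI)
    fix \<alpha> \<beta> :: "'v \<Rightarrow>\<^sub>0 nat" and v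
    assume eq: "(\<lambda>v. (v, lookup \<alpha> v)) ` keys \<alpha> = (\<lambda>v. (v, lookup \<beta> v)) ` keys \<beta>"
    have "v \<in> keys \<alpha> \<Longrightarrow> (v, lookup \<alpha> v) \<in> (\<lambda>v. (v, lookup \<beta> v)) ` keys \<beta>"
      "v \<in> keys \<beta> \<Longrightarrow> (v, lookup \<beta> v) \<in> (\<lambda>v. (v, lookup \<alpha> v)) ` keys \<alpha>"
      using eq by blast+
    then show "lookup \<alpha> v = lookup \<beta> v"
      by (cases "v \<in> keys \<alpha>"; cases "v \<in> keys \<beta>") (auto simp: not_in_keys_iff_lookup_eq_zero)
  qed
  ultimately show ?thesis by (metis countable_image_inj_on)
qed

lemma uncountable_complex: "uncountable (UNIV :: complex set)"
proof
  assume "countable (UNIV :: complex set)"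
  then have "countable (range complex_of_real)" by (rule countable_subset[rotated]) auto
  then have "countable (UNIV :: real set)"
    by (rule countable_image_inj_on) (auto simp: inj_on_def)
  then show False using uncountable_UNIV_real by simp
qed

lemma comm_ring_hom_poly_map_poly:
  assumes "comm_ring_hom h"
  shows "comm_ring_hom (\<lambda>q. poly (map_poly h q) t)"
proof -
  interpret comm_ring_hom h by fact
  let ?e = "\<lambda>q. poly (map_poly h q) t"
  have pCons: "?e (pCons a p) = h a + t * ?e p" for a p
    by (simp add: map_poly_pCons)
  have add: "?e (p + q) = ?e p + ?e q" for p q
    by (induction p q rule: poly_induct2) (auto simp: pCons hom_add algebra_simps)
  have smult: "?e (Polynomial.smult a p) = h a * ?e p" for a p
    by (induction p) (auto simp: pCons hom_mult algebra_simps)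
  show ?thesis
  proof
    show "?e (p * q) = ?e p * ?e q" for p q
      by (induction p) (auto simp: pCons add smult mult_pCons_left algebra_simps)
    show "?e 1 = 1" by (simp add: one_pCons map_poly_pCons)
  qed (simp_all add: add)
qed

definition subst_var :: "'v \<Rightarrow> complex poly \<Rightarrow> ('v, complex) mpoly" where
  "subst_var v p = poly (map_poly mconst p) (mvar v)"

lemma comm_ring_hom_subst_var: "comm_ring_hom (subst_var v)"
  unfolding subst_var_def by (rule comm_ring_hom_poly_map_poly[OF comm_ring_hom_mconst])

interpretation subst_var: comm_ring_hom "subst_var v" for v
  by (rule comm_ring_hom_subst_var)

lemma subst_var_linear: "subst_var v [:a, b:] = mconst a + mconst b * mvar v"
  by (simp add: subst_var_def map_poly_pCons)

text \<open>
  If \<open>x\<^sub>v - c\<close> were invertible modulo \<open>J\<close> for every \<open>c\<close>, the uncountably many inverses would be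
  linearly dependent, which gives a nonzero univariate polynomial in \<open>x\<^sub>v\<close> in \<open>J\<close>; it splits into
  invertible linear factors.
\<close>

lemma ex_proper_adjoin:
  fixes J :: "('v, complex) mpoly set"
  assumes cnt: "countable (UNIV :: 'v set)" and J: "mideal J" "1 \<notin> J"
  shows "\<exists>c. 1 \<notin> adjoin J (mvar v - mconst c)"
proof (rule ccontr)
  assume "\<not> ?thesis"
  then have "\<forall>c. \<exists>q. 1 - q * (mvar v - mconst c) \<in> J"
    unfolding adjoin_def by (auto simp: algebra_simps) (metis add_diff_cancel_right')
  then obtain q where q: "\<And>c. 1 - q c * (mvar v - mconst c) \<in> J" by metis
  obtain e :: "('v \<Rightarrow>\<^sub>0 nat) \<Rightarrow> nat" where e: "inj e"
    using countable_monomials[OF cnt] unfolding countable_def by auto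
  \<comment> \<open>The monomials are numbered by \<open>e\<close>, and \<open>B D\<close> collects
    the \<open>c\<close> whose inverse only uses monomials with numbers below \<open>D\<close>.
    Countably many such sets exhaust an uncountable one, so some \<open>B D\<close> is infinite, and
    any \<open>Suc D\<close> of its inverses are dependent.\<close>
  define B where "B = (\<lambda>D. {c. \<forall>\<alpha>\<in>keys (q c). e \<alpha> < D})"
  have "c \<in> B (Suc (Max (insert 0 (e ` keys (q c)))))" for c
    by (auto simp: B_def less_Suc_eq_le)
  then have "(\<Union>D. B D) = UNIV" by auto
  then have "\<exists>D. infinite (B D)"
    using uncountable_complex countable_UN[of UNIV B] countable_finite by (metis UNIV_I countableI_type)
  then obtain D where "infinite (B D)" ..
  then obtain C where C: "C \<subseteq> B D" "finite C" "card C = Suc D"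
    using infinite_arbitrarily_large by blast
  obtain a where a: "\<exists>c\<in>C. a c \<noteq> 0" "\<forall>k<D. (\<Sum>c\<in>C. a c * lookup (q c) (inv_into UNIV e k)) = 0"
    using nontrivial_linear_relation[of C D "\<lambda>c k. lookup (q c) (inv_into UNIV e k)"] C by auto
  have rel: "(\<Sum>c\<in>C. q c * mconst (a c)) = 0"
  proof (rule poly_mapping_eqI)
    fix \<alpha>
    have "(\<Sum>c\<in>C. a c * lookup (q c) \<alpha>) = 0"
    proof (cases "e \<alpha> < D")
      case True
      then show ?thesis using a(2)[rule_format, of "e \<alpha>"] by (simp add: inv_into_f_f[OF e])
    next
      case False
      then have "lookup (q c) \<alpha> = 0" if "c \<in> C" for c
        using that C(1) False by (auto simp: B_def not_in_keys_iff_lookup_eq_zero[symmetric])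
      then show ?thesis by simp
    qed
    then show "lookup (\<Sum>c\<in>C. q c * mconst (a c)) \<alpha> = lookup 0 \<alpha>"
      by (simp add: lookup_sum lookup_mult_mconst mult.commute)
  qed
  \<comment> \<open>Multiplying the linear relation among the inverses by all factors x_v - c turns
    each inverse into a product that omits one factor.\<close>
  define \<pi> where "\<pi> = (\<lambda>c. \<Prod>c'\<in>C - {c}. [:- c', 1:])"
  define p where "p = (\<Sum>c\<in>C. [:a c:] * \<pi> c)"
  have lin: "mvar v - mconst c = subst_var v [:- c, 1:]" for c
    by (simp add: subst_var_linear mconst.hom_uminus)
  have const: "mconst c = subst_var v [:c:]" for c
    by (simp add: subst_var_def map_poly_pCons)
  have "(\<Sum>c\<in>C. (1 - q c * (mvar v - mconst c)) * (mconst (a c) * subst_var v (\<pi> c))) \<in> J"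
    by (intro midealD(6)[OF J(1)] midealD(4)[OF J(1)] q)
  moreover have "(1 - q c * (mvar v - mconst c)) * (mconst (a c) * subst_var v (\<pi> c)) =
      subst_var v ([:a c:] * \<pi> c) - q c * mconst (a c) * subst_var v (\<Prod>c'\<in>C. [:- c', 1:])"
    if "c \<in> C" for c
  proof -
    have "(\<Prod>c'\<in>C. [:- c', 1:]) = [:- c, 1:] * \<pi> c"
      unfolding \<pi>_def using C(2) that by (rule prod.remove)
    then have "subst_var v (\<Prod>c'\<in>C. [:- c', 1:]) = (mvar v - mconst c) * subst_var v (\<pi> c)"
      unfolding lin subst_var.hom_mult[symmetric] by simp
    moreover have "(1 - d * x) * (b * y) = b * y - d * b * (x * y)" for b d x y :: "('v, complex) mpoly"
      by (simp add: algebra_simps)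
    ultimately show ?thesis unfolding subst_var.hom_mult const[symmetric] by simp
  qed
  then have "(\<Sum>c\<in>C. (1 - q c * (mvar v - mconst c)) * (mconst (a c) * subst_var v (\<pi> c))) =
      subst_var v p - (\<Sum>c\<in>C. q c * mconst (a c)) * subst_var v (\<Prod>c'\<in>C. [:- c', 1:])"
    unfolding p_def by (simp add: sum_subtractf subst_var.hom_sum sum_distrib_right)
  ultimately have pJ: "subst_var v p \<in> J" using rel by simp
  \<comment> \<open>At a point \<open>c\<close> of \<open>C\<close> only the summand that omits the
    factor of \<open>c\<close> survives.\<close>
  have p0: "p \<noteq> 0"
  proof
    assume "p = 0"
    obtain c where c: "c \<in> C" "a c \<noteq> 0" using a by auto
    have "poly p c = (\<Sum>c'\<in>C. a c' * (\<Prod>d\<in>C - {c'}. c - d))"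
      by (simp add: p_def \<pi>_def poly_sum poly_prod)
    also have "\<dots> = (\<Sum>c'\<in>C. if c' = c then a c * (\<Prod>d\<in>C - {c}. c - d) else 0)"
      using C(2) c(1) by (intro sum.cong) auto
    also have "\<dots> \<noteq> 0" using C(2) c by auto
    finally show False using \<open>p = 0\<close> by simp
  qed
  have "1 \<in> J" if "p \<noteq> 0" "subst_var v p \<in> J" for p
    using that
  proof (induction "degree p" arbitrary: p)
    case 0
    then obtain c where c: "p = [:c:]" using degree_0_id by metis
    have "mconst (1 / c) * mconst c \<in> J" using 0 c const by (intro midealD(3)[OF J(1)]) simp
    then show ?case using 0 c by (simp add: mconst.hom_mult[symmetric] mconst.hom_one)
  next
    case (Suc n)
    then obtain r where "poly p r = 0"
      using fundamental_theorem_of_algebra[of p] by (auto simp: constant_degree)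
    then obtain p' where p': "p = [:- r, 1:] * p'" by (auto simp: poly_eq_0_iff_dvd)
    have "p' \<noteq> 0" using Suc p' by auto
    then have "degree p' = n" using Suc p' by (simp add: degree_mult_eq del: mult_pCons_left)
    moreover have "(1 - q r * (mvar v - mconst r)) * subst_var v p' + q r * subst_var v p \<in> J"
      using q Suc.prems(2) by (intro midealD(2)[OF J(1)] midealD(3,4)[OF J(1)])
    moreover have "subst_var v p = (mvar v - mconst r) * subst_var v p'"
      unfolding lin subst_var.hom_mult[symmetric] by (simp add: p')
    then have "(1 - q r * (mvar v - mconst r)) * subst_var v p' + q r * subst_var v p = subst_var v p'"
      by (simp add: left_diff_distrib mult.assoc)
    ultimately show ?case using Suc.hyps(1) \<open>p' \<noteq> 0\<close> by auto
  qed
  then show False using p0 pJ J by blast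
qed

text \<open>Adjoining a suitable x_v - c for each variable in \<open>W\<close> keeps the ideal
  proper. Modulo the result, every polynomial in these variables is congruent to its value at
  \<open>x\<close>, so a nonzero value of an element of \<open>J\<close> would put a unit into a
  proper ideal.\<close>

theorem weak_nullstellensatz:
  fixes J :: "('v, complex) mpoly set"
  assumes cnt: "countable (UNIV :: 'v set)" and J: "mideal J" "1 \<notin> J" and W: "finite W"
  shows "\<exists>x. \<forall>p\<in>J \<inter> mpolys W. peval x p = 0"
proof -
  have "\<exists>x J'. mideal J' \<and> J \<subseteq> J' \<and> 1 \<notin> J' \<and> (\<forall>v\<in>W. mvar v - mconst (x v) \<in> J')"
    using W
  proof (induction W rule: finite_induct)
    case empty
    then show ?case using J by blast
  next
    case (insert v W)
    then obtain x J' where x: "mideal J'" "J \<subseteq> J'" "1 \<notin> J'" "\<forall>v\<in>W. mvar v - mconst (x v) \<in> J'"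
      by auto
    obtain c where "1 \<notin> adjoin J' (mvar v - mconst c)"
      using ex_proper_adjoin[OF cnt x(1,3)] by auto
    moreover have "\<forall>w\<in>insert v W. mvar w - mconst ((x(v := c)) w) \<in> adjoin J' (mvar v - mconst c)"
      using x(4) insert.hyps(2) adjoin_superset[of J'] in_adjoin[OF x(1)] by auto
    ultimately show ?case
      using mideal_adjoin[OF x(1)] subset_trans[OF x(2) adjoin_superset] by blast
  qed
  then obtain x J' where x: "mideal J'" "J \<subseteq> J'" "1 \<notin> J'" "\<forall>v\<in>W. mvar v - mconst (x v) \<in> J'"
    by auto
  interpret ev: comm_ring_hom "peval x :: ('v, complex) mpoly \<Rightarrow> complex"
    by (intro comm_ring_hom_meval comm_ring_hom_id)
  have S: "subring {p. p - mconst (peval x p) \<in> J'}" (is "subring ?S")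
    unfolding subring_def mem_Collect_eq
  proof (intro conjI ballI)
    fix p q assume pq: "p \<in> ?S" "q \<in> ?S"
    let ?e = "\<lambda>p. mconst (peval x p) :: ('v, complex) mpoly"
    have "p + q - ?e (p + q) = (p - ?e p) + (q - ?e q)"
      by (simp add: ev.hom_add mconst.hom_add)
    also have "\<dots> \<in> J'" using midealD(2)[OF x(1)] pq by simp
    finally show "p + q - ?e (p + q) \<in> J'" .
    have "p - q - ?e (p - q) = (p - ?e p) - (q - ?e q)"
      by (simp add: ev.hom_minus mconst.hom_minus)
    also have "\<dots> \<in> J'" using midealD(5)[OF x(1)] pq by simp
    finally show "p - q - ?e (p - q) \<in> J'" .
    have "p * q - ?e (p * q) = p * (q - ?e q) + ?e q * (p - ?e p)"
      by (simp add: ev.hom_mult mconst.hom_mult algebra_simps)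
    also have "\<dots> \<in> J'" using midealD(2,3)[OF x(1)] pq by simp
    finally show "p * q - ?e (p * q) \<in> J'" .
  qed (use midealD(1)[OF x(1)] in \<open>auto simp: mconst.hom_one\<close>)
  have "peval x p = 0" if p: "p \<in> J" "p \<in> mpolys W" for p
  proof (rule ccontr)
    assume ne: "peval x p \<noteq> 0"
    have "meval mconst mvar p \<in> ?S"
      using x(4) p(2) midealD(1)[OF x(1)]
      by (intro meval_in_subring[OF S]) (auto simp: comm_ring_hom_id mpolys_def)
    then have "p - mconst (peval x p) \<in> J'" by simp
    then have "p - (p - mconst (peval x p)) \<in> J'"
      by (rule midealD(5)[OF x(1) subsetD[OF x(2) p(1)]])
    then have "mconst (1 / peval x p) * mconst (peval x p) \<in> J'"
      by (intro midealD(3)[OF x(1)]) simp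
    then show False using x(3) ne by (simp add: mconst.hom_mult[symmetric] mconst.hom_one)
  qed
  then show ?thesis by auto
qed

text \<open>The computation in Rabinowitsch's trick: 1/r is substituted for the auxiliary variable
  and the denominators are cleared, without forming fractions.\<close>

lemma homogenized_relation:
  fixes r :: "'a::comm_ring_1" and f :: "nat \<Rightarrow> 'a"
  assumes "1 = (\<Sum>i<n. a i * [:f i:]) + b * ([:0, 1:] * [:r:] - 1)"
  shows "\<exists>K. r ^ K = (\<Sum>i<n. (\<Sum>k\<le>K. coeff (a i) k * r ^ (K - k)) * f i)"
proof -
  define K where "K = Suc (degree b)"
  \<comment> \<open>\<open>h p\<close> stands for r^K p(1/r), with the terms of degree above
    \<open>K\<close> dropped. It is merely linear, which suffices because the \<open>f i\<close> are
    constants. As \<open>K\<close> exceeds the degree of \<open>b\<close>, multiplying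
    \<open>b\<close> by the variable and by \<open>r\<close> does not change
    \<open>h b\<close>.\<close>
  define h where "h = (\<lambda>p. \<Sum>k\<le>K. coeff p k * r ^ (K - k))"
  have h_add: "h (p + q) = h p + h q" for p q
    by (simp add: h_def algebra_simps sum.distrib)
  have h0: "h 0 = 0" by (simp add: h_def)
  have h_sum: "h (\<Sum>i<n. g i) = (\<Sum>i<n. h (g i))" for n and g :: "nat \<Rightarrow> 'a poly"
    by (induction n) (auto simp: h_add h0)
  have h1: "h 1 = r ^ K"
    unfolding h_def by (subst sum.remove[of _ 0]) (auto intro!: sum.neutral simp: coeff_1)
  have "h (b * ([:0, 1:] * [:r:])) = (\<Sum>k\<in>Suc ` {..<K}. coeff (pCons 0 (Polynomial.smult r b)) k * r ^ (K - k))"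
    unfolding h_def
  proof (rule sum.mono_neutral_cong_right)
    show "\<forall>i\<in>{..K} - Suc ` {..<K}. coeff (b * ([:0, 1:] * [:r:])) i * r ^ (K - i) = 0"
    proof
      fix i assume "i \<in> {..K} - Suc ` {..<K}"
      then have "i = 0" by (cases i) auto
      then show "coeff (b * ([:0, 1:] * [:r:])) i * r ^ (K - i) = 0" by (simp add: coeff_mult)
    qed
  qed (auto simp: mult_pCons_right)
  also have "\<dots> = (\<Sum>k<K. coeff b k * (r * r ^ (K - Suc k)))"
    by (subst sum.reindex) (auto simp: algebra_simps)
  also have "\<dots> = (\<Sum>k<K. coeff b k * r ^ (K - k))"
    by (intro sum.cong) (auto simp: power_Suc[symmetric] Suc_diff_Suc simp del: power_Suc)
  also have "\<dots> = h b"
    by (simp add: h_def lessThan_Suc_atMost[symmetric]) (simp add: K_def coeff_eq_0)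
  finally have "h (b * ([:0, 1:] * [:r:])) = h b" .
  moreover have "h (b * ([:0, 1:] * [:r:] - 1)) + h b = h (b * ([:0, 1:] * [:r:]))"
    unfolding h_add[symmetric] by (simp add: algebra_simps)
  ultimately have "h (b * ([:0, 1:] * [:r:] - 1)) = 0" by simp
  moreover have "h 1 = h (\<Sum>i<n. a i * [:f i:]) + h (b * ([:0, 1:] * [:r:] - 1))"
    unfolding h_add[symmetric] using assms by (rule arg_cong)
  ultimately have "r ^ K = (\<Sum>i<n. h (a i * [:f i:]))"
    unfolding h1 h_sum by simp
  also have "\<dots> = (\<Sum>i<n. h (a i) * f i)"
    by (simp add: h_def sum_distrib_left mult_ac)
  finally show ?thesis unfolding h_def by blast
qed

text \<open>Where all \<open>f i\<close> vanish, so does \<open>r\<close>, and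
  \<open>y * r - 1\<close> is -1: together they have no common zero and generate the unit ideal. The
  infinite supply of variables provides the fresh \<open>y\<close>.\<close>

theorem nullstellensatz:
  fixes f :: "nat \<Rightarrow> ('v, complex) mpoly"
  assumes cnt: "countable (UNIV :: 'v set)" and inf: "infinite (UNIV :: 'v set)"
    and zeros: "\<And>x. (\<And>i. i < n \<Longrightarrow> peval x (f i) = 0) \<Longrightarrow> peval x r = 0"
  shows "\<exists>K a. r ^ K = (\<Sum>i<n. a i * f i)"
proof -
  let ?V = "vars r \<union> (\<Union>i<n. vars (f i))"
  obtain y where y: "y \<notin> ?V" using ex_new_if_finite[OF inf, of ?V] by auto
  let ?R = "mvar y * r - 1"
  define J where "J = {(\<Sum>i<n. a i * f i) + b * ?R | a b. True}"
  have J: "mideal J"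
    unfolding mideal_def
  proof (intro conjI ballI allI)
    show "0 \<in> J" unfolding J_def by (auto intro!: exI[of _ 0] exI[of _ "\<lambda>_. 0"])
    fix p q c assume "p \<in> J"
    then obtain a b where p: "p = (\<Sum>i<n. a i * f i) + b * ?R" by (auto simp: J_def)
    have "c * p = (\<Sum>i<n. (c * a i) * f i) + (c * b) * ?R"
      by (simp add: p distrib_left sum_distrib_left mult.assoc)
    then show "c * p \<in> J" unfolding J_def
      by (intro CollectI exI[of _ "\<lambda>i. c * a i"] exI[of _ "c * b"] conjI TrueI)
    assume "q \<in> J"
    then obtain a' b' where q: "q = (\<Sum>i<n. a' i * f i) + b' * ?R" by (auto simp: J_def)
    have "p + q = (\<Sum>i<n. (a i + a' i) * f i) + (b + b') * ?R"
      by (simp add: p q distrib_right sum.distrib)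
    then show "p + q \<in> J" unfolding J_def
      by (intro CollectI exI[of _ "\<lambda>i. a i + a' i"] exI[of _ "b + b'"] conjI TrueI)
  qed
  have fJ: "f i \<in> J" if "i < n" for i
  proof -
    have "f i = (\<Sum>j<n. (if j = i then 1 else 0) * f j) + 0 * ?R"
      using that by (simp add: if_distrib[of "\<lambda>c. c * _"] cong: if_cong)
    then show ?thesis unfolding J_def
      by (intro CollectI exI[of _ "\<lambda>j. if j = i then 1 else 0"] exI[of _ 0] conjI TrueI)
  qed
  have RJ: "?R \<in> J"
    unfolding J_def by (intro CollectI exI[of _ "\<lambda>_. 0"] exI[of _ 1]) simp
  have "1 \<in> J"
  proof (rule ccontr)
    assume "1 \<notin> J"
    from weak_nullstellensatz[OF cnt J this, of "insert y ?V"] obtain x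
      where x: "\<And>p. p \<in> J \<Longrightarrow> p \<in> mpolys (insert y ?V) \<Longrightarrow> peval x p = 0" by auto
    interpret ev: comm_ring_hom "peval x :: ('v, complex) mpoly \<Rightarrow> complex"
      by (intro comm_ring_hom_meval comm_ring_hom_id)
    have "peval x r = 0"
      by (rule zeros, rule x) (auto simp: fJ mpolys_def)
    moreover have "peval x ?R = 0"
      by (rule x[OF RJ], intro subringD[OF subring_mpolys] mvar_in_mpolys) (auto simp: mpolys_def)
    ultimately show False by (simp add: ev.hom_minus ev.hom_mult)
  qed
  then obtain a b where "1 = (\<Sum>i<n. a i * f i) + b * ?R" by (auto simp: J_def)
  then have "as_poly y 1 = as_poly y ((\<Sum>i<n. a i * f i) + b * ?R)" by simp
  then have "1 = (\<Sum>i<n. as_poly y (a i) * as_poly y (f i)) + as_poly y b * (as_poly y (mvar y) * as_poly y r - 1)"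
    by (simp only: as_poly.hom_add as_poly.hom_mult as_poly.hom_minus as_poly.hom_sum as_poly.hom_one)
  moreover have "as_poly y (f i) = [:f i:]" if "i < n" for i using y that by (intro as_poly_const) auto
  moreover have "as_poly y r = [:r:]" using y by (intro as_poly_const) auto
  moreover have "as_poly y (mvar y :: ('v, complex) mpoly) = [:0, 1:]"
    by (simp add: as_poly_def comm_ring_hom_pconst_mconst)
  ultimately have "1 = (\<Sum>i<n. as_poly y (a i) * [:f i:]) + as_poly y b * ([:0, 1:] * [:r:] - 1)"
    by simp
  from homogenized_relation[OF this] obtain K
    where "r ^ K = (\<Sum>i<n. (\<Sum>k\<le>K. coeff (as_poly y (a i)) k * r ^ (K - k)) * f i)" ..
  then show ?thesis by (intro exI)
qed

section \<open>Complex polynomials as combinations of integer ones\<close>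

definition int_independent :: "nat \<Rightarrow> (nat \<Rightarrow> complex) \<Rightarrow> bool" where
  "int_independent K b \<longleftrightarrow> (\<forall>w :: nat \<Rightarrow> int. (\<Sum>k<K. of_int (w k) * b k) = 0 \<longrightarrow> (\<forall>k<K. w k = 0))"

text \<open>The family grows with \<open>C\<close>. If a nonzero multiple \<open>n * c\<close> is
  already a combination, the family is divided by \<open>n\<close>, so that \<open>c\<close> becomes
  an integer combination too; otherwise \<open>c\<close> itself is added.\<close>

lemma ex_int_independent:
  assumes "finite C"
  shows "\<exists>K b z. int_independent K b \<and> (\<forall>c\<in>C. c = (\<Sum>k<K. of_int (z c k) * b k))"
  using assms
proof (induction C rule: finite_induct)
  case empty
  then show ?case by (intro exI[of _ 0]) (auto simp: int_independent_def)
next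
  case (insert c C)
  then obtain K b z where b: "int_independent K b" and z: "\<forall>c\<in>C. c = (\<Sum>k<K. of_int (z c k) * b k)"
    by auto
  show ?case
  proof (cases "\<exists>n w. n \<noteq> 0 \<and> of_int n * c = (\<Sum>k<K. of_int (w k) * b k)")
    case True
    then obtain n w where n: "n \<noteq> 0" "of_int n * c = (\<Sum>k<K. of_int (w k) * b k)" by auto
    define b' where "b' = (\<lambda>k. b k / of_int n)"
    define z' where "z' = (\<lambda>d. if d = c then w else (\<lambda>k. n * z d k))"
    have "int_independent K b'"
      unfolding int_independent_def
    proof (intro allI impI)
      fix u :: "nat \<Rightarrow> int" and k assume "(\<Sum>k<K. of_int (u k) * b' k) = 0" "k < K"
      moreover have "(\<Sum>k<K. of_int (u k) * b k) = of_int n * (\<Sum>k<K. of_int (u k) * b' k)"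
        using n by (simp add: b'_def sum_distrib_left)
      ultimately show "u k = 0" using b by (auto simp: int_independent_def)
    qed
    moreover have "d = (\<Sum>k<K. of_int (z' d k) * b' k)" if "d \<in> insert c C" for d
    proof (cases "d = c")
      case True
      have "c = (of_int n * c) / of_int n" using n(1) by simp
      also have "\<dots> = (\<Sum>k<K. of_int (w k) * b' k)" 
        by (subst n(2)) (simp add: b'_def sum_divide_distrib)
      finally show ?thesis using True by (simp add: z'_def)
    next
      case False
      then have "d = (\<Sum>k<K. of_int (z d k) * b k)" using that z by blast
      also have "\<dots> = (\<Sum>k<K. of_int (z' d k) * b' k)" using False n by (simp add: z'_def b'_def)
      finally show ?thesis .
    qed
    ultimately show ?thesis by blast
  next
    case False
    define b' where "b' = b(K := c)"
    define z' where "z' = (\<lambda>d. if d = c then (\<lambda>k. if k = K then 1 else 0) else (z d)(K := 0))"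
    have b': "(\<Sum>k<Suc K. of_int (u k) * b' k) = (\<Sum>k<K. of_int (u k) * b k) + of_int (u K) * c"
      for u :: "nat \<Rightarrow> int" by (simp add: b'_def)
    have "int_independent (Suc K) b'"
      unfolding int_independent_def b'
    proof (intro allI impI)
      fix u :: "nat \<Rightarrow> int" and k
      assume u: "(\<Sum>k<K. of_int (u k) * b k) + of_int (u K) * c = 0" and k: "k < Suc K"
      have "of_int (u K) * c = - (\<Sum>k<K. of_int (u k) * b k)"
        using u by (metis add.commute eq_neg_iff_add_eq_0)
      also have "\<dots> = (\<Sum>k<K. of_int (- u k) * b k)" by (simp add: sum_negf)
      finally have "of_int (u K) * c = (\<Sum>k<K. of_int (- u k) * b k)" .
      then have "u K = 0" using False by (metis (no_types))
      then show "u k = 0" using u k b by (cases "k = K") (auto simp: int_independent_def)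
    qed
    moreover have "d = (\<Sum>k<Suc K. of_int (z' d k) * b' k)" if "d \<in> insert c C" for d
    proof (cases "d = c")
      case False
      then have "d = (\<Sum>k<K. of_int (z d k) * b k)" using that z by blast
      then show ?thesis unfolding b' using False by (simp add: z'_def)
    next
      case True
      then show ?thesis unfolding b' by (simp add: z'_def)
    qed
    ultimately show ?thesis by blast
  qed
qed

lemma complex_mpoly_decomposition:
  fixes p :: "('v, complex) mpoly"
  obtains K b q where "int_independent K b" "p = (\<Sum>k<K. map_int (q k) * mconst (b k))"
    "\<And>k. vars (q k) \<subseteq> vars p"
proof -
  obtain K b z where b: "int_independent K b"
    and z: "\<forall>c\<in>lookup p ` keys p. c = (\<Sum>k<K. of_int (z c k) * b k)"
    using ex_int_independent[of "lookup p ` keys p"] by auto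
  define q where "q = (\<lambda>k. \<Sum>\<alpha>\<in>keys p. single \<alpha> (z (lookup p \<alpha>) k))"
  have lq: "lookup (q k) \<alpha> = (if \<alpha> \<in> keys p then z (lookup p \<alpha>) k else 0)" for k \<alpha>
    by (simp add: q_def lookup_sum lookup_single when_def sum.delta)
  have "p = (\<Sum>k<K. map_int (q k) * mconst (b k))"
  proof (rule poly_mapping_eqI)
    fix \<alpha>
    show "lookup p \<alpha> = lookup (\<Sum>k<K. map_int (q k) * mconst (b k)) \<alpha>"
      using z by (cases "\<alpha> \<in> keys p")
        (auto simp: lookup_sum lookup_mult_mconst lq dest: lookup_eq_zero_in_keys_contradict
          simp flip: not_in_keys_iff_lookup_eq_zero)
  qed
  moreover have "vars (q k) \<subseteq> vars p" for k
    by (auto simp: vars_def in_keys_iff[of _ "q k"] lq split: if_splits)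
  ultimately show ?thesis using that b by blast
qed

lemma int_independent_mpoly:
  assumes "int_independent K b" "(\<Sum>k<K. map_int (q k) * mconst (b k)) = 0" "k < K"
  shows "q k = 0"
proof (rule poly_mapping_eqI)
  fix \<alpha>
  have "lookup (\<Sum>k<K. map_int (q k) * mconst (b k)) \<alpha> = 0" using assms(2) by simp
  then show "lookup (q k) \<alpha> = lookup 0 \<alpha>"
    using assms(1)[unfolded int_independent_def, rule_format, of "\<lambda>k. lookup (q k) \<alpha>" k] assms(3)
    by (simp add: lookup_sum lookup_mult_mconst)
qed

section \<open>The ideal of inertia forms\<close>

lemma finite_exponents [simp]: "finite (exponents N k)"
proof (rule inj_on_finite)
  let ?f = "\<lambda>\<alpha>. restrict (lookup \<alpha>) {..<N}"
  show "inj_on ?f (exponents N k)"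
  proof (rule inj_onI, rule poly_mapping_eqI)
    fix \<alpha> \<beta> v assume *: "\<alpha> \<in> exponents N k" "\<beta> \<in> exponents N k" "?f \<alpha> = ?f \<beta>"
    show "lookup \<alpha> v = lookup \<beta> v"
    proof (cases "v < N")
      case True
      then show ?thesis using fun_cong[OF *(3), of v] by simp
    next
      case False
      then have "v \<notin> keys \<alpha>" "v \<notin> keys \<beta>" using * by (auto simp: exponents_def)
      then show ?thesis by (simp add: not_in_keys_iff_lookup_eq_zero)
    qed
  qed
  show "?f ` exponents N k \<subseteq> {..<N} \<rightarrow>\<^sub>E {..k}"
  proof (clarsimp simp: exponents_def)
    fix \<alpha> :: "nat \<Rightarrow>\<^sub>0 nat" and j assume "j < N"
    then show "lookup \<alpha> j \<le> (\<Sum>j<N. lookup \<alpha> j)" by (intro member_le_sum[of j "{..<N}" "lookup \<alpha>"]) auto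
  qed
qed (auto intro: finite_PiE)

lemma single_in_exponents: "i < N \<Longrightarrow> single i k \<in> exponents N k"
  by (auto simp: exponents_def lookup_single when_def)

lemma add_in_exponents:
  "\<alpha> \<in> exponents N a \<Longrightarrow> \<beta> \<in> exponents N b \<Longrightarrow> \<alpha> + \<beta> \<in> exponents N (a + b)"
  using keys_add[of \<alpha> \<beta>] by (auto simp: exponents_def lookup_add sum.distrib)

lemma mon_exponents: "\<alpha> \<in> exponents N k \<Longrightarrow> mon x \<alpha> = (\<Prod>j<N. x j ^ lookup \<alpha> j)"
  by (rule mon_superset) (auto simp: exponents_def)

lemma tendsto_meval:
  fixes p :: "('v, 'b::zero) mpoly" and a :: "'v \<Rightarrow> 'a::{comm_ring_1,real_normed_algebra_1}"
  assumes "\<And>v. v \<in> vars p \<Longrightarrow> ((\<lambda>n. b n v) \<longlongrightarrow> a v) F"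
  shows "((\<lambda>n. meval \<phi> (b n) p) \<longlongrightarrow> meval \<phi> a p) F"
  unfolding meval_def
  by (intro tendsto_sum tendsto_mult tendsto_const tendsto_prod tendsto_power assms)
     (auto simp: vars_def)

locale form_degrees =
  fixes N :: nat and d :: "nat \<Rightarrow> nat"
  assumes N_pos: "0 < N" and d_pos: "\<And>i. i < N \<Longrightarrow> 0 < d i"
begin

definition coeff_vars :: "cvar set" where
  "coeff_vars = (SIGMA i:{..<N}. exponents N (d i))"

definition fval :: "(cvar \<Rightarrow> 'a::comm_ring_1) \<Rightarrow> (nat \<Rightarrow> 'a) \<Rightarrow> nat \<Rightarrow> 'a" where
  "fval c x i = (\<Sum>\<alpha>\<in>exponents N (d i). c (i, \<alpha>) * mon x \<alpha>)"

lemma fval_remove_pure: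
  assumes "i < N" "x 0 = 1"
  shows "fval c x i = c (i, single 0 (d i)) +
    (\<Sum>\<beta>\<in>exponents N (d i) - {single 0 (d i)}. c (i, \<beta>) * mon x \<beta>)"
  unfolding fval_def using assms single_in_exponents[OF N_pos]
  by (subst sum.remove[of _ "single 0 (d i)"]) auto

text \<open>
  \<open>normal_form\<close> specializes the coefficient of \<open>x\<^sub>0 ^ d\<^sub>i\<close> in each form such that the generic
  system vanishes at \<open>(1, x\<^sub>1, \<dots>)\<close>. The index \<open>N\<close>, which does not occur in the generic system, is
  used to encode \<open>x\<^sub>k\<close> as the variable \<open>(N, single k 1)\<close>.
\<close>

definition point_var :: "nat \<Rightarrow> (cvar, 'a::comm_ring_1) mpoly" where
  "point_var k = (if k = 0 then 1 else mvar (N, single k 1))"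

definition pure_subst :: "cvar \<Rightarrow> (cvar, 'a::comm_ring_1) mpoly" where
  "pure_subst v = (case v of (i, \<alpha>) \<Rightarrow>
     if i < N \<and> \<alpha> = single 0 (d i)
     then - (\<Sum>\<beta>\<in>exponents N (d i) - {\<alpha>}. mvar (i, \<beta>) * mon point_var \<beta>) else mvar v)"

definition normal_form :: "(cvar, 'a::comm_ring_1) mpoly \<Rightarrow> (cvar, 'a) mpoly" where
  "normal_form = meval mconst pure_subst"

definition inertia :: "(cvar, 'a::comm_ring_1) mpoly set" where
  "inertia = {P. P \<in> mpolys coeff_vars \<and> normal_form P = 0}"

end

sublocale form_degrees \<subseteq> normal_form: comm_ring_hom normal_form
  unfolding normal_form_def by (rule comm_ring_hom_meval[OF comm_ring_hom_mconst])

context form_degrees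
begin

text \<open>Vanishing at a point with \<open>x 0 = 1\<close> determines the coefficients of the
  powers of x_0 by exactly the formula in \<open>pure_subst\<close>, so evaluating the normal form
  of \<open>P\<close> gives back the value of \<open>P\<close>.\<close>

lemma inertia_vanishes:
  fixes c :: "cvar \<Rightarrow> 'a::comm_ring_1"
  assumes "comm_ring_hom \<phi>" "P \<in> inertia" "x 0 = 1" and zero: "\<And>i. i < N \<Longrightarrow> fval c x i = 0"
  shows "meval \<phi> c P = 0"
proof -
  interpret ev: comm_ring_hom "meval \<phi> a" for a :: "cvar \<Rightarrow> 'a"
    by (rule comm_ring_hom_meval) fact
  have inj: "single k 1 = single l (1::nat) \<longleftrightarrow> k = l" for k l :: nat
    by (metis lookup_single_eq lookup_single_not_eq zero_neq_one)
  \<comment> \<open>At index \<open>N\<close> the variables encode the coordinates of the point, and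
    \<open>THE\<close> reads off which coordinate is meant.\<close>
  define a where "a = (\<lambda>v. if fst v = N then x (THE k. snd v = single k 1) else c v)"
  have x: "meval \<phi> a (point_var k) = x k" for k
    using assms(1,3) by (simp add: point_var_def a_def inj ev.hom_one inj[unfolded One_nat_def])
  have "meval \<phi> a (pure_subst v) = c v" if "v \<in> vars P" for v
  proof -
    obtain i \<alpha> where v: "v = (i, \<alpha>)" "i < N" "\<alpha> \<in> exponents N (d i)"
    proof -
      have "v \<in> coeff_vars" using \<open>v \<in> vars P\<close> assms(2) by (auto simp: inertia_def mpolys_def)
      then show thesis using that by (auto simp: coeff_vars_def)
    qed
    have a: "a (i, \<beta>) = c (i, \<beta>)" for \<beta> using v(2) by (simp add: a_def)
    show ?thesis
    proof (cases "\<alpha> = single 0 (d i)")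
      case True
      then have "meval \<phi> a (pure_subst v) = - (\<Sum>\<beta>\<in>exponents N (d i) - {\<alpha>}. c (i, \<beta>) * mon x \<beta>)"
        using v assms(1) by (simp add: pure_subst_def ev.hom_uminus ev.hom_sum ev.hom_mult ev.hom_mon x a)
      also have "\<dots> = c v"
        using zero[OF v(2)] fval_remove_pure[of i x c, OF v(2) assms(3)] True v(1)
        by (simp add: add_eq_0_iff)
      finally show ?thesis .
    qed (use v a assms(1) in \<open>auto simp: pure_subst_def\<close>)
  qed
  then have "meval \<phi> c P = meval \<phi> a (normal_form P)"
    unfolding normal_form_def meval_meval[OF assms(1)] by (intro meval_cong) simp
  then show ?thesis using assms(2) by (simp add: inertia_def)
qed

text \<open>Every assignment \<open>a\<close> to the variables of the normal form defines, through
  \<open>pure_subst\<close>, a system with a zero whose first coordinate is 1; so the normal form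
  vanishes as a function.\<close>

lemma inertiaI:
  fixes P :: "(cvar, complex) mpoly"
  assumes "P \<in> mpolys coeff_vars"
    and "\<And>c x. x 0 = 1 \<Longrightarrow> (\<And>i. i < N \<Longrightarrow> fval c x i = 0) \<Longrightarrow> peval c P = 0"
  shows "P \<in> inertia"
proof -
  note id = comm_ring_hom_id
  have "normal_form P = 0"
  proof (rule mpoly_eq_0_if_vanishing)
    fix a :: "cvar \<Rightarrow> complex"
    interpret ev: comm_ring_hom "peval a :: (cvar, complex) mpoly \<Rightarrow> complex"
      by (rule comm_ring_hom_meval[OF id])
    define c where "c = (\<lambda>v. peval a (pure_subst v))"
    define x where "x = (\<lambda>k. peval a (point_var k))"
    have x0: "x 0 = 1" by (simp add: x_def point_var_def)
    have "fval c x i = 0" if "i < N" for i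
    proof -
      have "c (i, \<beta>) = a (i, \<beta>)" if "\<beta> \<noteq> single 0 (d i)" for \<beta>
        using that by (simp add: c_def pure_subst_def id)
      moreover have "c (i, single 0 (d i)) =
          - (\<Sum>\<beta>\<in>exponents N (d i) - {single 0 (d i)}. a (i, \<beta>) * mon x \<beta>)"
        using that by (simp add: c_def pure_subst_def x_def id ev.hom_uminus ev.hom_sum ev.hom_mult ev.hom_mon)
      ultimately show ?thesis unfolding fval_remove_pure[of _ x, OF that x0] by simp
    qed
    then have "peval c P = 0" using assms(2) x0 by blast
    then show "peval a (normal_form P) = 0"
      unfolding normal_form_def meval_meval[OF id] c_def .
  qed
  then show ?thesis using assms(1) by (simp add: inertia_def)
qed

lemma map_int_in_mpolys_iff:
  "(map_int P :: ('v, 'a::{comm_ring_1,ring_char_0}) mpoly) \<in> mpolys V \<longleftrightarrow> P \<in> mpolys V"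
  by (simp add: mpolys_def vars_map_int)

text \<open>The substitution has integer coefficients, so it commutes with extension of
  scalars.\<close>

lemma normal_form_map_int:
  "normal_form (map_int P) = (map_int (normal_form P) :: (cvar, 'a::comm_ring_1) mpoly)"
proof -
  have [simp]: "normal_form (mconst c) = mconst c" "normal_form (mvar v) = pure_subst v"
    for c :: 'a and v by (simp_all add: normal_form_def comm_ring_hom_mconst)
  have "map_int (mon point_var \<beta>) = (mon point_var \<beta> :: (cvar, 'a) mpoly)" for \<beta>
    unfolding map_int.hom_mon
    by (intro arg_cong[where f = "\<lambda>x. mon x \<beta>"] ext) (simp add: point_var_def map_int.hom_one)
  then have *: "map_int (pure_subst v) = (pure_subst v :: (cvar, 'a) mpoly)" for v
    by (auto simp: pure_subst_def map_int.hom_uminus map_int.hom_sum map_int.hom_mult split: prod.splits)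
  have "normal_form (map_int P) =
      (meval (\<lambda>c. mconst (of_int c)) pure_subst P :: (cvar, 'a) mpoly)"
    unfolding map_int_def normal_form.hom_meval by simp
  also have "\<dots> = map_int (normal_form P)"
    unfolding normal_form_def map_int.hom_meval by (simp add: *)
  finally show ?thesis .
qed

lemma map_int_in_inertia_iff:
  "(map_int P :: (cvar, 'a::{comm_ring_1,ring_char_0}) mpoly) \<in> inertia \<longleftrightarrow> P \<in> inertia"
  by (simp add: inertia_def map_int_in_mpolys_iff normal_form_map_int)

lemma inertia_mult:
  assumes "P \<in> inertia" "Q \<in> mpolys coeff_vars" shows "Q * P \<in> inertia"
  using assms subringD(5)[OF subring_mpolys] by (auto simp: inertia_def normal_form.hom_mult)

lemma inertia_prime:
  fixes P Q :: "(cvar, 'a::idom) mpoly"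
  assumes "P * Q \<in> inertia" "P \<in> mpolys coeff_vars" "Q \<in> mpolys coeff_vars"
  shows "P \<in> inertia \<or> Q \<in> inertia"
  using assms by (auto simp: inertia_def normal_form.hom_mult)

text \<open>
  Scale the coefficients of \<open>x\<^sub>0 ^ (d\<^sub>i - 1) * x\<^sub>i\<close>, \<open>0 < i < N\<close>, by \<open>s\<close>. As \<open>s\<close> tends to infinity,
  the common zero near \<open>(1, 0, \<dots>, 0)\<close> can be prescribed up to terms that tend to zero, so that
  the part of \<open>P\<close> of maximal degree in these coefficients vanishes.
\<close>

lemma inertia_without_pure_eq_0:
  fixes P :: "(cvar, complex) mpoly"
  assumes P: "P \<in> inertia" "(0, single 0 (d 0)) \<notin> vars P"
  shows "P = 0"
proof -
  define lin where "lin = (\<lambda>i. single 0 (d i - 1) + single i (1::nat))"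
  define E where "E = (\<lambda>i. (i, lin i)) ` {1..<N}"
  note id = comm_ring_hom_id
  have lin_exp: "lin i \<in> exponents N (d i)" if "i < N" for i
    using add_in_exponents[OF single_in_exponents[OF N_pos, of "d i - 1"] single_in_exponents[OF that, of 1]]
      d_pos[OF that] by (simp add: lin_def)
  have lin_i: "lookup (lin i) i = 1" if "i \<noteq> 0" for i
    using that by (simp add: lin_def lookup_add lookup_single)
  have lin_ne: "lin i \<noteq> single 0 k" if "i \<noteq> 0" for i k
    using lin_i[OF that] that by (metis lookup_single_not_eq zero_neq_one)
  let ?W = "graded E P"
  let ?K = "degree ?W"
  have W_vars: "vars (coeff ?W k) \<subseteq> vars P" for k
    using graded_in_polys_over[of P "vars P" E] by (auto simp: polys_over_def mpolys_def)
  have vanish: "peval a (lead_coeff ?W) = 0" if a: "\<forall>v\<in>E. a v \<noteq> 0" for a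
  proof -
    define s :: "nat \<Rightarrow> complex" where "s = (\<lambda>n. of_nat (Suc n))"
    have s0: "s n \<noteq> 0" for n by (simp add: s_def del: of_nat_Suc)
    have lim: "(\<lambda>n. z / s n) \<longlonglongrightarrow> 0" for z
      unfolding s_def using LIMSEQ_Suc[OF lim_const_over_n[of z]] by simp
    \<comment> \<open>Form k at this point is, up to small terms, its pure coefficient plus the
      scaled linear coefficient times \<open>x n k\<close>; the choice makes these two
      cancel.\<close>
    define x where "x = (\<lambda>n k. if k = 0 then 1 else - (a (k, single 0 (d k)) / a (k, lin k)) / s n)"
    define e where "e = (\<lambda>n v. if v \<in> E then s n * a v else a v)"
    define c where "c = (\<lambda>n v. if fst v < N \<and> snd v = single 0 (d (fst v))
      then - (\<Sum>\<beta>\<in>exponents N (d (fst v)) - {snd v}. e n (fst v, \<beta>) * mon (x n) \<beta>) else e n v)"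
    \<comment> \<open>\<open>b n\<close> is \<open>c n\<close> with the scaling taken out again, and
      tends to \<open>a\<close> on the variables of \<open>P\<close>. The coefficient of the power
      of x_0 in form 0 is not controlled, but does not occur in \<open>P\<close>.\<close>
    define b where "b = (\<lambda>n v. if fst v < N \<and> snd v = single 0 (d (fst v)) then c n v else a v)"
    have x0: "x n 0 = 1" for n by (simp add: x_def)
    have pure_E: "(i, single 0 (d i)) \<notin> E" for i 
    proof
      assume "(i, single 0 (d i)) \<in> E"
      then have "i \<noteq> 0" "lin i = single 0 (d i)" by (auto simp: E_def)
      then show False using lin_ne by metis
    qed
    have cb: "c n v = (if v \<in> E then s n * b n v else b n v)" for n v
      using pure_E by (cases v) (auto simp: c_def b_def e_def)
    have "fval (c n) (x n) i = 0" if "i < N" for n i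
    proof -
      have "(\<Sum>\<beta>\<in>exponents N (d i) - {single 0 (d i)}. c n (i, \<beta>) * mon (x n) \<beta>) =
          (\<Sum>\<beta>\<in>exponents N (d i) - {single 0 (d i)}. e n (i, \<beta>) * mon (x n) \<beta>)"
        by (intro sum.cong) (auto simp: c_def)
      then show ?thesis using that by (simp add: fval_remove_pure[of _ "x n", OF that x0]) (simp add: c_def)
    qed
    then have c_zero: "peval (c n) P = 0" for n
      using inertia_vanishes[OF id P(1), of "x n" "c n"] x0 by blast
    have sum0: "(\<Sum>k\<le>?K. peval (b n) (coeff ?W k) * s n ^ k) = 0" for n
    proof -
      interpret ev: comm_ring_hom "peval (b n) :: (cvar, complex) mpoly \<Rightarrow> complex"
        by (rule comm_ring_hom_meval[OF id])
      have "peval (b n) (poly ?W (mconst (s n))) = peval (c n) P"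
        unfolding poly_graded meval_meval[OF id]
        by (intro meval_cong) (simp add: cb ev.hom_mult id)
      then show ?thesis using c_zero unfolding ev.hom_poly by (simp add: id)
    qed
    have mon_lim: "(\<lambda>n. mon (x n) \<beta>) \<longlonglongrightarrow> 0"
      if \<beta>: "\<beta> \<in> exponents N (d i)" "\<beta> \<noteq> single 0 (d i)" for \<beta> i
    proof -
      obtain k where k: "k \<noteq> 0" "k \<in> keys \<beta>"
      proof (rule ccontr)
        assume *: "\<not> thesis"
        then have **: "lookup \<beta> k = 0" if "k \<noteq> 0" for k
          using that \<open>\<And>k. k \<noteq> 0 \<Longrightarrow> k \<in> keys \<beta> \<Longrightarrow> thesis\<close> by (auto simp: in_keys_iff)
        have "d i = (\<Sum>j<N. lookup \<beta> j)" using \<beta>(1) by (simp add: exponents_def)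
        also have "\<dots> = lookup \<beta> 0"
          using N_pos ** by (subst sum.remove[of _ 0]) auto
        finally have "\<beta> = single 0 (d i)"
          using ** by (intro poly_mapping_eqI) (auto simp: lookup_single when_def)
        then show False using \<beta>(2) by blast
      qed
      have xk: "(\<lambda>n. x n k) \<longlonglongrightarrow> (if k = 0 then 1 else 0)" for k
        using lim[of "- (a (k, single 0 (d k)) / a (k, lin k))"] by (auto simp: x_def)
      have "(\<lambda>n. mon (x n) \<beta>) \<longlonglongrightarrow> mon (\<lambda>k. if k = 0 then 1 else 0) \<beta>"
        unfolding mon_def by (intro tendsto_prod tendsto_power xk)
      moreover have "mon (\<lambda>k. if k = 0 then 1 else 0 :: complex) \<beta> = 0"
        unfolding mon_def by (rule prod_zero) (use k in \<open>auto simp: in_keys_iff intro!: bexI[of _ k]\<close>)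
      ultimately show ?thesis by simp
    qed
    have b_lim: "(\<lambda>n. b n v) \<longlonglongrightarrow> a v" if "v \<in> vars P" for v
    proof (cases "fst v < N \<and> snd v = single 0 (d (fst v))")
      case True
      then obtain i where i: "v = (i, single 0 (d i))" "i < N" by (cases v) auto
      then have i0: "i \<noteq> 0" using that P(2) by metis
      let ?S = "exponents N (d i) - {single 0 (d i)} - {lin i}"
      have linE: "(i, lin i) \<in> E" using i i0 by (auto simp: E_def)
      have "b n v = - (e n (i, lin i) * mon (x n) (lin i) + (\<Sum>\<beta>\<in>?S. e n (i, \<beta>) * mon (x n) \<beta>))" for n
        using i lin_exp[OF i(2)] lin_ne[OF i0]
        by (simp add: b_def c_def sum.remove[of "exponents N (d i) - {single 0 (d i)}" "lin i"])
      moreover have "e n (i, lin i) * mon (x n) (lin i) = - a v" for n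
        using linE a s0[of n] i i0 by (simp add: e_def lin_def mon_add x0) (simp add: x_def lin_def)
      moreover have "(\<Sum>\<beta>\<in>?S. e n (i, \<beta>) * mon (x n) \<beta>) = (\<Sum>\<beta>\<in>?S. a (i, \<beta>) * mon (x n) \<beta>)" for n
        by (intro sum.cong) (auto simp: e_def E_def)
      ultimately have "b n v = a v - (\<Sum>\<beta>\<in>?S. a (i, \<beta>) * mon (x n) \<beta>)" for n by simp
      moreover have "(\<lambda>n. a v - (\<Sum>\<beta>\<in>?S. a (i, \<beta>) * mon (x n) \<beta>)) \<longlonglongrightarrow> a v - (\<Sum>\<beta>\<in>?S. a (i, \<beta>) * 0)"
        by (intro tendsto_diff tendsto_sum tendsto_mult tendsto_const mon_lim) auto
      ultimately show ?thesis by simp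
    next
      case False
      then have "b n v = a v" for n by (simp only: b_def if_False)
      then show ?thesis by simp
    qed
    have coeff_lim: "(\<lambda>n. peval (b n) (coeff ?W k)) \<longlonglongrightarrow> peval a (coeff ?W k)" for k
      using W_vars b_lim by (intro tendsto_meval) auto
    \<comment> \<open>Dividing \<open>sum0\<close> by the top power of \<open>s n\<close> isolates
      the leading coefficient.\<close>
    have "peval (b n) (lead_coeff ?W) =
        - (\<Sum>k<?K. peval (b n) (coeff ?W k) * (1 / s n) ^ (?K - k))" for n
    proof -
      have "peval (b n) (lead_coeff ?W) * s n ^ ?K =
          - (\<Sum>k<?K. peval (b n) (coeff ?W k) * s n ^ k)"
        using sum0[of n] by (simp add: lessThan_Suc_atMost[symmetric] eq_neg_iff_add_eq_0 add.commute)
      then have "peval (b n) (lead_coeff ?W) =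
          - (\<Sum>k<?K. peval (b n) (coeff ?W k) * s n ^ k) / s n ^ ?K"
        by (rule eq_divide_imp[OF power_not_zero[OF s0]])
      also have "\<dots> = - (\<Sum>k<?K. peval (b n) (coeff ?W k) * s n ^ k / s n ^ ?K)"
        by (simp add: sum_divide_distrib)
      also have "(\<Sum>k<?K. peval (b n) (coeff ?W k) * s n ^ k / s n ^ ?K) =
          (\<Sum>k<?K. peval (b n) (coeff ?W k) * (1 / s n) ^ (?K - k))"
        using s0[of n] by (intro sum.cong refl) (simp add: power_diff power_one_over field_simps)
      finally show ?thesis .
    qed
    moreover have "(\<lambda>n. - (\<Sum>k<?K. peval (b n) (coeff ?W k) * (1 / s n) ^ (?K - k)))
        \<longlonglongrightarrow> - (\<Sum>k<?K. peval a (coeff ?W k) * 0 ^ (?K - k))"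
      by (intro tendsto_minus tendsto_sum tendsto_mult tendsto_power coeff_lim lim)
    ultimately have "(\<lambda>n. peval (b n) (lead_coeff ?W)) \<longlonglongrightarrow> 0"
      by (simp add: power_0_left)
    then show ?thesis using coeff_lim LIMSEQ_unique by blast
  qed
  \<comment> \<open>\<open>vanish\<close> speaks only of assignments that are nonzero on
    \<open>E\<close>; the product with the variables in \<open>E\<close> vanishes at all of
    them.\<close>
  have "lead_coeff ?W * (\<Prod>v\<in>E. mvar v) = 0"
  proof (rule mpoly_eq_0_if_vanishing)
    fix a :: "cvar \<Rightarrow> complex"
    interpret ev: comm_ring_hom "peval a :: (cvar, complex) mpoly \<Rightarrow> complex"
      by (rule comm_ring_hom_meval[OF id])
    show "peval a (lead_coeff ?W * (\<Prod>v\<in>E. mvar v)) = 0"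
    proof (cases "\<forall>v\<in>E. a v \<noteq> 0")
      case False
      then show ?thesis by (auto simp: ev.hom_mult ev.hom_prod id E_def intro!: prod_zero)
    qed (simp add: ev.hom_mult vanish)
  qed
  moreover have "(mvar v :: (cvar, complex) mpoly) \<noteq> 0" for v
    by (metis lookup_single_eq lookup_zero mvar_def zero_neq_one)
  ultimately have "lead_coeff ?W = 0" by (simp add: E_def)
  then show ?thesis by simp
qed

text \<open>\<open>R\<close> is a nonzero element of minimal size. The ideal is prime, so one of two
  factors of \<open>R\<close> would lie in it again and be smaller if the other were not a unit.
  Divisibility is seen through an element \<open>w\<close> of minimal degree in the variable
  \<open>?u\<close>: it generates the ideal up to powers of its leading coefficient, and these are
  free of \<open>?u\<close>, so \<open>R\<close> cannot divide them.\<close>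

lemma inertia_principal:
  fixes D :: "(cvar, int) mpoly"
  assumes "D \<in> inertia" "D \<noteq> 0"
  shows "\<exists>R \<in> inertia. irreducible R \<and> (\<forall>P\<in>inertia. R dvd (P :: (cvar, int) mpoly))"
proof -
  have dvdV: "P \<in> mpolys V" if "P dvd Q" "Q \<in> mpolys V" "Q \<noteq> 0"
    for P Q :: "(cvar, int) mpoly" and V
    using vars_dvd[OF that(1,3)] that(2) by (auto simp: mpolys_def)
  let ?u = "(0, single 0 (d 0))" and ?V = "coeff_vars - {(0, single 0 (d 0))}"
  have free0: "P = 0" if "P \<in> inertia" "P \<in> mpolys ?V" for P :: "(cvar, int) mpoly"
  proof -
    have "?u \<notin> vars P" using that(2) by (auto simp: mpolys_def)
    then have "(map_int P :: (cvar, complex) mpoly) = 0"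
      using that(1) by (intro inertia_without_pure_eq_0) (simp_all add: map_int_in_inertia_iff vars_map_int)
    then show ?thesis by simp
  qed
  obtain R :: "(cvar, int) mpoly" where R: "R \<in> inertia - {0}"
    and min: "\<And>P. (P, R) \<in> size_less \<Longrightarrow> P \<notin> inertia - {0}"
    using wfE_min[OF wf_size_less, of D "inertia - {0}"] assms by auto
  have RV: "R \<in> mpolys coeff_vars" using R by (simp add: inertia_def)
  have irr: "irreducible R"
  proof (rule irreducibleI)
    show "R \<noteq> 0" using R by simp
    show "\<not> R dvd 1"
    proof
      assume "R dvd 1"
      then have "normal_form R dvd 1" using normal_form.hom_dvd_1 by blast
      then show False using R by (simp add: inertia_def)
    qed
    fix a b assume ab: "R = a * b"
    have "a \<in> mpolys coeff_vars" "b \<in> mpolys coeff_vars"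
      using dvdV[OF _ RV] ab R by auto
    then have "a \<in> inertia \<or> b \<in> inertia" using inertia_prime[of a b] R ab by auto
    moreover have "b dvd 1" if "a \<in> inertia"
      using proper_divisor_size_less[of a b] min[of a] that R ab by auto
    moreover have "a dvd 1" if "b \<in> inertia"
      using proper_divisor_size_less[of b a] min[of b] that R ab by (auto simp: mult.commute)
    ultimately show "a dvd 1 \<or> b dvd 1" by blast
  qed
  have prime: "prime_elem R" using irreducible_imp_prime_elem_mpoly[OF irr] .
  let ?S = "mpolys ?V :: (cvar, int) mpoly set"
  note S = subring_mpolys[of ?V, where 'b = int]
  define I where "I = as_poly ?u ` (inertia :: (cvar, int) mpoly set)"
  have ap: "as_poly ?u P \<in> polys_over ?S" if "P \<in> mpolys coeff_vars" for P
    by (rule as_poly_in_polys_over[OF that])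
  have I: "I \<subseteq> polys_over ?S" using ap by (auto simp: I_def inertia_def)
  have I': "f - g \<in> I" if fg: "f \<in> I" "g \<in> I" for f g
  proof -
    obtain P Q where "f = as_poly ?u P" "g = as_poly ?u Q" "P \<in> inertia" "Q \<in> inertia"
      using fg unfolding I_def by blast
    then have "f - g = as_poly ?u (P - Q)" "P - Q \<in> inertia"
      using subringD(4)[OF subring_mpolys] by (auto simp: inertia_def as_poly.hom_minus normal_form.hom_minus)
    then show ?thesis by (auto simp: I_def)
  qed
  have eval_as: "as_poly ?u (poly q (mvar ?u)) = q" if "q \<in> polys_over ?S" for q
  proof -
    have "as_poly ?u (coeff q i) = [:coeff q i:]" for i
      using that by (intro as_poly_const) (auto simp: polys_over_def mpolys_def)
    moreover have "as_poly ?u (mvar ?u :: (cvar, int) mpoly) = [:0, 1:]"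
      by (simp add: as_poly_def comm_ring_hom_pconst_mconst)
    ultimately have "as_poly ?u (poly q (mvar ?u)) = (\<Sum>i\<le>degree q. Polynomial.smult (coeff q i) ([:0, 1:] ^ i))"
      unfolding as_poly.hom_poly by simp
    also have "\<dots> = q"
      by (simp only: monom_altdef[symmetric] poly_as_sum_of_monoms)
    finally show ?thesis .
  qed
  have u: "?u \<in> coeff_vars" using N_pos single_in_exponents by (auto simp: coeff_vars_def)
  have I'': "q * f \<in> I" if fI: "f \<in> I" and "q \<in> polys_over ?S" for f q
  proof -
    obtain P where P: "f = as_poly ?u P" "P \<in> inertia" using fI by (auto simp: I_def)
    have "q * f = as_poly ?u (poly q (mvar ?u) * P)" by (simp add: P as_poly.hom_mult eval_as that)
    moreover have "poly q (mvar ?u) * P \<in> inertia"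
      using poly_in_mpolys[OF that(2) _ u] by (intro inertia_mult P) auto
    ultimately show ?thesis by (auto simp: I_def)
  qed
  have RI: "as_poly ?u R \<in> I" using R by (auto simp: I_def)
  obtain w where w: "w \<in> I" "w \<noteq> 0" "\<And>f. f \<in> I \<Longrightarrow> f \<noteq> 0 \<Longrightarrow> degree w \<le> degree f"
    using ex_min_degree[OF RI] R by auto
  obtain W where W: "w = as_poly ?u W" "W \<in> inertia" using w(1) by (auto simp: I_def)
  let ?l = "lead_coeff w"
  have l: "?l \<in> ?S" "?l \<noteq> 0" using w I by (auto simp: polys_over_def)
  have div: "\<exists>q k. ?l ^ k * P = q * W" if "P \<in> inertia" for P
  proof -
    have "as_poly ?u P \<in> I" using that by (auto simp: I_def)
    from pseudo_generator[OF S I I' I'' w this] obtain q k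
      where "Polynomial.smult (?l ^ k) (as_poly ?u P) = q * w" by auto
    from arg_cong[OF this, of "\<lambda>p. poly p (mvar ?u)"] show ?thesis by (auto simp: W)
  qed
  have not_dvd: "\<not> R dvd l" if "l \<in> ?S" "l \<noteq> 0" for l
  proof
    assume "R dvd l"
    then have "R \<in> mpolys ?V" using dvdV that by blast
    then show False using free0 R by blast
  qed
  have lk: "?l ^ k \<in> ?S" "?l ^ k \<noteq> 0" for k using l subringD(7)[OF S] by auto
  obtain q k where qk: "?l ^ k * R = q * W" using div[of R] R by auto
  then have "R dvd q * W" by (metis dvd_triv_right)
  then have "R dvd q \<or> R dvd W" using prime prime_elem_dvd_mult_iff by blast
  \<comment> \<open>Otherwise \<open>W\<close> divides a power of the leading coefficient and is
    free of \<open>?u\<close>, but 0 is the only such element of the ideal.\<close>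
  moreover have "\<not> R dvd q"
  proof
    assume "R dvd q"
    then obtain q' where "q = R * q'" by auto
    then have "R * (?l ^ k) = R * (q' * W)" using qk by (simp add: ac_simps)
    then have "?l ^ k = q' * W" using R by simp
    then have "W \<in> ?S" using dvdV[of W "?l ^ k"] lk by (metis dvd_triv_right)
    then show False using free0[OF W(2)] W(1) w(2) by simp
  qed
  ultimately have RW: "R dvd W" by blast
  have "R dvd P" if P: "P \<in> inertia" for P
  proof -
    obtain q k where "?l ^ k * P = q * W" using div[OF P] by auto
    then have "R dvd ?l ^ k * P" using RW by simp
    then have "R dvd ?l ^ k \<or> R dvd P" using prime prime_elem_dvd_mult_iff by blast
    then show ?thesis using not_dvd lk by blast
  qed
  then show ?thesis using R irr by blast
qed

text \<open>Expanding the coefficients of \<open>P\<close> in numbers independent over the integers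
  splits \<open>P\<close> into integer polynomials. The normal form respects this splitting, so each
  of them lies in the integer ideal.\<close>

lemma map_int_dvd_inertia:
  fixes P :: "(cvar, complex) mpoly"
  assumes R: "\<And>P :: (cvar, int) mpoly. P \<in> inertia \<Longrightarrow> R dvd P" and P: "P \<in> inertia"
  shows "map_int R dvd P"
proof -
  obtain K b q where b: "int_independent K b" and Pq: "P = (\<Sum>k<K. map_int (q k) * mconst (b k))"
    and vars: "\<And>k. vars (q k) \<subseteq> vars P"
    by (rule complex_mpoly_decomposition[of P], rule that)
  have "normal_form P = (\<Sum>k<K. map_int (normal_form (q k)) * mconst (b k))"
    unfolding Pq normal_form.hom_sum normal_form.hom_mult normal_form_map_int
    by (simp add: normal_form_def comm_ring_hom_mconst)
  then have "normal_form (q k) = 0" if "k < K" for k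
    using int_independent_mpoly[OF b _ that, of "\<lambda>k. normal_form (q k)"] P by (simp add: inertia_def)
  then have "R dvd q k" if "k < K" for k
    using R[of "q k"] vars[of k] P that by (auto simp: inertia_def mpolys_def)
  then show ?thesis unfolding Pq by (intro dvd_sum dvd_mult2 map_int.hom_dvd) auto
qed

lemma fval_scale: "fval c (\<lambda>k. t * x k) i = t ^ d i * fval c x i"
proof -
  have "mon (\<lambda>k. t * x k) \<alpha> = t ^ d i * mon x \<alpha>" if "\<alpha> \<in> exponents N (d i)" for \<alpha>
    using that mon_exponents[OF that, of "\<lambda>_. t"]
    by (simp add: mon_mult power_sum[symmetric]) (simp add: exponents_def)
  then show ?thesis unfolding fval_def by (simp add: sum_distrib_left mult_ac)
qed

text \<open>Zeros with first coordinate 1 are covered by construction, those with nonzero first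
  coordinate by rescaling, and the others by a limit; so no coordinate is distinguished in the
  end.\<close>

lemma inertia_vanishes_at_nontrivial_zero:
  fixes P :: "(cvar, complex) mpoly"
  assumes P: "P \<in> inertia" and x: "k < N" "x k \<noteq> 0" "\<And>i. i < N \<Longrightarrow> fval c x i = 0"
  shows "peval c P = 0"
proof -
  note id = comm_ring_hom_id
  have nz: "peval c P = 0" if "x 0 \<noteq> 0" "\<And>i. i < N \<Longrightarrow> fval c x i = 0" for c and x :: "nat \<Rightarrow> complex"
  proof (rule inertia_vanishes[OF id P, of "\<lambda>k. (1 / x 0) * x k"])
    show "fval c (\<lambda>k. 1 / x 0 * x k) i = 0" if "i < N" for i
      unfolding fval_scale using \<open>\<And>i. i < N \<Longrightarrow> fval c x i = 0\<close>[OF that] by simp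
  qed (use that in auto)
  show ?thesis
  proof (cases "x 0 = 0")
    case True
    text \<open>Perturb the zero such that its first coordinate no longer vanishes, and adjust the system.\<close>
    define y where "y = (\<lambda>n. x(0 := 1 / of_nat (Suc n)))"
    \<comment> \<open>The correction sits in the coefficient of x_k^(d_i). Since x_k is nonzero and
      not perturbed, it makes every form vanish at \<open>y n\<close>, and it tends to 0.\<close>
    define b where "b = (\<lambda>n v. if fst v < N \<and> snd v = single k (d (fst v))
      then c v - fval c (y n) (fst v) / x k ^ d (fst v) else c v)"
    have k0: "k \<noteq> 0" using True x(2) by metis
    have "fval (b n) (y n) i = 0" if "i < N" for n i
    proof -
      have "fval (b n) (y n) i = (\<Sum>\<alpha>\<in>exponents N (d i). c (i, \<alpha>) * mon (y n) \<alpha> -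
          (if \<alpha> = single k (d i) then fval c (y n) i / x k ^ d i * mon (y n) \<alpha> else 0))"
        unfolding fval_def[of "b n"] using that by (intro sum.cong) (auto simp: b_def algebra_simps)
      also have "\<dots> = fval c (y n) i - fval c (y n) i / x k ^ d i * y n k ^ d i"
        using single_in_exponents[OF x(1)] by (simp add: sum_subtractf fval_def)
      also have "\<dots> = 0" using x(2) k0 by (simp add: y_def)
      finally show ?thesis .
    qed
    moreover have "y n 0 \<noteq> 0" for n by (simp add: y_def del: of_nat_Suc)
    ultimately have zero: "peval (b n) P = 0" for n by (intro nz) auto
    have "(\<lambda>n. 1 / of_nat (Suc n) :: complex) \<longlonglongrightarrow> 0"
      using LIMSEQ_Suc[OF lim_const_over_n[of 1]] by simp
    then have y: "(\<lambda>n. y n j) \<longlonglongrightarrow> x j" for j using True by (cases "j = 0") (auto simp: y_def)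
    have "(\<lambda>n. fval c (y n) i) \<longlonglongrightarrow> fval c x i" for i
      unfolding fval_def mon_def by (intro tendsto_sum tendsto_mult tendsto_const tendsto_prod tendsto_power y)
    then have f: "(\<lambda>n. fval c (y n) i) \<longlonglongrightarrow> 0" if "i < N" for i using x(3)[OF that] by metis
    have "(\<lambda>n. b n v) \<longlonglongrightarrow> c v" for v
    proof (cases "fst v < N \<and> snd v = single k (d (fst v))")
      case True
      have "(\<lambda>n. c v - fval c (y n) (fst v) / x k ^ d (fst v)) \<longlonglongrightarrow> c v - 0 / x k ^ d (fst v)"
        using True x(2) by (intro tendsto_intros f) auto
      then show ?thesis using True by (simp add: b_def)
    next
      case False
      then have "b n v = c v" for n by (simp only: b_def if_False)
      then show ?thesis by simp
    qed
    then have "(\<lambda>n. peval (b n) P) \<longlonglongrightarrow> peval c P" by (intro tendsto_meval)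
    then show ?thesis unfolding zero using LIMSEQ_unique tendsto_const by blast
  qed (use nz x in blast)
qed

end

section \<open>Determinants in the ideal of inertia forms\<close>

lemma lookup_times_single_add:
  fixes p :: "('v, 'a::comm_ring_1) mpoly"
  shows "lookup (p * single \<delta> c) (\<gamma> + \<delta>) = lookup p \<gamma> * c"
  by (induction p rule: poly_mapping_additive_induct)
     (auto simp: mult_single lookup_single when_def lookup_add distrib_right)

lemma lookup_times_single_eq_0:
  fixes p :: "('v, 'a::comm_ring_1) mpoly"
  assumes "\<And>\<gamma>. \<gamma> + \<delta> \<noteq> \<beta>"
  shows "lookup (p * single \<delta> c) \<beta> = 0"
  using assms
  by (induction p rule: poly_mapping_additive_induct)
     (auto simp: mult_single lookup_single when_def lookup_add distrib_right)

lemma diff_single_add: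
  assumes "k \<le> lookup \<alpha> j" shows "\<alpha> - single j k + single j k = (\<alpha> :: 'b \<Rightarrow>\<^sub>0 nat)"
  by (rule poly_mapping_eqI) (use assms in \<open>auto simp: lookup_add lookup_minus lookup_single when_def\<close>)

lemma exponents_cancel:
  assumes "\<gamma> + \<delta> \<in> exponents N \<nu>" "\<delta> \<in> exponents N k" shows "\<gamma> \<in> exponents N (\<nu> - k)"
proof -
  have "keys \<gamma> \<subseteq> keys (\<gamma> + \<delta>)" by (auto simp: in_keys_iff lookup_add)
  then show ?thesis using assms by (auto simp: exponents_def lookup_add sum.distrib)
qed

lemma (in comm_ring_hom) hom_if: "hom (if b then x else y) = (if b then hom x else hom y)"
  by simp

context form_degrees
begin

text \<open>
  The matrix with rows the coefficient vectors of \<open>\<Sum>\<^sub>i h\<^sub>\<beta>\<^sub>i F\<^sub>i\<close>, where the \<open>F\<^sub>i\<close> are the generic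
  forms and the \<open>h\<^sub>\<beta>\<^sub>i\<close> are fixed forms, one row for each monomial \<open>\<beta>\<close> of degree \<open>\<nu>\<close>.
\<close>

definition comb_entry :: "nat \<Rightarrow> ((nat \<Rightarrow>\<^sub>0 nat) \<Rightarrow> nat \<Rightarrow> (nat \<Rightarrow>\<^sub>0 nat) \<Rightarrow> 'a::comm_ring_1) \<Rightarrow>
    (nat \<Rightarrow>\<^sub>0 nat) \<Rightarrow> (nat \<Rightarrow>\<^sub>0 nat) \<Rightarrow> (cvar, 'a) mpoly" where
  "comb_entry \<nu> h \<beta> \<beta>' = (\<Sum>i<N. \<Sum>\<gamma>\<in>exponents N (\<nu> - d i). \<Sum>\<delta>\<in>exponents N (d i).
     if \<gamma> + \<delta> = \<beta>' then mconst (h \<beta> i \<gamma>) * mvar (i, \<delta>) else 0)"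

definition monomials :: "nat \<Rightarrow> (nat \<Rightarrow>\<^sub>0 nat) list" where
  "monomials \<nu> = (SOME L. distinct L \<and> set L = exponents N \<nu>)"

lemma monomials: "distinct (monomials \<nu>)" "set (monomials \<nu>) = exponents N \<nu>"
  using someI_ex[of "\<lambda>L. distinct L \<and> set L = exponents N \<nu>"] finite_distinct_list[OF finite_exponents]
  unfolding monomials_def by (metis (no_types, lifting))+

lemma sum_monomials: "(\<Sum>s<length (monomials \<nu>). f (monomials \<nu> ! s)) = (\<Sum>\<beta>\<in>exponents N \<nu>. f \<beta>)"
  using bij_betw_nth[OF monomials(1) refl monomials(2)[symmetric]]
  by (intro sum.reindex_bij_betw) (simp add: lessThan_def)

lemma prod_monomials: "(\<Prod>s<length (monomials \<nu>). f (monomials \<nu> ! s)) = (\<Prod>\<beta>\<in>exponents N \<nu>. f \<beta>)"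
  using bij_betw_nth[OF monomials(1) refl monomials(2)[symmetric]]
  by (intro prod.reindex_bij_betw) (simp add: lessThan_def)

definition comb_mat :: "nat \<Rightarrow> ((nat \<Rightarrow>\<^sub>0 nat) \<Rightarrow> nat \<Rightarrow> (nat \<Rightarrow>\<^sub>0 nat) \<Rightarrow> 'a::comm_ring_1) \<Rightarrow>
    (cvar, 'a) mpoly mat" where
  "comb_mat \<nu> h = mat (length (monomials \<nu>)) (length (monomials \<nu>))
     (\<lambda>(r, s). comb_entry \<nu> h (monomials \<nu> ! r) (monomials \<nu> ! s))"

definition comb_det :: "nat \<Rightarrow> ((nat \<Rightarrow>\<^sub>0 nat) \<Rightarrow> nat \<Rightarrow> (nat \<Rightarrow>\<^sub>0 nat) \<Rightarrow> 'a::comm_ring_1) \<Rightarrow>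
    (cvar, 'a) mpoly" where
  "comb_det \<nu> h = det (comb_mat \<nu> h)"

lemma det_mat:
  "det (mat k k (\<lambda>(r, s). f r s)) =
     (\<Sum>p | p permutes {0..<k}. of_int (sign p) * (\<Prod>r = 0..<k. f r (p r)))"
proof -
  have "(\<Prod>r = 0..<k. mat k k (\<lambda>(r, s). f r s) $$ (r, p r)) = (\<Prod>r = 0..<k. f r (p r))"
    if "p permutes {0..<k}" for p
    using permutes_in_image[OF that] by (intro prod.cong) auto
  then show ?thesis unfolding det_def by (auto intro!: sum.cong)
qed

lemma of_int_in_subring: "subring S \<Longrightarrow> of_int (sign p) \<in> S"
  by (cases "sign p = 1") (auto simp: sign_def intro: subringD)

lemma comb_entry_in_mpolys: "comb_entry \<nu> h \<beta> \<beta>' \<in> mpolys coeff_vars"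
  unfolding comb_entry_def
proof (intro subringD(8)[OF subring_mpolys])
  fix i \<gamma> \<delta> assume "i \<in> {..<N}" "\<delta> \<in> exponents N (d i)"
  then have "(i, \<delta>) \<in> coeff_vars" by (simp add: coeff_vars_def)
  then show "(if \<gamma> + \<delta> = \<beta>' then mconst (h \<beta> i \<gamma>) * mvar (i, \<delta>) else 0) \<in> mpolys coeff_vars"
    by (auto intro: subringD[OF subring_mpolys] mvar_in_mpolys)
qed

lemma comb_det_in_mpolys: "comb_det \<nu> h \<in> mpolys coeff_vars"
  unfolding comb_det_def comb_mat_def det_mat
  by (intro subringD(5,8,9)[OF subring_mpolys] of_int_in_subring subring_mpolys comb_entry_in_mpolys)

lemma meval_comb_entry:
  assumes "comm_ring_hom \<phi>"
  shows "meval \<phi> c (comb_entry \<nu> h \<beta> \<beta>') = (\<Sum>i<N. \<Sum>\<gamma>\<in>exponents N (\<nu> - d i). \<Sum>\<delta>\<in>exponents N (d i).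
     if \<gamma> + \<delta> = \<beta>' then \<phi> (h \<beta> i \<gamma>) * c (i, \<delta>) else 0)"
proof -
  interpret ev: comm_ring_hom "meval \<phi> c" by (rule comm_ring_hom_meval[OF assms])
  show ?thesis using assms by (simp add: comb_entry_def ev.hom_sum ev.hom_if ev.hom_mult cong: if_cong)
qed

lemma (in comm_ring_hom) hom_det_mat:
  "hom (det (mat k k (\<lambda>(r, s). f r s))) = det (mat k k (\<lambda>(r, s). hom (f r s)))"
  unfolding hom_det[symmetric] by (intro arg_cong[where f = det] eq_matI) auto

lemma sum_swap4:
  "(\<Sum>b\<in>B. \<Sum>i\<in>I. \<Sum>x\<in>X i. \<Sum>y\<in>Y i. f b i x y) = (\<Sum>i\<in>I. \<Sum>x\<in>X i. \<Sum>y\<in>Y i. \<Sum>b\<in>B. f b i x y)"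
proof -
  have "(\<Sum>b\<in>B. \<Sum>i\<in>I. \<Sum>x\<in>X i. \<Sum>y\<in>Y i. f b i x y) = (\<Sum>i\<in>I. \<Sum>b\<in>B. \<Sum>x\<in>X i. \<Sum>y\<in>Y i. f b i x y)"
    by (rule sum.swap)
  also have "\<dots> = (\<Sum>i\<in>I. \<Sum>x\<in>X i. \<Sum>b\<in>B. \<Sum>y\<in>Y i. f b i x y)"
    by (intro sum.cong refl sum.swap)
  also have "\<dots> = (\<Sum>i\<in>I. \<Sum>x\<in>X i. \<Sum>y\<in>Y i. \<Sum>b\<in>B. f b i x y)"
    by (intro sum.cong refl sum.swap)
  finally show ?thesis .
qed

text \<open>The vector of the monomials at \<open>x\<close> lies in the kernel of the matrix, since
  each row is a combination of forms vanishing at \<open>x\<close>. It is nonzero, as its entry at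
  x_0^\<nu> is 1.\<close>

lemma comb_det_vanishes:
  fixes c :: "cvar \<Rightarrow> complex"
  assumes deg: "\<And>i. i < N \<Longrightarrow> d i \<le> \<nu>" and x: "x 0 = 1" "\<And>i. i < N \<Longrightarrow> fval c x i = 0"
  shows "peval c (comb_det \<nu> h) = 0"
proof -
  note id = comm_ring_hom_id
  interpret ev: comm_ring_hom "peval c :: (cvar, complex) mpoly \<Rightarrow> complex"
    by (rule comm_ring_hom_meval[OF id])
  let ?L = "monomials \<nu>" and ?k = "length (monomials \<nu>)"
  let ?A = "mat ?k ?k (\<lambda>(r, s). peval c (comb_entry \<nu> h (?L ! r) (?L ! s)))"
  define v where "v = vec ?k (\<lambda>s. mon x (?L ! s))"
  have "(\<Sum>\<beta>'\<in>exponents N \<nu>. peval c (comb_entry \<nu> h \<beta> \<beta>') * mon x \<beta>') = 0" for \<beta>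
  proof -
    have "(\<Sum>\<beta>'\<in>exponents N \<nu>. peval c (comb_entry \<nu> h \<beta> \<beta>') * mon x \<beta>') =
      (\<Sum>\<beta>'\<in>exponents N \<nu>. \<Sum>i<N. \<Sum>\<gamma>\<in>exponents N (\<nu> - d i). \<Sum>\<delta>\<in>exponents N (d i).
        if \<gamma> + \<delta> = \<beta>' then h \<beta> i \<gamma> * c (i, \<delta>) * mon x \<beta>' else 0)"
      by (simp add: meval_comb_entry id sum_distrib_right if_distrib[of "\<lambda>z. z * _"] cong: if_cong)
    also have "\<dots> = (\<Sum>i<N. \<Sum>\<gamma>\<in>exponents N (\<nu> - d i). \<Sum>\<delta>\<in>exponents N (d i). \<Sum>\<beta>'\<in>exponents N \<nu>.
        if \<gamma> + \<delta> = \<beta>' then h \<beta> i \<gamma> * c (i, \<delta>) * mon x \<beta>' else 0)"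
      by (rule sum_swap4)
    also have "\<dots> = (\<Sum>i<N. \<Sum>\<gamma>\<in>exponents N (\<nu> - d i). h \<beta> i \<gamma> * mon x \<gamma> * fval c x i)"
    proof (intro sum.cong refl)
      fix i \<gamma> assume i: "i \<in> {..<N}" and \<gamma>: "\<gamma> \<in> exponents N (\<nu> - d i)"
      have "(\<Sum>\<delta>\<in>exponents N (d i). \<Sum>\<beta>'\<in>exponents N \<nu>.
          if \<gamma> + \<delta> = \<beta>' then h \<beta> i \<gamma> * c (i, \<delta>) * mon x \<beta>' else 0) =
          (\<Sum>\<delta>\<in>exponents N (d i). h \<beta> i \<gamma> * mon x \<gamma> * (c (i, \<delta>) * mon x \<delta>))"
      proof (rule sum.cong[OF refl])
        fix \<delta> assume "\<delta> \<in> exponents N (d i)"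
        then have "\<gamma> + \<delta> \<in> exponents N \<nu>" using add_in_exponents[OF \<gamma>] deg[of i] i by fastforce
        then show "(\<Sum>\<beta>'\<in>exponents N \<nu>. if \<gamma> + \<delta> = \<beta>' then h \<beta> i \<gamma> * c (i, \<delta>) * mon x \<beta>' else 0) =
            h \<beta> i \<gamma> * mon x \<gamma> * (c (i, \<delta>) * mon x \<delta>)"
          by (simp add: mon_add mult_ac)
      qed
      then show "(\<Sum>\<delta>\<in>exponents N (d i). \<Sum>\<beta>'\<in>exponents N \<nu>.
          if \<gamma> + \<delta> = \<beta>' then h \<beta> i \<gamma> * c (i, \<delta>) * mon x \<beta>' else 0) = h \<beta> i \<gamma> * mon x \<gamma> * fval c x i"
        by (simp add: fval_def sum_distrib_left)
    qed
    finally show ?thesis using x(2) by simp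
  qed
  then have "?A *\<^sub>v v = 0\<^sub>v ?k"
    by (intro eq_vecI)
       (auto simp: v_def scalar_prod_def lessThan_atLeast0[symmetric]
         sum_monomials[of "\<lambda>\<beta>. peval c (comb_entry \<nu> h _ \<beta>) * mon x \<beta>"])
  moreover have "v \<noteq> 0\<^sub>v ?k"
  proof
    assume *: "v = 0\<^sub>v ?k"
    obtain s where s: "s < ?k" "?L ! s = single 0 \<nu>"
      using single_in_exponents[OF N_pos] monomials(2) by (metis in_set_conv_nth)
    have "v $ s = 1" using s x(1) by (simp add: v_def)
    then show False using * s by simp
  qed
  moreover have "v \<in> carrier_vec ?k" by (simp add: v_def)
  ultimately have "det ?A = 0"
    by (subst det_0_iff_vec_prod_zero_field[of _ ?k]) (simp, blast)
  then show ?thesis unfolding comb_det_def comb_mat_def ev.hom_det_mat .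
qed

lemma comb_det_in_inertia:
  fixes h :: "(nat \<Rightarrow>\<^sub>0 nat) \<Rightarrow> nat \<Rightarrow> (nat \<Rightarrow>\<^sub>0 nat) \<Rightarrow> complex"
  assumes "\<And>i. i < N \<Longrightarrow> d i \<le> \<nu>"
  shows "comb_det \<nu> h \<in> inertia"
proof (rule inertiaI[OF comb_det_in_mpolys])
  fix c x assume "x 0 = 1" "\<And>i. i < N \<Longrightarrow> fval c x i = (0 :: complex)"
  then show "peval c (comb_det \<nu> h) = 0"
    using assms by (intro comb_det_vanishes[of \<nu> x c]) auto
qed

lemma map_int_comb_det: "map_int (comb_det \<nu> h) = comb_det \<nu> (\<lambda>\<beta> i \<gamma>. of_int (h \<beta> i \<gamma>))"
  unfolding comb_det_def comb_mat_def map_int.hom_det_mat comb_entry_def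
    map_int.hom_sum map_int.hom_if map_int.hom_mult by (simp cong: if_cong)

lemma int_comb_det_in_inertia:
  fixes h :: "(nat \<Rightarrow>\<^sub>0 nat) \<Rightarrow> nat \<Rightarrow> (nat \<Rightarrow>\<^sub>0 nat) \<Rightarrow> int"
  assumes "\<And>i. i < N \<Longrightarrow> d i \<le> \<nu>"
  shows "comb_det \<nu> h \<in> inertia"
proof -
  have "(map_int (comb_det \<nu> h) :: (cvar, complex) mpoly) \<in> inertia"
    unfolding map_int_comb_det by (rule comb_det_in_inertia[OF assms])
  then show ?thesis by (simp only: map_int_in_inertia_iff)
qed

lemma meval_comb_det_1:
  assumes "comm_ring_hom \<phi>"
    and "\<And>\<beta> \<beta>'. \<beta> \<in> exponents N \<nu> \<Longrightarrow> \<beta>' \<in> exponents N \<nu> \<Longrightarrow>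
      meval \<phi> c (comb_entry \<nu> h \<beta> \<beta>') = (if \<beta> = \<beta>' then 1 else 0)"
  shows "meval \<phi> c (comb_det \<nu> h) = 1"
proof -
  interpret ev: comm_ring_hom "meval \<phi> c" by (rule comm_ring_hom_meval[OF assms(1)])
  have "monomials \<nu> ! r \<in> exponents N \<nu>" if "r < length (monomials \<nu>)" for r
    using monomials(2) that nth_mem by blast
  then have "mat (length (monomials \<nu>)) (length (monomials \<nu>))
      (\<lambda>(r, s). meval \<phi> c (comb_entry \<nu> h (monomials \<nu> ! r) (monomials \<nu> ! s))) =
      1\<^sub>m (length (monomials \<nu>))"
    using monomials(1) by (intro eq_matI) (auto simp: assms(2) nth_eq_iff_index_eq)
  then show ?thesis unfolding comb_det_def comb_mat_def ev.hom_det_mat by simp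
qed

text \<open>By the Nullstellensatz some power of each variable is a combination of the specialized
  forms, hence so is every monomial of a large degree. With these combinations as rows, the matrix
  becomes the identity at \<open>c\<close>.\<close>

lemma ex_nonvanishing_inertia:
  fixes c :: "cvar \<Rightarrow> complex"
  assumes nz: "\<And>x k. k < N \<Longrightarrow> x k \<noteq> 0 \<Longrightarrow> \<exists>i<N. fval c x i \<noteq> 0"
  shows "\<exists>D\<in>inertia. peval c D = 1"
proof -
  note id = comm_ring_hom_id
  define f where "f = (\<lambda>i. \<Sum>\<alpha>\<in>exponents N (d i). single \<alpha> (c (i, \<alpha>)))"
  have f_eval: "peval x (f i) = fval c x i" for x i
  proof -
    interpret ev: comm_ring_hom "peval x :: (nat, complex) mpoly \<Rightarrow> complex"
      by (rule comm_ring_hom_meval[OF id])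
    show ?thesis by (simp add: f_def ev.hom_sum meval_single fval_def)
  qed
  have "\<exists>K a. mvar j ^ K = (\<Sum>i<N. a i * f i)" if "j < N" for j
  proof (rule nullstellensatz)
    fix x assume "\<And>i. i < N \<Longrightarrow> peval x (f i) = 0"
    then show "peval x (mvar j) = 0" using nz[OF that, of x] by (auto simp: f_eval id)
  qed auto
  then obtain K a where Ka: "\<And>j. j < N \<Longrightarrow> mvar j ^ K j = (\<Sum>i<N. a j i * f i)" by metis
  \<comment> \<open>By the pigeonhole principle a monomial of this degree contains some x_j to the
    power \<open>K j\<close>; the summands \<open>d j\<close> make the inequality strict and ensure
    \<open>d i \<le> \<nu>\<close>.\<close>
  define \<nu> where "\<nu> = (\<Sum>j<N. K j + d j)"
  have deg: "d i \<le> \<nu>" if "i < N" for i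
  proof -
    have "K i + d i \<le> \<nu>" unfolding \<nu>_def using that by (intro member_le_sum) auto
    then show ?thesis by simp
  qed
  have "\<exists>j<N. K j \<le> lookup \<alpha> j" if "\<alpha> \<in> exponents N \<nu>" for \<alpha>
  proof (rule ccontr)
    assume *: "\<not> ?thesis"
    have "\<nu> = (\<Sum>j<N. lookup \<alpha> j)" using that by (simp add: exponents_def)
    also have "\<dots> < (\<Sum>j<N. K j + d j)"
      using * N_pos by (intro sum_strict_mono) (auto simp: not_le trans_less_add1)
    finally show False by (simp add: \<nu>_def)
  qed
  then obtain jj where jj: "\<And>\<alpha>. \<alpha> \<in> exponents N \<nu> \<Longrightarrow> jj \<alpha> < N \<and> K (jj \<alpha>) \<le> lookup \<alpha> (jj \<alpha>)"
    by metis
  define p where "p = (\<lambda>\<alpha> i. single (\<alpha> - single (jj \<alpha>) (K (jj \<alpha>))) 1 * a (jj \<alpha>) i)"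
  have single_p: "single \<alpha> 1 = (\<Sum>i<N. p \<alpha> i * f i)" if "\<alpha> \<in> exponents N \<nu>" for \<alpha>
  proof -
    have "(\<Sum>i<N. p \<alpha> i * f i) = single (\<alpha> - single (jj \<alpha>) (K (jj \<alpha>))) 1 * mvar (jj \<alpha>) ^ K (jj \<alpha>)"
      using Ka jj[OF that] by (simp add: p_def sum_distrib_left mult.assoc)
    also have "mvar (jj \<alpha>) ^ K (jj \<alpha>) = (single (single (jj \<alpha>) (K (jj \<alpha>))) 1 :: (nat, complex) mpoly)"
      using mon_mvar[of "single (jj \<alpha>) (K (jj \<alpha>))"] by simp
    finally show ?thesis using jj[OF that] by (simp add: mult_single diff_single_add)
  qed
  define h where "h = (\<lambda>\<alpha> i \<gamma>. lookup (p \<alpha> i) \<gamma>)"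
  have "peval c (comb_det \<nu> h) = 1"
  proof (rule meval_comb_det_1[OF id])
    fix \<alpha> \<beta>' assume \<alpha>: "\<alpha> \<in> exponents N \<nu>" and \<beta>': "\<beta>' \<in> exponents N \<nu>"
    \<comment> \<open>The combinations need not be homogeneous: as \<open>f i\<close> is, only their
      parts of degree \<open>\<nu> - d i\<close> contribute to monomials of degree \<nu>.\<close>
    have "(\<Sum>\<gamma>\<in>exponents N (\<nu> - d i). if \<gamma> + \<delta> = \<beta>' then h \<alpha> i \<gamma> * c (i, \<delta>) else 0) =
        lookup (p \<alpha> i * single \<delta> (c (i, \<delta>))) \<beta>'"
      if \<delta>: "\<delta> \<in> exponents N (d i)" for i \<delta>
    proof (cases "\<exists>\<gamma>. \<gamma> + \<delta> = \<beta>'")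
      case True
      then obtain \<gamma>0 where \<gamma>0: "\<beta>' = \<gamma>0 + \<delta>" by auto
      then have "\<gamma>0 \<in> exponents N (\<nu> - d i)" using exponents_cancel \<beta>' \<delta> by blast
      then show ?thesis by (simp add: \<gamma>0 lookup_times_single_add h_def)
    next
      case False
      then show ?thesis by (simp add: lookup_times_single_eq_0)
    qed
    then have "peval c (comb_entry \<nu> h \<alpha> \<beta>') =
        (\<Sum>i<N. \<Sum>\<delta>\<in>exponents N (d i). lookup (p \<alpha> i * single \<delta> (c (i, \<delta>))) \<beta>')"
      unfolding meval_comb_entry[OF id] by (subst sum.swap) simp
    also have "\<dots> = lookup (\<Sum>i<N. p \<alpha> i * f i) \<beta>'"
      by (simp add: f_def sum_distrib_left lookup_sum)
    finally show "peval c (comb_entry \<nu> h \<alpha> \<beta>') = (if \<alpha> = \<beta>' then 1 else 0)"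
      unfolding single_p[OF \<alpha>, symmetric] by (simp add: lookup_single when_def)
  qed
  then show ?thesis using comb_det_in_inertia[OF deg] by blast
qed

definition pure_coeffs :: "cvar \<Rightarrow> 'a::comm_ring_1" where
  "pure_coeffs v = (if snd v = single (fst v) (d (fst v)) then 1 else 0)"

text \<open>
  Macaulay's determinant. A monomial is assigned to the row of \<open>F\<^sub>i\<close> only if no other form can
  take it, which keeps the degree in the coefficients of \<open>F\<^sub>i\<close> as small as possible.
\<close>

lemma ex_macaulay_det:
  assumes i: "i < N"
  shows "\<exists>(D :: (cvar, int) mpoly) m. D \<in> inertia \<and> D \<noteq> 0 \<and>
    meval of_int pure_coeffs D = (1 :: int) \<and>
    graded ({i} \<times> UNIV) D = [:0, 1:] ^ m * [:D:] \<and> m \<le> (\<Prod>j\<in>{..<N} - {i}. d j)"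
proof -
  \<comment> \<open>Macaulay's degree, the smallest in which every monomial is divisible by some
    x_j^(d_j).\<close>
  define \<nu> where "\<nu> = Suc (\<Sum>j<N. d j - 1)"
  have deg: "d j \<le> \<nu>" if "j < N" for j
  proof -
    have "d j - 1 \<le> (\<Sum>j<N. d j - 1)" using that by (intro member_le_sum[of j "{..<N}" "\<lambda>j. d j - 1"]) auto
    then show ?thesis by (simp add: \<nu>_def)
  qed
  define good where "good = (\<lambda>\<alpha> j. j < N \<and> j \<noteq> i \<and> d j \<le> lookup \<alpha> j)"
  define k where "k = (\<lambda>\<alpha>. if Ex (good \<alpha>) then (SOME j. good \<alpha> j) else i)"
  have k: "k \<alpha> < N \<and> d (k \<alpha>) \<le> lookup \<alpha> (k \<alpha>)" if \<alpha>: "\<alpha> \<in> exponents N \<nu>" for \<alpha>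
  proof (cases "Ex (good \<alpha>)")
    case True
    then have "good \<alpha> (k \<alpha>)" using someI_ex[OF True] by (simp add: k_def)
    then show ?thesis by (simp add: good_def)
  next
    case False
    have "(\<Sum>j\<in>{..<N} - {i}. lookup \<alpha> j) \<le> (\<Sum>j\<in>{..<N} - {i}. d j - 1)"
    proof (rule sum_mono)
      fix j assume "j \<in> {..<N} - {i}"
      then have "\<not> d j \<le> lookup \<alpha> j" using False by (auto simp: good_def)
      then show "lookup \<alpha> j \<le> d j - 1" by simp
    qed
    moreover have "(\<Sum>j<N. lookup \<alpha> j) = \<nu>" using \<alpha> by (simp add: exponents_def)
    then have "lookup \<alpha> i + (\<Sum>j\<in>{..<N} - {i}. lookup \<alpha> j) = Suc ((d i - 1) + (\<Sum>j\<in>{..<N} - {i}. d j - 1))"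
      using i unfolding \<nu>_def by (simp add: sum.remove[of "{..<N}" i])
    ultimately have "d i \<le> lookup \<alpha> i" using d_pos[OF i] by simp
    moreover have "k \<alpha> = i" using False by (simp only: k_def if_False)
    ultimately show ?thesis using i by simp
  qed
  define g where "g = (\<lambda>\<alpha>. \<alpha> - single (k \<alpha>) (d (k \<alpha>)))"
  have g: "g \<alpha> + single (k \<alpha>) (d (k \<alpha>)) = \<alpha>" if "\<alpha> \<in> exponents N \<nu>" for \<alpha>
    unfolding g_def using k[OF that] by (simp add: diff_single_add)
  have g_exp: "g \<alpha> \<in> exponents N (\<nu> - d (k \<alpha>))" if "\<alpha> \<in> exponents N \<nu>" for \<alpha>
    using exponents_cancel[of "g \<alpha>" "single (k \<alpha>) (d (k \<alpha>))" N \<nu>] g[OF that] k[OF that] that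
    by (simp add: single_in_exponents)
  \<comment> \<open>The row of \<alpha> is the form with index \<open>k \<alpha>\<close>, multiplied
    by the monomial that takes its pure power to \<alpha>.\<close>
  define h :: "(nat \<Rightarrow>\<^sub>0 nat) \<Rightarrow> nat \<Rightarrow> (nat \<Rightarrow>\<^sub>0 nat) \<Rightarrow> int"
    where "h = (\<lambda>\<alpha> j \<gamma>. if j = k \<alpha> then if \<gamma> = g \<alpha> then 1 else 0 else 0)"
  define D where "D = comb_det \<nu> h"
  have entry: "comb_entry \<nu> h \<alpha> \<beta>' =
      (\<Sum>\<delta>\<in>exponents N (d (k \<alpha>)). if g \<alpha> + \<delta> = \<beta>' then mvar (k \<alpha>, \<delta>) else 0)"
    if \<alpha>: "\<alpha> \<in> exponents N \<nu>" for \<alpha> \<beta>'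
  proof -
    have "comb_entry \<nu> h \<alpha> \<beta>' = (\<Sum>j<N. if j = k \<alpha> then
        \<Sum>\<gamma>\<in>exponents N (\<nu> - d (k \<alpha>)). if \<gamma> = g \<alpha> then
          \<Sum>\<delta>\<in>exponents N (d (k \<alpha>)). if g \<alpha> + \<delta> = \<beta>' then mvar (k \<alpha>, \<delta>) else 0 else 0 else 0)"
      unfolding comb_entry_def
    proof (intro sum.cong refl)
      fix j
      show "(\<Sum>\<gamma>\<in>exponents N (\<nu> - d j). \<Sum>\<delta>\<in>exponents N (d j).
          if \<gamma> + \<delta> = \<beta>' then mconst (h \<alpha> j \<gamma>) * mvar (j, \<delta>) else 0) = (if j = k \<alpha> then
        \<Sum>\<gamma>\<in>exponents N (\<nu> - d (k \<alpha>)). if \<gamma> = g \<alpha> then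
          \<Sum>\<delta>\<in>exponents N (d (k \<alpha>)). if g \<alpha> + \<delta> = \<beta>' then mvar (k \<alpha>, \<delta>) else 0 else 0 else 0)"
      proof (cases "j = k \<alpha>")
        case True
        have "(\<Sum>\<delta>\<in>exponents N (d j). if \<gamma> + \<delta> = \<beta>' then mconst (h \<alpha> j \<gamma>) * mvar (j, \<delta>) else 0) =
            (if \<gamma> = g \<alpha> then
              \<Sum>\<delta>\<in>exponents N (d (k \<alpha>)). if g \<alpha> + \<delta> = \<beta>' then mvar (k \<alpha>, \<delta>) else 0 else 0)" for \<gamma>
          by (cases "\<gamma> = g \<alpha>") (simp_all add: True h_def mconst.hom_one cong: if_cong)
        then show ?thesis using True by simp
      qed (simp add: h_def cong: if_cong)
    qed
    then show ?thesis using k[OF \<alpha>] g_exp[OF \<alpha>] by simp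
  qed
  have D1: "meval of_int pure_coeffs D = (1 :: int)"
    unfolding D_def
  proof (rule meval_comb_det_1[OF comm_ring_hom_of_int])
    fix \<alpha> \<beta>' assume \<alpha>: "\<alpha> \<in> exponents N \<nu>"
    interpret ev: comm_ring_hom "meval of_int pure_coeffs :: (cvar, int) mpoly \<Rightarrow> int"
      by (rule comm_ring_hom_meval[OF comm_ring_hom_of_int])
    have "meval of_int pure_coeffs (comb_entry \<nu> h \<alpha> \<beta>') =
        (\<Sum>\<delta>\<in>exponents N (d (k \<alpha>)). if \<delta> = single (k \<alpha>) (d (k \<alpha>)) then
          if g \<alpha> + \<delta> = \<beta>' then 1 else 0 else 0 :: int)"
      unfolding entry[OF \<alpha>] ev.hom_sum
      by (intro sum.cong refl)
        (auto simp: meval_mvar[OF comm_ring_hom_of_int] pure_coeffs_def simp del: of_int_eq_id)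
    also have "\<dots> = (if \<alpha> = \<beta>' then 1 else 0)"
      using single_in_exponents[of "k \<alpha>" N "d (k \<alpha>)"] k[OF \<alpha>] g[OF \<alpha>] by simp
    finally show "meval of_int pure_coeffs (comb_entry \<nu> h \<alpha> \<beta>') = (if \<alpha> = \<beta>' then 1 else 0 :: int)" .
  qed
  have "D \<noteq> 0" using D1 by auto
  let ?W = "{i} \<times> UNIV :: cvar set"
  let ?L = "monomials \<nu>" and ?f = "\<lambda>\<alpha>. if k \<alpha> = i then [:0, 1:] else 1 :: (cvar, int) mpoly poly"
  interpret pc: comm_ring_hom "\<lambda>c. [:c:] :: (cvar, int) mpoly poly" by (rule comm_ring_hom_pconst)
  have graded_entry: "graded ?W (comb_entry \<nu> h \<alpha> \<beta>') = ?f \<alpha> * [:comb_entry \<nu> h \<alpha> \<beta>':]"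
    if \<alpha>: "\<alpha> \<in> exponents N \<nu>" for \<alpha> \<beta>'
  proof -
    have "graded ?W (mvar (k \<alpha>, \<delta>) :: (cvar, int) mpoly) = ?f \<alpha> * [:mvar (k \<alpha>, \<delta>):]" for \<delta>
      by (simp add: graded_def comm_ring_hom_pconst_mconst)
    then show ?thesis
      unfolding entry[OF \<alpha>] graded.hom_sum pc.hom_sum sum_distrib_left
      by (intro sum.cong refl) auto
  qed
  \<comment> \<open>Each row is linear in the coefficients of a single form, so the degree of the
    determinant in the coefficients of form \<open>i\<close> is the number of rows that use
    it.\<close>
  define m where "m = card {\<alpha>\<in>exponents N \<nu>. k \<alpha> = i}"
  have L: "?L ! r \<in> exponents N \<nu>" if "r < length ?L" for r
    using monomials(2) that nth_mem by blast
  have pc_D: "[:D:] = (\<Sum>p | p permutes {0..<length ?L}. of_int (sign p) *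
      (\<Prod>r = 0..<length ?L. [:comb_entry \<nu> h (?L ! r) (?L ! p r):]))"
    unfolding D_def comb_det_def comb_mat_def pc.hom_det_mat by (rule det_mat)
  have "graded ?W D = (\<Sum>p | p permutes {0..<length ?L}. of_int (sign p) *
      (\<Prod>r = 0..<length ?L. graded ?W (comb_entry \<nu> h (?L ! r) (?L ! p r))))"
    unfolding D_def comb_det_def comb_mat_def graded.hom_det_mat by (rule det_mat)
  also have "\<dots> = (\<Sum>p | p permutes {0..<length ?L}. of_int (sign p) *
      ((\<Prod>r = 0..<length ?L. ?f (?L ! r)) * (\<Prod>r = 0..<length ?L. [:comb_entry \<nu> h (?L ! r) (?L ! p r):])))"
    unfolding prod.distrib[symmetric]
    by (intro sum.cong refl arg_cong2[of _ _ _ _ "(*)"] prod.cong) (simp add: graded_entry L)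
  also have "\<dots> = (\<Prod>r<length ?L. ?f (?L ! r)) * [:D:]"
    unfolding pc_D by (simp add: sum_distrib_left mult_ac lessThan_atLeast0)
  also have "(\<Prod>r<length ?L. ?f (?L ! r)) = [:0, 1:] ^ m"
    unfolding prod_monomials[of ?f] m_def by (simp add: prod.If_cases Int_def)
  finally have graded_D: "graded ?W D = [:0, 1:] ^ m * [:D:]" .
  let ?J = "{..<N} - {i}"
  \<comment> \<open>In these monomials the exponent of each x_j with j different from i is below
    \<open>d j\<close>, and the total degree \<nu> then determines that of x_i.\<close>
  have "m \<le> card (\<Pi>\<^sub>E j\<in>?J. {..<d j})"
    unfolding m_def
  proof (rule card_inj_on_le[where f = "\<lambda>\<alpha>. restrict (lookup \<alpha>) ?J"])
    show "inj_on (\<lambda>\<alpha>. restrict (lookup \<alpha>) ?J) {\<alpha> \<in> exponents N \<nu>. k \<alpha> = i}"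
    proof (rule inj_onI, rule poly_mapping_eqI)
      fix \<alpha> \<beta> v
      assume *: "\<alpha> \<in> {\<alpha> \<in> exponents N \<nu>. k \<alpha> = i}" "\<beta> \<in> {\<alpha> \<in> exponents N \<nu>. k \<alpha> = i}"
        "restrict (lookup \<alpha>) ?J = restrict (lookup \<beta>) ?J"
      have eq: "lookup \<alpha> j = lookup \<beta> j" if "j \<in> ?J" for j
        using fun_cong[OF *(3), of j] that by simp
      have "lookup \<gamma> i + (\<Sum>j\<in>?J. lookup \<gamma> j) = \<nu>" if "\<gamma> \<in> exponents N \<nu>" for \<gamma>
        using that i by (simp add: exponents_def sum.remove[of "{..<N}" i])
      moreover have "(\<Sum>j\<in>?J. lookup \<alpha> j) = (\<Sum>j\<in>?J. lookup \<beta> j)" using eq by (rule sum.cong[OF refl])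
      ultimately have "lookup \<alpha> i = lookup \<beta> i" using * by (metis (no_types, lifting) add_right_cancel mem_Collect_eq)
      moreover have "lookup \<alpha> v = lookup \<beta> v" if "\<not> v < N"
      proof -
        have "v \<notin> keys \<alpha>" "v \<notin> keys \<beta>" using * that by (auto simp: exponents_def)
        then show ?thesis by (simp add: not_in_keys_iff_lookup_eq_zero)
      qed
      ultimately show "lookup \<alpha> v = lookup \<beta> v" using eq[of v] by (cases "v = i"; cases "v < N") auto
    qed
    show "(\<lambda>\<alpha>. restrict (lookup \<alpha>) ?J) ` {\<alpha> \<in> exponents N \<nu>. k \<alpha> = i} \<subseteq> (\<Pi>\<^sub>E j\<in>?J. {..<d j})"
    proof (clarify, rule PiE_I)
      fix \<alpha> j assume *: "\<alpha> \<in> exponents N \<nu>" "i = k \<alpha>" "j \<in> {..<N} - {k \<alpha>}"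
      have "\<not> good \<alpha> j"
      proof
        assume "good \<alpha> j"
        then have "good \<alpha> (k \<alpha>)" using someI[of "good \<alpha>" j] by (auto simp: k_def)
        then show False using *(2) by (simp add: good_def)
      qed
      then show "restrict (lookup \<alpha>) ({..<N} - {k \<alpha>}) j \<in> {..<d j}"
        using * by (auto simp: good_def)
    qed auto
  qed (auto intro: finite_PiE)
  then have "m \<le> (\<Prod>j\<in>?J. d j)" by (simp add: card_PiE)
  moreover have "D \<in> inertia" unfolding D_def by (rule int_comb_det_in_inertia[OF deg])
  ultimately show ?thesis using D1 \<open>D \<noteq> 0\<close> graded_D by blast
qed

end

section \<open>The resultant\<close>

lemma meval_scaled:
  assumes "comm_ring_hom \<phi>"
  shows "meval \<phi> (\<lambda>v. if v \<in> W then t * c v else c v) p = poly (map_poly (meval \<phi> c) (graded W p)) t"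
proof -
  interpret ev: comm_ring_hom "meval \<phi> c" by (rule comm_ring_hom_meval) fact
  interpret comm_ring_hom "\<lambda>q. poly (map_poly (meval \<phi> c) q) t"
    by (rule comm_ring_hom_poly_map_poly[OF ev.comm_ring_hom_axioms])
  have "(\<lambda>v. poly (map_poly (meval \<phi> c) (if v \<in> W then [:0, mvar v:] else [:mvar v:])) t) =
      (\<lambda>v. if v \<in> W then t * c v else c v)"
    using assms by (auto simp: map_poly_pCons)
  then show ?thesis unfolding graded_def hom_meval using assms by (simp add: map_poly_pCons)
qed

text \<open>Evaluation at 0 shows that each of the \<open>m\<close> factors of the monomial divides
  \<open>p\<close> or \<open>q\<close>.\<close>

lemma divisor_of_monomial:
  fixes p q :: "'a::idom poly"
  assumes "p * q = [:0, 1:] ^ m * [:c:]" "c \<noteq> 0"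
  shows "\<exists>e a. e \<le> m \<and> p = [:0, 1:] ^ e * [:a:]"
  using assms
proof (induction m arbitrary: p q)
  case 0
  then have "p \<noteq> 0" "q \<noteq> 0" by auto
  then have "degree p + degree q = 0" using 0 by (metis degree_mult_eq degree_pCons_0 mult_1 power_0)
  then have "p = [:0, 1:] ^ 0 * [:coeff p 0:]" by (simp add: degree_0_id)
  then show ?case by blast
next
  case (Suc m)
  have "poly (p * q) 0 = 0" unfolding Suc.prems(1) by simp
  then consider "poly p 0 = 0" | "poly q 0 = 0" by auto
  then show ?case
  proof cases
    case 1
    then obtain p' where p': "p = [:0, 1:] * p'" by (auto simp: poly_eq_0_iff_dvd)
    have "[:0, 1:] * (p' * q) = [:0, 1:] * ([:0, 1:] ^ m * [:c:])"
      using Suc.prems(1) unfolding p' power_Suc by (simp only: mult.assoc)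
    then have "p' * q = [:0, 1:] ^ m * [:c:]" by (simp only: mult_cancel_left) simp
    from Suc.IH[OF this Suc.prems(2)] obtain e a where "e \<le> m" "p' = [:0, 1:] ^ e * [:a:]" by blast
    then have "Suc e \<le> Suc m" "p = [:0, 1:] ^ Suc e * [:a:]"
      unfolding p' power_Suc by (simp_all only: mult.assoc Suc_le_mono)
    then show ?thesis by blast
  next
    case 2
    then obtain q' where q': "q = [:0, 1:] * q'" by (auto simp: poly_eq_0_iff_dvd)
    have "[:0, 1:] * (p * q') = [:0, 1:] * ([:0, 1:] ^ m * [:c:])"
      using Suc.prems(1) unfolding q' power_Suc by (simp only: ac_simps)
    then have "p * q' = [:0, 1:] ^ m * [:c:]" by (simp only: mult_cancel_left) simp
    from Suc.IH[OF this Suc.prems(2)] show ?thesis using le_SucI by blast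
  qed
qed

text \<open>Multiplied by a power of the variable, the hypothesis becomes a polynomial identity with
  the reflection of \<open>q\<close>, since it holds at infinitely many points; then degrees are
  compared.\<close>

lemma degree_le_if_reciprocal:
  fixes p q :: "complex poly"
  assumes "\<And>s. s \<noteq> 0 \<Longrightarrow> poly p s = s ^ e * poly q (inverse s)"
  shows "degree p \<le> e"
proof (cases "p = 0")
  case False
  let ?X = "[:0, 1:] :: complex poly"
  let ?l = "?X ^ degree q * p" and ?r = "?X ^ e * reflect_poly q"
  have "poly (?l - ?r) s = 0" if "s \<noteq> 0" for s
    using assms[OF that] that by (simp add: poly_reflect_poly_nz)
  then have "- {0} \<subseteq> {s. poly (?l - ?r) s = 0}" by auto
  moreover have "infinite (- {0 :: complex})"
    by (simp add: Compl_eq_Diff_UNIV infinite_UNIV_char_0)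
  ultimately have "?l - ?r = 0" using poly_roots_finite finite_subset by blast
  then have eq: "?l = ?r" by simp
  then have "?r \<noteq> 0" using False by auto
  then have "degree q + degree p = e + degree (reflect_poly q)"
    using False arg_cong[OF eq, of degree]
    by (simp add: degree_mult_eq degree_power_eq del: mult_pCons_left)
  then show ?thesis using degree_reflect_poly_le[of q] by simp
qed simp

text \<open>The coefficients are the powers of one number \<open>B\<close>; each pair of distinct
  points only excludes the roots of a nonzero polynomial in \<open>B\<close>.\<close>

lemma ex_separating_combination:
  fixes Z :: "(nat \<Rightarrow> complex) set"
  assumes fin: "finite Z" and ext: "\<And>\<zeta> \<zeta>'. \<zeta> \<in> Z \<Longrightarrow> \<zeta>' \<in> Z \<Longrightarrow> (\<And>j. j < N \<Longrightarrow> \<zeta> j = \<zeta>' j) \<Longrightarrow> \<zeta> = \<zeta>'"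
  shows "\<exists>b. inj_on (\<lambda>\<zeta>. \<Sum>j<N. b j * \<zeta> j) Z"
proof -
  define p where "p = (\<lambda>q. \<Sum>j<N. Polynomial.monom (fst q j - snd q j :: complex) j)"
  define Q where "Q = {q \<in> Z \<times> Z. fst q \<noteq> snd q}"
  have "p q \<noteq> 0" if q: "q \<in> Q" for q
  proof
    assume "p q = 0"
    then have c0: "coeff (p q) j = 0" for j by simp
    have "fst q j = snd q j" if "j < N" for j
      using c0[of j] that by (simp add: p_def coeff_sum)
    then show False using ext[of "fst q" "snd q"] q by (auto simp: Q_def)
  qed
  moreover have "finite Q" unfolding Q_def using fin by simp
  ultimately have "finite (\<Union>q\<in>Q. {B. poly (p q) B = 0})"
    by (intro finite_UN_I poly_roots_finite) auto
  then obtain B where B: "B \<notin> (\<Union>q\<in>Q. {B. poly (p q) B = 0})"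
    using ex_new_if_finite[OF infinite_UNIV_char_0] by blast
  have "inj_on (\<lambda>\<zeta>. \<Sum>j<N. B ^ j * \<zeta> j) Z"
  proof (rule inj_onI, rule ccontr)
    fix \<zeta> \<zeta>' assume *: "\<zeta> \<in> Z" "\<zeta>' \<in> Z" "(\<Sum>j<N. B ^ j * \<zeta> j) = (\<Sum>j<N. B ^ j * \<zeta>' j)" "\<zeta> \<noteq> \<zeta>'"
    then have "(\<zeta>, \<zeta>') \<in> Q" by (simp add: Q_def)
    moreover have "poly (p (\<zeta>, \<zeta>')) B = (\<Sum>j<N. B ^ j * \<zeta> j) - (\<Sum>j<N. B ^ j * \<zeta>' j)"
      by (simp add: p_def poly_sum poly_monom sum_subtractf[symmetric] algebra_simps)
    ultimately show False using *(3) B by auto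
  qed
  then show ?thesis by blast
qed

section \<open>Existence, uniqueness and degrees of the normalized generator\<close>

context form_degrees
begin

definition nontrivial_zero :: "(cvar \<Rightarrow> complex) \<Rightarrow> bool" where
  "nontrivial_zero c \<longleftrightarrow> (\<exists>x k. k < N \<and> x k \<noteq> 0 \<and> (\<forall>i<N. fval c x i = 0))"

definition resultant_poly :: "(cvar, int) mpoly \<Rightarrow> bool" where
  "resultant_poly R \<longleftrightarrow> irreducible R \<and> R \<in> inertia \<and> (\<forall>P\<in>inertia. R dvd P) \<and>
     meval of_int pure_coeffs R = (1 :: int)"

text \<open>The value of the generator at the pure powers is an integer divisor of 1, because it
  divides the value of Macaulay's determinant; the case -1 is settled by a change of sign.\<close>

lemma ex_resultant_poly: "\<exists>R. resultant_poly R"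
proof -
  interpret ev: comm_ring_hom "meval of_int pure_coeffs :: (cvar, int) mpoly \<Rightarrow> int"
    by (rule comm_ring_hom_meval[OF comm_ring_hom_of_int])
  obtain D :: "(cvar, int) mpoly" where D: "D \<in> inertia" "D \<noteq> 0" "meval of_int pure_coeffs D = (1 :: int)"
    using ex_macaulay_det[OF N_pos] by blast
  obtain R :: "(cvar, int) mpoly" where R: "R \<in> inertia" "irreducible R" "\<forall>P\<in>inertia. R dvd P"
    using inertia_principal[OF D(1,2)] by blast
  obtain S where "D = R * S" using R(3) D(1) by auto
  then have "meval of_int pure_coeffs R * meval of_int pure_coeffs S = (1 :: int)"
    using D(3) by (simp only: ev.hom_mult)
  then have "meval of_int pure_coeffs R = (1 :: int) \<or> meval of_int pure_coeffs R = (- 1 :: int)"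
    by (auto simp only: zmult_eq_1_iff)
  then show ?thesis
  proof
    assume "meval of_int pure_coeffs R = (- 1 :: int)"
    then have "meval of_int pure_coeffs (- R) = (1 :: int)" by (simp only: ev.hom_uminus minus_minus)
    moreover have "- R \<in> inertia"
      using R(1) by (auto simp: inertia_def normal_form.hom_uminus intro: subringD(6)[OF subring_mpolys])
    moreover have "irreducible (- R)"
    proof (rule irreducibleI)
      fix a b assume "- R = a * b"
      then have "R = (- a) * b" by (metis minus_minus mult_minus_left)
      then show "a dvd 1 \<or> b dvd 1" using irreducibleD[OF R(2)] by fastforce
    qed (use R(2) in \<open>auto simp: irreducible_def\<close>)
    ultimately show ?thesis using R(3) unfolding resultant_poly_def
      by (intro exI[of _ "- R"]) (simp add: minus_dvd_iff)
  qed (use R in \<open>auto simp: resultant_poly_def\<close>)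
qed

text \<open>\<open>R'\<close> is a unit multiple of \<open>R\<close>; units are constants, and the
  common value at the pure powers forces the constant 1.\<close>

lemma resultant_poly_unique:
  assumes R: "resultant_poly R" and R': "irreducible R'" "R' \<in> inertia" "meval of_int pure_coeffs R' = (1 :: int)"
  shows "R' = R"
proof -
  interpret ev: comm_ring_hom "meval of_int pure_coeffs :: (cvar, int) mpoly \<Rightarrow> int"
    by (rule comm_ring_hom_meval[OF comm_ring_hom_of_int])
  obtain u where u: "R' = R * u" using R R'(2) by (auto simp: resultant_poly_def)
  then have "u dvd 1"
    using irreducibleD[OF R'(1) u] R by (auto simp: resultant_poly_def irreducible_def)
  then obtain c where c: "u = mconst c" using unit_mpoly by blast
  have "meval of_int pure_coeffs u = (1 :: int)"
    using R R'(3) unfolding u ev.hom_mult by (simp only: resultant_poly_def mult_1)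
  then have "u = 1"
    unfolding c by (simp add: meval_mconst[OF comm_ring_hom_of_int] mconst.hom_one del: of_int_eq_id)
  then show ?thesis using u by simp
qed

context
  fixes R :: "(cvar, int) mpoly"
  assumes R: "resultant_poly R"
begin

lemma resultant_dvd_inertia: "P \<in> inertia \<Longrightarrow> map_int R dvd (P :: (cvar, complex) mpoly)"
  using map_int_dvd_inertia R unfolding resultant_poly_def by blast

lemma map_int_resultant_in_inertia: "(map_int R :: (cvar, complex) mpoly) \<in> inertia"
  using R by (simp add: resultant_poly_def map_int_in_inertia_iff)

lemma resultant_ne_0: "R \<noteq> 0"
  using R by (auto simp: resultant_poly_def)

lemma resultant_vars: "R \<in> mpolys coeff_vars"
  using R by (simp add: resultant_poly_def inertia_def)

lemma resultant_eq_0_iff: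
  fixes c :: "cvar \<Rightarrow> complex"
  shows "meval of_int c R = 0 \<longleftrightarrow> nontrivial_zero c"
proof
  assume "nontrivial_zero c"
  then have "peval c (map_int R) = 0"
    using inertia_vanishes_at_nontrivial_zero[OF map_int_resultant_in_inertia]
    unfolding nontrivial_zero_def by blast
  then show "meval of_int c R = 0" by (simp add: meval_map_int comm_ring_hom_id)
next
  assume 0: "meval of_int c R = 0"
  interpret ev: comm_ring_hom "peval c :: (cvar, complex) mpoly \<Rightarrow> complex"
    by (rule comm_ring_hom_meval[OF comm_ring_hom_id])
  show "nontrivial_zero c"
  proof (rule ccontr)
    assume "\<not> nontrivial_zero c"
    then obtain D where D: "D \<in> inertia" "peval c D = 1"
      using ex_nonvanishing_inertia[of c] unfolding nontrivial_zero_def by blast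
    then obtain S where "D = map_int R * S" using resultant_dvd_inertia by auto
    then have "peval c D = 0"
      using 0 by (simp add: ev.hom_mult meval_map_int comm_ring_hom_id)
    then show False using D(2) by simp
  qed
qed

text \<open>Multiples of \<open>R\<close> lie in the ideal, which is prime over the complex numbers
  too, and there \<open>R\<close> divides all its elements. Irreducibility over the complex numbers
  follows from this.\<close>

lemma resultant_prime:
  fixes P Q :: "(cvar, complex) mpoly"
  assumes "map_int R dvd P * Q" "P \<in> mpolys coeff_vars" "Q \<in> mpolys coeff_vars"
  shows "map_int R dvd P \<or> map_int R dvd Q"
proof -
  obtain S where "P * Q = map_int R * S" using assms(1) by auto
  then have "normal_form (P * Q) = 0"
    using map_int_resultant_in_inertia by (simp add: normal_form.hom_mult inertia_def)
  then have "P * Q \<in> inertia" using assms subringD(5)[OF subring_mpolys] by (auto simp: inertia_def)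
  then show ?thesis using inertia_prime assms resultant_dvd_inertia by blast
qed

lemma irreducible_map_int_resultant: "irreducible (map_int R :: (cvar, complex) mpoly)"
proof (rule irreducibleI)
  let ?R = "map_int R :: (cvar, complex) mpoly"
  show R0: "?R \<noteq> 0" using resultant_ne_0 by simp
  show not_unit: "\<not> ?R dvd 1"
  proof
    assume "?R dvd 1"
    then have "normal_form ?R dvd 1" using normal_form.hom_dvd_1 by blast
    then show False using map_int_resultant_in_inertia by (simp add: inertia_def)
  qed
  fix a b assume ab: "?R = a * b"
  have "vars a \<subseteq> vars ?R" "vars b \<subseteq> vars ?R"
    using vars_dvd[of a ?R] vars_dvd[of b ?R] R0 unfolding ab by (simp_all del: mult_eq_0_iff)
  then have "a \<in> mpolys coeff_vars" "b \<in> mpolys coeff_vars"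
    using map_int_resultant_in_inertia by (auto simp: inertia_def mpolys_def)
  then have "?R dvd a \<or> ?R dvd b" using resultant_prime[of a b] ab by simp
  then show "a dvd 1 \<or> b dvd 1"
  proof
    assume "?R dvd a"
    then obtain u where "a = ?R * u" by auto
    then have "?R * (u * b) = ?R * 1" unfolding mult_1_right using ab by (metis mult.assoc)
    then have "u * b = 1" using R0 by (metis mult_cancel_left)
    then show ?thesis by (metis dvd_triv_right)
  next
    assume "?R dvd b"
    then obtain u where "b = ?R * u" by auto
    then have "?R * (u * a) = ?R * 1" unfolding mult_1_right using ab by (metis mult.assoc mult.commute)
    then have "u * a = 1" using R0 by (metis mult_cancel_left)
    then show ?thesis by (metis dvd_triv_right)
  qed
qed

text \<open>As \<open>R\<close> is prime, its copies are cancelled one at a time against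
  \<open>a\<close> or \<open>g\<close>; in the end \<open>g\<close> is left with a unit.\<close>

lemma divisor_of_resultant_power:
  fixes a g :: "(cvar, complex) mpoly"
  assumes "map_int R ^ K = a * g"
  shows "\<exists>u k. g = mconst u * map_int R ^ k"
  using assms
proof (induction K arbitrary: a g)
  case 0
  then have "g dvd 1" by (metis dvd_triv_right power_0)
  then obtain u where "g = mconst u" using unit_mpoly by blast
  then have "g = mconst u * map_int R ^ 0" by simp
  then show ?case by blast
next
  case (Suc K)
  let ?R = "map_int R :: (cvar, complex) mpoly"
  have R0: "?R \<noteq> 0" using resultant_ne_0 by simp
  have RK: "?R ^ Suc K \<in> mpolys coeff_vars"
    using map_int_resultant_in_inertia by (intro subringD(7)[OF subring_mpolys]) (simp add: inertia_def)
  have "vars a \<subseteq> vars (?R ^ Suc K)" "vars g \<subseteq> vars (?R ^ Suc K)"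
    using R0 unfolding Suc.prems by (intro vars_dvd dvd_triv_left dvd_triv_right;
        simp add: Suc.prems[symmetric] del: power_Suc)+
  then have "a \<in> mpolys coeff_vars" "g \<in> mpolys coeff_vars" using RK by (auto simp: mpolys_def)
  moreover have "?R dvd a * g" unfolding Suc.prems[symmetric] by simp
  ultimately have "?R dvd a \<or> ?R dvd g" by (intro resultant_prime)
  then show ?case
  proof
    assume "?R dvd a"
    then obtain a' where "a = ?R * a'" by auto
    then have "?R * ?R ^ K = ?R * (a' * g)" using Suc.prems by (simp add: ac_simps)
    then have "?R ^ K = a' * g" using R0 by (simp only: mult_cancel_left) simp
    then show ?thesis by (rule Suc.IH)
  next
    assume "?R dvd g"
    then obtain g' where g': "g = ?R * g'" by auto
    then have "?R * ?R ^ K = ?R * (a * g')" using Suc.prems by (simp add: ac_simps)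
    then have "?R ^ K = a * g'" using R0 by (simp only: mult_cancel_left) simp
    from Suc.IH[OF this] obtain u k where "g' = mconst u * ?R ^ k" by blast
    then have "g = mconst u * ?R ^ Suc k" by (simp add: g' ac_simps)
    then show ?thesis by blast
  qed
qed

text \<open>
  The degree \<open>e\<close> in the coefficients of \<open>F\<^sub>i\<close> is bounded from above by that of Macaulay's
  determinant. For the lower bound let \<open>F\<^sub>j = x\<^sub>j ^ d\<^sub>j - x\<^sub>i ^ d\<^sub>j\<close> for \<open>j \<noteq> i\<close> and
  \<open>F\<^sub>i = (\<Sum>\<^sub>l b\<^sub>l x\<^sub>l) x\<^sub>i ^ (d\<^sub>i - 1) - s x\<^sub>i ^ d\<^sub>i\<close>: the resultant is a polynomial in \<open>s\<close> of degree at
  most \<open>e\<close>, with one root for each common zero of the \<open>F\<^sub>j\<close>.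
\<close>

lemma resultant_homogeneous:
  fixes c :: "cvar \<Rightarrow> complex"
  assumes i: "i < N"
  shows "meval of_int (\<lambda>v. if fst v = i then t * c v else c v) R =
    t ^ (\<Prod>j\<in>{..<N} - {i}. d j) * meval of_int c R"
proof -
  let ?W = "{i} \<times> UNIV :: cvar set"
  obtain D :: "(cvar, int) mpoly" and m where D: "D \<in> inertia" "D \<noteq> 0"
    and gD: "graded ?W D = [:0, 1:] ^ m * [:D:]" and m: "m \<le> (\<Prod>j\<in>{..<N} - {i}. d j)"
    using ex_macaulay_det[OF i] by blast
  \<comment> \<open>The grading of \<open>D\<close> is a monomial in the auxiliary variable, hence
    so is that of its factor \<open>R\<close>: it is homogeneous of some degree
    \<open>e \<le> m\<close>.\<close>
  obtain S where "D = R * S" using R D(1) by (auto simp: resultant_poly_def)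
  then have "graded ?W R * graded ?W S = [:0, 1:] ^ m * [:D:]"
    unfolding gD[symmetric] by (simp add: graded.hom_mult)
  from divisor_of_monomial[OF this D(2)] obtain e a where
    e: "e \<le> m" and ga: "graded ?W R = [:0, 1:] ^ e * [:a:]" by blast
  have "R = a" using poly_graded_1[of ?W R] unfolding ga by simp
  then have gR: "graded ?W R = [:0, 1:] ^ e * [:R:]" using ga by simp
  have hom: "meval of_int (\<lambda>v. if fst v = i then t * c v else c v) R = t ^ e * meval of_int c R"
    for t :: complex and c
  proof -
    interpret ev: comm_ring_hom "meval of_int c :: (cvar, int) mpoly \<Rightarrow> complex"
      by (rule comm_ring_hom_meval[OF comm_ring_hom_of_int])
    interpret comm_ring_hom "\<lambda>q. poly (map_poly (meval of_int c) q) t"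
      by (rule comm_ring_hom_poly_map_poly[OF ev.comm_ring_hom_axioms])
    have "(\<lambda>v. if fst v = i then t * c v else c v) = (\<lambda>v. if v \<in> ?W then t * c v else c v)"
      by (auto simp: fun_eq_iff)
    then have "meval of_int (\<lambda>v. if fst v = i then t * c v else c v) R =
        poly (map_poly (meval of_int c) (graded ?W R)) t"
      by (simp only: meval_scaled[OF comm_ring_hom_of_int])
    also have "\<dots> = t ^ e * meval of_int c R"
      unfolding gR hom_mult hom_power by (simp add: map_poly_pCons)
    finally show ?thesis .
  qed
  \<comment> \<open>The common zeros of the F_j for j different from i, normalized by x_i = 1: their
    other coordinates are roots of unity.\<close>
  define Z where "Z = (\<Pi>\<^sub>E j\<in>{..<N}. if j = i then {1} else {z :: complex. z ^ d j = 1})"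
  have finZ: "finite Z" unfolding Z_def using d_pos by (intro finite_PiE) (auto intro: finite_roots_unity)
  have cardZ: "card Z = (\<Prod>j\<in>{..<N} - {i}. d j)"
  proof -
    have "card Z = (\<Prod>j<N. if j = i then 1 else d j)"
      unfolding Z_def using d_pos
      by (subst card_PiE) (auto intro!: prod.cong simp: card_roots_unity_eq Suc_le_eq)
    also have "\<dots> = (\<Prod>j\<in>{..<N} - {i}. d j)"
      using i by (subst prod.remove[of _ i]) (auto intro!: prod.cong)
    finally show ?thesis .
  qed
  obtain b where b: "inj_on (\<lambda>\<zeta>. \<Sum>j<N. b j * \<zeta> j) Z"
    using ex_separating_combination[OF finZ, of N] unfolding Z_def
    by (metis (no_types, lifting) PiE_ext lessThan_iff)
  define l where "l = (\<lambda>\<zeta>. \<Sum>j<N. b j * \<zeta> j)"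
  \<comment> \<open>\<open>c0\<close> is the part of the system without \<open>s\<close>, and
    \<open>c1\<close> the coefficient of \<open>s\<close>.\<close>
  define c0 where "c0 = (\<lambda>v. if fst v = i
    then \<Sum>l<N. if snd v = single l 1 + single i (d i - 1) then b l else 0
    else (if snd v = single (fst v) (d (fst v)) then 1 else 0) - (if snd v = single i (d (fst v)) then 1 else 0))"
  define c1 :: "cvar \<Rightarrow> complex" where "c1 = (\<lambda>v. if v = (i, single i (d i)) then - 1 else 0)"
  have exp_l: "single l 1 + single i (d i - 1) \<in> exponents N (d i)" if "l < N" for l
    using add_in_exponents[OF single_in_exponents[OF that, of 1] single_in_exponents[OF i, of "d i - 1"]]
      d_pos[OF i] by simp
  have fval_j: "fval (\<lambda>v. c0 v + s * c1 v) x j = x j ^ d j - x i ^ d j" if "j < N" "j \<noteq> i" for s x j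
    unfolding fval_def using that single_in_exponents[of _ N "d j"] i
    by (simp add: c0_def c1_def left_diff_distrib sum_subtractf if_distrib[of "\<lambda>z. z * _"] cong: if_cong)
  have fval_i: "fval (\<lambda>v. c0 v + s * c1 v) x i = x i ^ (d i - 1) * (l x - s * x i)" for s x
  proof -
    have "fval (\<lambda>v. c0 v + s * c1 v) x i =
      (\<Sum>\<delta>\<in>exponents N (d i). \<Sum>l<N. if \<delta> = single l 1 + single i (d i - 1) then b l * mon x \<delta> else 0) -
      (\<Sum>\<delta>\<in>exponents N (d i). if \<delta> = single i (d i) then s * mon x \<delta> else 0)"
      unfolding fval_def sum_subtractf[symmetric]
    proof (rule sum.cong[OF refl])
      fix \<delta>
      have "c0 (i, \<delta>) * mon x \<delta> =
          (\<Sum>l<N. if \<delta> = single l 1 + single i (d i - 1) then b l * mon x \<delta> else 0)"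
        by (auto simp: c0_def sum_distrib_right intro!: sum.cong)
      moreover have "s * c1 (i, \<delta>) * mon x \<delta> = - (if \<delta> = single i (d i) then s * mon x \<delta> else 0)"
        by (simp add: c1_def)
      ultimately show "(c0 (i, \<delta>) + s * c1 (i, \<delta>)) * mon x \<delta> =
          (\<Sum>l<N. if \<delta> = single l 1 + single i (d i - 1) then b l * mon x \<delta> else 0) -
          (if \<delta> = single i (d i) then s * mon x \<delta> else 0)"
        by (simp only: distrib_right) simp
    qed
    also have "\<dots> = (\<Sum>l<N. b l * (x l * x i ^ (d i - 1))) - s * x i ^ d i"
      using exp_l single_in_exponents[OF i, of "d i"] by (subst sum.swap) (simp add: mon_add)
    also have "x i ^ d i = x i ^ (d i - 1) * x i" using d_pos[OF i] by (metis power_minus_mult)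
    finally show ?thesis by (simp add: l_def algebra_simps sum_distrib_left)
  qed
  define H where "H = meval (\<lambda>n. [:of_int n:]) (\<lambda>v. [:c0 v, c1 v:]) R"
  \<comment> \<open>The coefficients of F_i are \<open>s\<close> times those in c1 + c0/s, so
    homogeneity writes the resultant as s^e times a polynomial in 1/s, which bounds the degree of
    \<open>H\<close>.\<close>
  define H' where "H' = meval (\<lambda>n. [:of_int n:]) (\<lambda>v. if fst v = i then [:c1 v, c0 v:] else [:c0 v:]) R"
  have H: "poly H s = meval of_int (\<lambda>v. c0 v + s * c1 v) R" for s
    unfolding H_def comm_ring_hom.hom_meval[OF comm_ring_hom_poly] by simp
  have "poly H s = s ^ e * poly H' (inverse s)" if "s \<noteq> 0" for s
  proof -
    have "poly H s = meval of_int (\<lambda>v. if fst v = i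
        then s * (if fst v = i then c1 v + inverse s * c0 v else c0 v)
        else (if fst v = i then c1 v + inverse s * c0 v else c0 v)) R"
      unfolding H by (rule meval_cong) (use that in \<open>auto simp: c1_def field_simps\<close>)
    also have "\<dots> = s ^ e * meval of_int (\<lambda>v. if fst v = i then c1 v + inverse s * c0 v else c0 v) R"
      by (rule hom)
    also have "meval of_int (\<lambda>v. if fst v = i then c1 v + inverse s * c0 v else c0 v) R = poly H' (inverse s)"
      unfolding H'_def comm_ring_hom.hom_meval[OF comm_ring_hom_poly]
      by (simp, rule meval_cong, auto)
    finally show ?thesis .
  qed
  then have degH: "degree H \<le> e" by (rule degree_le_if_reciprocal)
  have roots: "poly H s = 0 \<longleftrightarrow> s \<in> l ` Z" for s
  proof
    assume "s \<in> l ` Z"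
    then obtain \<zeta> where \<zeta>: "\<zeta> \<in> Z" "s = l \<zeta>" by auto
    have mem: "\<zeta> j \<in> (if j = i then {1} else {z. z ^ d j = 1})" if "j < N" for j
      using PiE_mem[OF \<zeta>(1)[unfolded Z_def], of j] that by simp
    have \<zeta>i: "\<zeta> i = 1" using mem[OF i] by simp
    have \<zeta>j: "\<zeta> j ^ d j = 1" if "j < N" "j \<noteq> i" for j using mem[OF that(1)] that(2) by simp
    have "fval (\<lambda>v. c0 v + s * c1 v) \<zeta> j = 0" if "j < N" for j
      using that \<zeta> \<zeta>i \<zeta>j by (cases "j = i") (auto simp: fval_j fval_i)
    then have "nontrivial_zero (\<lambda>v. c0 v + s * c1 v)"
      unfolding nontrivial_zero_def using i \<zeta>i by (intro exI[of _ \<zeta>] exI[of _ i]) auto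
    then show "poly H s = 0" unfolding H by (simp only: resultant_eq_0_iff)
  next
    assume "poly H s = 0"
    then obtain x k where x: "k < N" "x k \<noteq> 0" "\<And>j. j < N \<Longrightarrow> fval (\<lambda>v. c0 v + s * c1 v) x j = 0"
      unfolding H resultant_eq_0_iff nontrivial_zero_def by blast
    have xj: "x j ^ d j = x i ^ d j" if "j < N" "j \<noteq> i" for j
      using x(3)[OF that(1)] fval_j[OF that] by simp
    have xi: "x i \<noteq> 0"
    proof
      assume *: "x i = 0"
      then have "k \<noteq> i" using x(2) by auto
      then have "x k ^ d k = 0" using xj[OF x(1)] * d_pos[OF x(1)] by simp
      then show False using x(2) by simp
    qed
    \<comment> \<open>A nontrivial zero has x_i nonzero and can be normalized to x_i = 1.\<close>
    define \<zeta> where "\<zeta> = restrict (\<lambda>j. x j / x i) {..<N}"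
    have "\<zeta> \<in> Z"
      unfolding Z_def
    proof (rule PiE_I)
      fix j assume "j \<in> {..<N}"
      then show "\<zeta> j \<in> (if j = i then {1} else {z. z ^ d j = 1})"
        using xi xj[of j] by (auto simp: \<zeta>_def power_divide)
    qed (simp add: \<zeta>_def)
    moreover have "l x = s * x i" using x(3)[OF i] fval_i[of s x] xi by simp
    then have "s = l \<zeta>" using xi by (simp add: l_def \<zeta>_def sum_divide_distrib[symmetric])
    ultimately show "s \<in> l ` Z" by blast
  qed
  have "H \<noteq> 0"
  proof
    assume "H = 0"
    then have "l ` Z = UNIV" using roots by auto
    then have "finite (UNIV :: complex set)" using finite_imageI[OF finZ, of l] by simp
    then show False using infinite_UNIV_char_0 by blast
  qed
  \<comment> \<open>The number of zeros is at most the degree of \<open>H\<close>, which is at most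
    \<open>e\<close>, then \<open>m\<close>, and then the number of zeros again.\<close>
  have "card Z = card (l ` Z)" using b by (simp add: card_image l_def)
  also have "l ` Z = {s. poly H s = 0}" using roots by auto
  also have "card {s. poly H s = 0} \<le> degree H" using \<open>H \<noteq> 0\<close> by (rule card_poly_roots_bound)
  finally have "e = (\<Prod>j\<in>{..<N} - {i}. d j)" using degH e m cardZ by simp
  then show ?thesis using hom by simp
qed

end

subsection \<open>Identification with the generic resultant\<close>

lemma fval_lookup:
  assumes "is_form N (d i) (F i)"
  shows "fval (\<lambda>(i, \<alpha>). lookup (F i) \<alpha>) x i = peval x (F i)"
  unfolding fval_def using assms by (subst meval_superset[of "exponents N (d i)"]) (auto simp: is_form_def)

lemma nontrivial_zero_lookup:
  assumes "\<And>i. i < N \<Longrightarrow> is_form N (d i) (F i)"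
  shows "has_nontrivial_zero N F \<longleftrightarrow> nontrivial_zero (\<lambda>(i, \<alpha>). lookup (F i) \<alpha>)"
  unfolding has_nontrivial_zero_def nontrivial_zero_def using assms by (auto simp: fval_lookup)

lemma res_eval_pure:
  "res_eval P (\<lambda>i. mvar i ^ d i :: (nat, 'a::comm_ring_1) mpoly) = meval of_int pure_coeffs P"
proof -
  have "(mvar i ^ k :: (nat, 'a) mpoly) = single (single i k) 1" for i k
    using mon_mvar[where 'a = 'a, of "single i k"] by simp
  then have "(\<lambda>(i, \<alpha>). lookup (mvar i ^ d i :: (nat, 'a) mpoly) \<alpha>) = pure_coeffs"
    by (auto simp: fun_eq_iff pure_coeffs_def lookup_single when_def)
  then show ?thesis by (simp add: res_eval_def)
qed

text \<open>For the converse, the condition on zeros covers all systems with a zero (1, x_1, ...),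
  which puts the polynomial into the ideal; irreducibility and normalization then leave only the
  generator already constructed.\<close>

lemma is_resultant_iff: "is_resultant N d R \<longleftrightarrow> resultant_poly R"
proof
  assume R: "resultant_poly R"
  have "\<forall>F :: nat \<Rightarrow> (nat, complex) mpoly. (\<forall>i<N. is_form N (d i) (F i)) \<longrightarrow>
      (res_eval R F = 0 \<longleftrightarrow> has_nontrivial_zero N F)"
    by (simp add: res_eval_def resultant_eq_0_iff[OF R] nontrivial_zero_lookup)
  moreover have "\<forall>\<mu>\<in>keys R. keys \<mu> \<subseteq> (SIGMA i:{..<N}. exponents N (d i))"
    using resultant_vars[OF R] by (auto simp: mpolys_def vars_def coeff_vars_def)
  ultimately show "is_resultant N d R"
    using R irreducible_map_int_resultant[OF R]
    unfolding is_resultant_def res_eval_pure map_int_eq resultant_poly_def by blast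
next
  assume R: "is_resultant N d R"
  obtain R0 where R0: "resultant_poly R0" using ex_resultant_poly by blast
  have vars: "vars R \<subseteq> coeff_vars"
    using R by (auto simp: is_resultant_def vars_def coeff_vars_def)
  have "(map_int R :: (cvar, complex) mpoly) \<in> inertia"
  proof (rule inertiaI)
    show "(map_int R :: (cvar, complex) mpoly) \<in> mpolys coeff_vars"
      using vars by (simp add: mpolys_def vars_map_int)
    fix c x assume x: "x 0 = 1" "\<And>i. i < N \<Longrightarrow> fval c x i = (0 :: complex)"
    define F where "F = (\<lambda>i. \<Sum>\<alpha>\<in>exponents N (d i). single \<alpha> (c (i, \<alpha>)))"
    have lF: "lookup (F i) \<alpha> = (if \<alpha> \<in> exponents N (d i) then c (i, \<alpha>) else 0)" for i \<alpha>
      by (simp add: F_def lookup_sum lookup_single when_def)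
    have form: "is_form N (d i) (F i)" for i
      by (auto simp: is_form_def in_keys_iff lF split: if_splits)
    have "fval (\<lambda>(i, \<alpha>). lookup (F i) \<alpha>) x i = fval c x i" for i
      unfolding fval_def by (intro sum.cong) (auto simp: lF)
    then have "has_nontrivial_zero N F"
      unfolding nontrivial_zero_lookup[OF form] nontrivial_zero_def
      using x N_pos by (intro exI[of _ x] exI[of _ 0]) auto
    then have "res_eval R F = 0" using R form by (auto simp: is_resultant_def)
    moreover have "res_eval R F = meval of_int c R"
      unfolding res_eval_def using vars by (intro meval_cong) (auto simp: lF coeff_vars_def)
    ultimately show "peval c (map_int R) = 0" by (simp add: meval_map_int comm_ring_hom_id)
  qed
  then have "R \<in> inertia" by (simp add: map_int_in_inertia_iff)
  then have "R = R0"
    using R unfolding is_resultant_def res_eval_pure by (intro resultant_poly_unique[OF R0]) auto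
  then show "resultant_poly R" using R0 by simp
qed

lemma resultant_poly_generic: "resultant_poly (generic_resultant N d)"
proof -
  obtain R where R: "resultant_poly R" using ex_resultant_poly by blast
  have "generic_resultant N d = R"
    unfolding generic_resultant_def is_resultant_iff
    using R resultant_poly_unique[OF R] by (intro the_equality) (auto simp: resultant_poly_def)
  then show ?thesis using R by simp
qed

end

section \<open>Forms\<close>

lemma is_form_mono: "is_form N d p \<Longrightarrow> N \<le> M \<Longrightarrow> is_form M d p"
proof -
  assume p: "is_form N d p" and NM: "N \<le> M"
  have "exponents N d \<subseteq> exponents M d"
  proof
    fix \<alpha> assume \<alpha>: "\<alpha> \<in> exponents N d"
    have "(\<Sum>j<M. lookup \<alpha> j) = (\<Sum>j<N. lookup \<alpha> j)"
      by (rule sum.mono_neutral_right) (use \<alpha> NM in \<open>auto simp: exponents_def in_keys_iff\<close>)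
    then show "\<alpha> \<in> exponents M d" using \<alpha> NM by (auto simp: exponents_def)
  qed
  then show ?thesis using p by (auto simp: is_form_def)
qed

lemma is_form_sum:
  assumes "\<And>i. i \<in> I \<Longrightarrow> is_form N d (f i)"
  shows "is_form N d (sum f I)"
  unfolding is_form_def
proof
  fix \<alpha> assume "\<alpha> \<in> keys (sum f I)"
  then have "(\<Sum>i\<in>I. lookup (f i) \<alpha>) \<noteq> 0" by (simp add: in_keys_iff lookup_sum)
  then obtain i where "i \<in> I" "\<alpha> \<in> keys (f i)" by (meson in_keys_iff sum.not_neutral_contains_not_neutral)
  then show "\<alpha> \<in> exponents N d" using assms by (auto simp: is_form_def)
qed

lemma is_form_diff:
  fixes p q :: "(nat, 'a::comm_ring_1) mpoly"
  shows "is_form N d p \<Longrightarrow> is_form N d q \<Longrightarrow> is_form N d (p - q)"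
  unfolding is_form_def subset_iff in_keys_iff lookup_minus by (metis diff_zero)

lemma mvar_power: "mvar v ^ k = single (single v k) 1"
  using mon_mvar[of "single v k"] by simp

lemma is_form_mvar_power:
  "i < N \<Longrightarrow> is_form N k (mvar i ^ k :: (nat, 'a::comm_ring_1) mpoly)"
  by (simp add: mvar_power is_form_def single_in_exponents)

lemma prod_list_mvar:
  "(\<Prod>j\<leftarrow>js. mvar j) = single (\<Sum>j\<leftarrow>js. single j 1) 1"
  by (induction js) (auto simp: mvar_def mult_single)

lemma lookup_tensor_form:
  "lookup (tensor_form n m A i) \<alpha> = (\<Sum>js\<in>{js. length js = m - 1 \<and> set js \<subseteq> {..<n}}.
     A (i # js) when (\<Sum>j\<leftarrow>js. single j 1) = \<alpha>)"
  by (simp add: tensor_form_def lookup_sum prod_list_mvar mconst_def mult_single lookup_single)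

lemma is_form_tensor_form: "is_form n (m - 1) (tensor_form n m A i)"
proof -
  have *: "(\<Sum>j\<leftarrow>js. single j 1) \<in> exponents n (length js)" if "set js \<subseteq> {..<n}" for js
    using that
  proof (induction js)
    case (Cons j js)
    then show ?case using add_in_exponents[OF single_in_exponents[of j n 1], of _ "length js"] by simp
  qed (simp add: exponents_def)
  have "(\<Sum>j\<leftarrow>js. single j 1) \<in> exponents n (m - 1)" if "length js = m - 1" "set js \<subseteq> {..<n}" for js
    using *[OF that(2)] that(1) by simp
  then show ?thesis
    unfolding tensor_form_def prod_list_mvar
    by (intro is_form_sum) (auto simp: is_form_def mconst_def mult_single)
qed

lemma is_form_square_sum: "is_form n 2 (square_sum n)"
  unfolding square_sum_def by (intro is_form_sum is_form_mvar_power) auto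

lemma lookup_square_sum:
  "lookup (square_sum n) \<alpha> = (\<Sum>j<n. (1 when single j 2 = \<alpha>))"
  by (simp add: square_sum_def lookup_sum mvar_power lookup_single)

section \<open>Adjoining the form \<open>q - x\<^sub>n\<^sup>2\<close>\<close>

lemma countable_cvar: "countable (UNIV :: cvar set)"
  unfolding UNIV_Times_UNIV[symmetric] by (intro countable_SIGMA countable_monomials) auto

lemma infinite_cvar: "infinite (UNIV :: cvar set)"
proof
  assume "finite (UNIV :: cvar set)"
  then have "finite (fst ` (UNIV :: cvar set))" by (rule finite_imageI)
  then show False by simp
qed

lemma const_if_nonvanishing:
  fixes p :: "complex poly"
  assumes "\<And>s. poly p s \<noteq> 0"
  shows "poly p a = poly p b"
proof -
  have "constant (poly p)" using assms fundamental_theorem_of_algebra by blast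
  then show ?thesis by (auto simp: constant_def)
qed

lemma is_form_keys: "is_form n e p \<Longrightarrow> \<alpha> \<notin> exponents n e \<Longrightarrow> lookup p \<alpha> = 0"
  by (auto simp: is_form_def in_keys_iff)

lemma (in form_degrees) resultant_at_pure_coeffs:
  assumes "resultant_poly R" shows "meval of_int pure_coeffs R = (1 :: complex)"
proof -
  have "(\<lambda>v. of_int (pure_coeffs v)) = (pure_coeffs :: cvar \<Rightarrow> complex)"
    by (auto simp: pure_coeffs_def)
  then show ?thesis
    using comm_ring_hom.hom_meval[OF comm_ring_hom_of_int[where 'a = complex], of of_int pure_coeffs R]
      assms by (simp add: resultant_poly_def)
qed

text \<open>
  Both sides vanish for the same \<open>F\<close>, so that the left-hand side is a power of the resultant of
  \<open>F\<close> up to a constant. The degrees in \<open>F\<^sub>0\<close> show that it is the square, and at the system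
  \<open>x\<^sub>i ^ e\<close> the left-hand side is not affected by scaling \<open>q\<close>, in particular it is the value at
  \<open>q = 0\<close>, which is \<open>(-1) ^ (e ^ n)\<close>.
\<close>

theorem Res_diff_square:
  fixes F :: "nat \<Rightarrow> (nat, complex) mpoly" and q :: "(nat, complex) mpoly"
  assumes n: "0 < n" and e: "0 < e" "even e"
    and F: "\<And>i. i < n \<Longrightarrow> is_form n e (F i)" and q: "is_form n 2 q"
  shows "Res (n + 1) (\<lambda>i. if i < n then e else 2) (\<lambda>i. if i < n then F i else q - mvar n ^ 2) =
    (Res n (\<lambda>_. e) F)\<^sup>2"
proof -
  let ?d = "\<lambda>i. if i < n then e else 2"
  interpret A: form_degrees n "\<lambda>_. e" by unfold_locales (use n e in auto)
  interpret B: form_degrees "n + 1" ?d by unfold_locales (use e in auto)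
  define R where "R = generic_resultant n (\<lambda>_. e)"
  define R' where "R' = generic_resultant (n + 1) ?d"
  have R: "A.resultant_poly R" unfolding R_def by (rule A.resultant_poly_generic)
  have R': "B.resultant_poly R'" unfolding R'_def by (rule B.resultant_poly_generic)
  note id = comm_ring_hom_id
  define Q where "Q = (\<lambda>s. mconst s * q - mvar n ^ 2)"
  have q': "is_form (n + 1) 2 (mconst s * q)" for s
    using is_form_mono[OF q, of "n + 1"] lookup_mult_mconst[of q s]
    by (auto simp: is_form_def in_keys_iff subset_iff mult.commute[of _ q])
  have Q_form: "is_form (n + 1) 2 (Q s)" for s
    unfolding Q_def by (intro is_form_diff q' is_form_mvar_power) simp
  \<comment> \<open>The enlarged system: the monomials of the first \<open>n\<close> forms that
    contain the new variable get coefficient 0, and \<open>q\<close> gets the factor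
    \<open>s\<close>.\<close>
  define ext where "ext = (\<lambda>s c v. if fst v < n then if snd v \<in> exponents n e then c v else 0
    else lookup (Q s) (snd v) :: complex)"
  have exp_sub: "exponents n e \<subseteq> exponents (n + 1) e"
  proof
    fix \<alpha> assume "\<alpha> \<in> exponents n e"
    then have "is_form n e (single \<alpha> (1 :: int))" by (simp add: is_form_def)
    then have "is_form (n + 1) e (single \<alpha> (1 :: int))" by (rule is_form_mono) simp
    then show "\<alpha> \<in> exponents (n + 1) e" by (simp add: is_form_def)
  qed
  have fval_ext: "B.fval (ext s c) x i = A.fval c x i" if "i < n" for s c x i
    unfolding A.fval_def B.fval_def using that exp_sub
    by (intro sum.mono_neutral_cong_right) (auto simp: ext_def)
  have fval_ext_n: "B.fval (ext s c) x n = s * peval x q - (x n)\<^sup>2" for s c x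
  proof -
    interpret ev: comm_ring_hom "peval x :: (nat, complex) mpoly \<Rightarrow> complex"
      by (rule comm_ring_hom_meval[OF id])
    have "B.fval (ext s c) x n = peval x (Q s)"
      unfolding B.fval_def using Q_form[of s]
      by (subst meval_superset[of "exponents (n + 1) 2"]) (auto simp: is_form_def ext_def)
    also have "\<dots> = s * peval x q - (x n)\<^sup>2"
      by (simp add: Q_def ev.hom_minus ev.hom_mult ev.hom_power id)
    finally show ?thesis .
  qed
  \<comment> \<open>If only the last coordinate were nonzero, the last form would reduce to -x_n^2;
    so a nontrivial zero is already nontrivial for \<open>F\<close>.\<close>
  have q_0: "peval x q = 0" if "\<And>j. j < n \<Longrightarrow> x j = 0" for x
  proof -
    have "mon x \<alpha> = 0" if "\<alpha> \<in> keys q" for \<alpha>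
    proof -
      have \<alpha>: "\<alpha> \<in> exponents n 2" using q that by (auto simp: is_form_def)
      then have "(\<Sum>j<n. lookup \<alpha> j) \<noteq> 0" by (simp add: exponents_def)
      then obtain j where "j < n" "lookup \<alpha> j \<noteq> 0" by (meson lessThan_iff sum.neutral)
      then show ?thesis
        unfolding mon_exponents[OF \<alpha>] using \<open>\<And>j. j < n \<Longrightarrow> x j = 0\<close>
        by (intro prod_zero) (auto intro!: bexI[of _ j])
    qed
    then show ?thesis by (simp add: meval_keys)
  qed
  have zero_ext: "B.nontrivial_zero (ext s c) \<longleftrightarrow> A.nontrivial_zero c" for s c
  proof
    assume "B.nontrivial_zero (ext s c)"
    then obtain x k where x: "k < n + 1" "x k \<noteq> 0" "\<And>i. i < n + 1 \<Longrightarrow> B.fval (ext s c) x i = 0"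
      unfolding B.nontrivial_zero_def by blast
    have "\<exists>j<n. x j \<noteq> 0"
    proof (rule ccontr)
      assume *: "\<not> ?thesis"
      then have "peval x q = 0" by (intro q_0) auto
      then have "x n = 0" using x(3)[of n] fval_ext_n[of s c x] by simp
      then show False using x(1,2) * by (auto simp: less_Suc_eq)
    qed
    moreover have "A.fval c x i = 0" if "i < n" for i
      using x(3)[of i] fval_ext[OF that] that by simp
    ultimately show "A.nontrivial_zero c" unfolding A.nontrivial_zero_def by blast
  next
    assume "A.nontrivial_zero c"
    then obtain x k where x: "k < n" "x k \<noteq> 0" "\<And>i. i < n \<Longrightarrow> A.fval c x i = 0"
      unfolding A.nontrivial_zero_def by blast
    \<comment> \<open>A zero of \<open>F\<close> is extended by a square root, which exists over the
      complex numbers.\<close>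
    define y where "y = x(n := csqrt (s * peval x q))"
    have "mon y \<alpha> = mon x \<alpha>" if "\<alpha> \<in> exponents n k" for \<alpha> k
      unfolding mon_exponents[OF that] by (simp add: y_def)
    then have "A.fval c y i = 0" if "i < n" for i
      using x(3)[OF that] unfolding A.fval_def by simp
    moreover have "peval y q = peval x q"
    proof (rule meval_cong)
      fix j assume "j \<in> vars q"
      then have "j < n" using q by (auto simp: vars_def is_form_def exponents_def)
      then show "y j = x j" by (simp add: y_def)
    qed
    then have "B.fval (ext s c) y n = 0"
      unfolding fval_ext_n by (simp add: y_def)
    ultimately have "\<forall>i<n + 1. B.fval (ext s c) y i = 0"
      using fval_ext by (auto simp: less_Suc_eq)
    moreover have "y k \<noteq> 0" using x by (simp add: y_def)
    ultimately show "B.nontrivial_zero (ext s c)"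
      unfolding B.nontrivial_zero_def using x(1) by (intro exI[of _ y] exI[of _ k]) auto
  qed
  \<comment> \<open>This substitution makes the enlarged resultant at \<open>s = 1\<close> a
    polynomial \<open>g\<close> in the coefficients of \<open>F\<close>, so that the Nullstellensatz
    applies to \<open>g\<close>.\<close>
  define \<tau> where "\<tau> = (\<lambda>v. if fst v < n then if snd v \<in> exponents n e then mvar v else 0
    else mconst (lookup (Q 1) (snd v)) :: (cvar, complex) mpoly)"
  define g where "g = meval mconst \<tau> (map_int R')"
  have g: "peval c g = meval of_int (ext 1 c) R'" for c
  proof -
    interpret ev: comm_ring_hom "peval c :: (cvar, complex) mpoly \<Rightarrow> complex"
      by (rule comm_ring_hom_meval[OF id])
    have "(\<lambda>v. peval c (\<tau> v)) = ext 1 c" by (auto simp: \<tau>_def ext_def id)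
    then show ?thesis unfolding g_def meval_meval[OF id] by (simp add: meval_map_int[OF id])
  qed
  have "\<exists>K a. map_int R ^ K = (\<Sum>i<1::nat. a i * g)"
  proof (rule nullstellensatz[OF countable_cvar infinite_cvar])
    fix c assume "\<And>i. i < (1::nat) \<Longrightarrow> peval c g = 0"
    then have "meval of_int (ext 1 c) R' = 0" by (simp add: g)
    then show "peval c (map_int R) = 0"
      using B.resultant_eq_0_iff[OF R'] A.resultant_eq_0_iff[OF R] zero_ext
      by (simp add: meval_map_int[OF id])
  qed
  then obtain K a where "map_int R ^ K = a * g" by auto
  then obtain u k where uk: "g = mconst u * map_int R ^ k"
    using A.divisor_of_resultant_power[OF R] by blast
  have gR: "meval of_int (ext 1 c) R' = u * meval of_int c R ^ k" for c
  proof -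
    interpret ev: comm_ring_hom "peval c :: (cvar, complex) mpoly \<Rightarrow> complex"
      by (rule comm_ring_hom_meval[OF id])
    show ?thesis
      unfolding g[symmetric] uk by (simp add: ev.hom_mult ev.hom_power id meval_map_int[OF id])
  qed
  have pA: "meval of_int A.pure_coeffs R = (1 :: complex)"
    by (rule A.resultant_at_pure_coeffs[OF R])
  have pB: "meval of_int B.pure_coeffs R' = (1 :: complex)"
    by (rule B.resultant_at_pure_coeffs[OF R'])
  have no_zero: "\<not> A.nontrivial_zero A.pure_coeffs"
    using A.resultant_eq_0_iff[OF R, of A.pure_coeffs] pA by simp
  \<comment> \<open>The value at the pure powers, as a polynomial in \<open>s\<close>. It has no
    root because the pure powers have no nontrivial zero, so it is constant.\<close>
  define p where "p = meval (\<lambda>c. [:of_int c:]) (\<lambda>v. if fst v < n then [:ext 0 A.pure_coeffs v:]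
    else [:- lookup (mvar n ^ 2) (snd v), lookup q (snd v):]) R'"
  have p: "poly p s = meval of_int (ext s A.pure_coeffs) R'" for s
  proof -
    have "(\<lambda>v. poly (if fst v < n then [:ext 0 A.pure_coeffs v:]
        else [:- lookup (mvar n ^ 2) (snd v), lookup q (snd v):]) s) = ext s A.pure_coeffs"
      by (auto simp: ext_def Q_def lookup_minus mult.commute[of _ q] lookup_mult_mconst)
    then show ?thesis unfolding p_def comm_ring_hom.hom_meval[OF comm_ring_hom_poly] by simp
  qed
  have "poly p s \<noteq> 0" for s
    unfolding p B.resultant_eq_0_iff[OF R'] zero_ext using no_zero .
  then have "poly p 1 = poly p 0" by (rule const_if_nonvanishing)
  \<comment> \<open>At \<open>s = 0\<close> the last form is -x_n^2, so this is the system of pure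
    powers with one form negated.\<close>
  moreover have "poly p 0 = meval of_int (\<lambda>v. if fst v = n then - 1 * B.pure_coeffs v else B.pure_coeffs v) R'"
    unfolding p
  proof (rule meval_cong)
    fix v assume "v \<in> vars R'"
    then have "v \<in> B.coeff_vars" using B.resultant_vars[OF R'] by (auto simp: mpolys_def)
    then obtain i \<alpha> where v: "v = (i, \<alpha>)" "i < n + 1" unfolding B.coeff_vars_def by blast
    show "ext 0 A.pure_coeffs v = (if fst v = n then - 1 * B.pure_coeffs v else B.pure_coeffs v)"
    proof (cases "i < n")
      case True
      then show ?thesis using v single_in_exponents[of i n e]
        by (auto simp: ext_def A.pure_coeffs_def B.pure_coeffs_def)
    next
      case False
      then have "i = n" using v by simp
      then show ?thesis using v
        by (auto simp: ext_def Q_def B.pure_coeffs_def mvar_power lookup_minus lookup_single when_def)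
    qed
  qed
  then have p0: "poly p 0 = (- 1) ^ (\<Prod>j\<in>{..<n + 1} - {n}. ?d j)"
    unfolding B.resultant_homogeneous[OF R', of n, simplified] by (simp add: pB)
  have "poly p 0 = 1"
  proof -
    have "{..<n + 1} - {n} = {..<n}" by auto
    then have "(\<Prod>j\<in>{..<n + 1} - {n}. ?d j) = e ^ n" by simp
    then show ?thesis using p0 e(2) n by simp
  qed
  ultimately have u: "u = 1" using gR[of A.pure_coeffs] by (simp add: p pA)
  have k: "k = 2"
  proof -
    \<comment> \<open>Doubling F_0 multiplies the enlarged resultant by \<open>2 ^ (2 * ?E)\<close>
      and that of \<open>F\<close> by \<open>2 ^ ?E\<close>, which reveals the exponent
      \<open>k\<close>.\<close>
    define c :: "cvar \<Rightarrow> complex" where "c = (\<lambda>v. if fst v = 0 then 2 * A.pure_coeffs v else A.pure_coeffs v)"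
    let ?E = "\<Prod>j\<in>{..<n} - {0}. e"
    have "ext 1 c = (\<lambda>v. if fst v = 0 then 2 * ext 1 A.pure_coeffs v else ext 1 A.pure_coeffs v)"
      using n by (auto simp: ext_def c_def fun_eq_iff)
    then have "meval of_int (ext 1 c) R' = 2 ^ (\<Prod>j\<in>{..<n + 1} - {0}. ?d j) * meval of_int (ext 1 A.pure_coeffs) R'"
      using B.resultant_homogeneous[OF R', of 0 2 "ext 1 A.pure_coeffs"] by simp
    also have "meval of_int (ext 1 A.pure_coeffs) R' = 1" unfolding gR by (simp add: u pA)
    also have "(\<Prod>j\<in>{..<n + 1} - {0}. ?d j) = 2 * ?E"
    proof -
      have "{..<n + 1} - {0} = insert n ({..<n} - {0})" using n by auto
      then have "(\<Prod>j\<in>{..<n + 1} - {0}. ?d j) = 2 * (\<Prod>j\<in>{..<n} - {0}. ?d j)" by simp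
      also have "(\<Prod>j\<in>{..<n} - {0}. ?d j) = ?E" by (intro prod.cong) auto
      finally show ?thesis .
    qed
    finally have "meval of_int (ext 1 c) R' = 2 ^ (2 * ?E)" by simp
    moreover have "meval of_int c R = 2 ^ ?E"
      using A.resultant_homogeneous[OF R n, of 2 A.pure_coeffs] by (simp add: c_def pA)
    ultimately have "(2 :: complex) ^ (2 * ?E) = 2 ^ (?E * k)"
      using gR[of c] u by (simp add: power_mult)
    then have "of_nat (2 ^ (2 * ?E)) = (of_nat (2 ^ (?E * k)) :: complex)" by simp
    then have "(2 :: nat) ^ (2 * ?E) = 2 ^ (?E * k)" by (simp only: of_nat_eq_iff)
    then have "2 * ?E = ?E * k" by (rule power_inject_exp[THEN iffD1, rotated]) simp
    then show ?thesis using e(1) by auto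
  qed
  define c where "c = (\<lambda>(i, \<alpha>). lookup (F i) \<alpha>)"
  have "Res (n + 1) ?d (\<lambda>i. if i < n then F i else q - mvar n ^ 2) = meval of_int (ext 1 c) R'"
    unfolding Res_def R'_def[symmetric] res_eval_def
    by (rule meval_cong)
       (auto simp: ext_def c_def Q_def mconst.hom_one is_form_keys[OF F] split: prod.splits)
  also have "\<dots> = (meval of_int c R)\<^sup>2" unfolding gR u k by simp
  also have "meval of_int c R = Res n (\<lambda>_. e) F"
    unfolding Res_def R_def c_def res_eval_def ..
  finally show ?thesis .
qed

section \<open>The constant term of the E-characteristic polynomial\<close>

text \<open>The generic resultant is one integer polynomial for all rings, so ring homomorphisms,
  here the passage to the constant coefficient, commute with its evaluation.\<close>

lemma coeff_0_Res:
  "coeff (Res N d F) 0 = Res N d G"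
  if "\<And>i \<alpha>. coeff (lookup (F i) \<alpha>) 0 = lookup (G i) \<alpha>"
proof -
  interpret comm_ring_hom "\<lambda>p :: 'a poly. coeff p 0" by unfold_locales (auto simp: coeff_mult)
  show ?thesis unfolding Res_def res_eval_def hom_meval
    by (simp add: hom_of_int that split_def)
qed

lemma coeff_0_lambda: "coeff (lookup (mconst [:0, 1:] * p) \<alpha>) 0 = (0 :: 'a::comm_ring_1)"
  by (simp add: mult.commute[of _ p] lookup_mult_mconst coeff_mult)

lemma coeff_0_tensor_form:
  "coeff (lookup (tensor_form n m (\<lambda>is. [:A is:]) i) \<alpha>) 0 = lookup (tensor_form n m A i) \<alpha>"
  by (auto simp: lookup_tensor_form coeff_sum when_def intro!: sum.cong)

theorem theorem2:
  fixes m n :: nat and A :: "nat list \<Rightarrow> complex"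
  assumes "m \<ge> 2" and "n \<ge> 1"
  shows "(even m \<longrightarrow>
            coeff (E_char_poly n m A) 0 = Res n (\<lambda>_. m - 1) (tensor_form n m A)) \<and>
         (odd m \<longrightarrow>
            coeff (E_char_poly n m A) 0 = (Res n (\<lambda>_. m - 1) (tensor_form n m A))\<^sup>2)"
proof (intro conjI impI)
  assume "even m"
  then show "coeff (E_char_poly n m A) 0 = Res n (\<lambda>_. m - 1) (tensor_form n m A)"
    unfolding E_char_poly_def Let_def
    by (simp only: if_True, intro coeff_0_Res)
       (simp only: lookup_minus coeff_diff mult.assoc coeff_0_lambda coeff_0_tensor_form diff_0_right)
next
  assume odd: "odd m"
  have "coeff (E_char_poly n m A) 0 = Res (n + 1) (\<lambda>i. if i < n then m - 1 else 2)
      (\<lambda>i. if i < n then tensor_form n m A i else square_sum n - mvar n ^ 2)"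
    unfolding E_char_poly_def Let_def if_not_P[OF odd]
  proof (rule coeff_0_Res)
    fix i \<alpha>
    have "coeff (lookup (square_sum n - mvar n ^ 2) \<alpha>) 0 =
        (lookup (square_sum n - mvar n ^ 2 :: (nat, complex) mpoly) \<alpha>)"
      by (auto simp: lookup_minus lookup_square_sum mvar_power lookup_single coeff_sum when_def coeff_1
          intro!: sum.cong)
    then show "coeff (lookup (if i < n then tensor_form n m (\<lambda>is. [:A is:]) i -
          mconst [:0, 1:] * mvar n ^ (m - 2) * mvar i else square_sum n - mvar n ^ 2) \<alpha>) 0 =
        lookup (if i < n then tensor_form n m A i else square_sum n - mvar n ^ 2) \<alpha>"
      by (simp add: lookup_minus mult.assoc coeff_0_lambda coeff_0_tensor_form)
  qed
  \<comment> \<open>For odd \<open>m\<close> with \<open>m \<ge> 2\<close> the degree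
    \<open>m - 1\<close> is positive and even, as \<open>Res_diff_square\<close> requires.\<close>
  also have "\<dots> = (Res n (\<lambda>_. m - 1) (tensor_form n m A))\<^sup>2"
    using assms odd by (intro Res_diff_square is_form_tensor_form is_form_square_sum) auto
  finally show "coeff (E_char_poly n m A) 0 = (Res n (\<lambda>_. m - 1) (tensor_form n m A))\<^sup>2" .
qed

end
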